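(* Let $\beta>\pi$ and define $\nu_\beta=\frac{\pi}{2\beta-\pi}$. Let $h$ be fixed such that $\frac{\nu_\beta}{2}<h<\min\left(\frac12,\frac{3\nu_\beta}{2}\right)$. Let $K_{D'_\beta}(w,z)$ be the Szegő kernel of $D'_\beta$. Then there exist functions $\rho_1,\rho_2,G_1,\ldots,G_8,E$ and $\widetilde E$ of $(w,z)$ that are holomorphic in $w$ and anti-holomorphic in $z$, for $w=(w_1,w_2)$ and $z=(z_1,z_2)$ varying in a neighborhood of $D'_\beta$, and that remain bounded, together with all their derivatives, for $w,z\in\overline{D'_\beta}$, as $|\operatorname{Re}(w_1-\overline{z_1})|\to+\infty$, such that $$K_{D'_\beta}(w,z)=e^{-\operatorname{sgn}[\operatorname{Re}(w_1-\overline{z_1})]\frac{(w_1-\overline{z_1})\nu_\beta}{2}}K(w,z)+e^{-\operatorname{sgn}[\operatorname{Re}(w_1-\overline{z_1})](w_1-\overline{z_1})h}\widetilde K(w,z),$$ where $$K(w,z)=\frac{\rho_1(w,z)}{e^{\frac{\pi-i(w_1-\overline{z_1})}{2}}-w_2\overline{z_2}}+\frac{\rho_2(w,z)}{e^{-\frac{i(w_1-\overline{z_1})+\pi}{2}}-w_2\overline{z_2}}+E(w,z)$$ and $$\begin{aligned}\widetilde K(w,z)=&\ \frac{G_1(w,z)}{[i(w_1-\overline{z_1})+2\beta][e^{\beta-\frac\pi2}-w_2\overline{z_2}]}+\frac{G_2(w,z)}{[e^{-\frac{i(w_1-\overline{z_1})+\pi}{2}}-w_2\overline{z_2}][i(w_1-\overline{z_1})+2\beta]}\\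 &+\frac{G_3(w,z)}{[e^{\frac{\pi-i(w_1-\overline{z_1})}{2}}-w_2\overline{z_2}][e^{\beta-\frac\pi2}-w_2\overline{z_2}]}+\frac{G_4(w,z)}{[e^{\frac{\pi-i(w_1-\overline{z_1})}{2}}-w_2\overline{z_2}][i(w_1-\overline{z_1})-2\beta]}\\ &+\frac{G_5(w,z)}{[i(w_1-\overline{z_1})-2\beta][e^{-(\beta-\frac\pi2)}-w_2\overline{z_2}]}+\frac{G_6(w,z)}{[e^{-\frac{i(w_1-\overline{z_1})+\pi}{2}}-w_2\overline{z_2}][e^{-(\beta-\frac\pi2)}-w_2\overline{z_2}]}\\ &+\frac{G_7(w,z)}{e^{\frac{\pi-i(w_1-\overline{z_1})}{2}}-w_2\overline{z_2}}+\frac{G_8(w,z)}{e^{-\frac{i(w_1-\overline{z_1})+\pi}{2}}-w_2\overline{z_2}}+\widetilde E(w,z).\end{aligned}$$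
   Context: For $\beta>\frac\pi2$ the non-smooth worm domain is $$D'_\beta=\left\{(z_1,z_2)\in\mathbb{C}^2:\ \left|\operatorname{Im}z_1-\log|z_2|^2\right|<\tfrac\pi2,\ \left|\log|z_2|^2\right|<\beta-\tfrac\pi2\right\}.$$ Its distinguished boundary $\partial D'_\beta=E_1\cup E_2\cup E_3\cup E_4$ consists of the four sets $E_1=\{\operatorname{Im}z_1=\beta,\ \log|z_2|^2=\beta-\frac\pi2\}$, $E_2=\{\operatorname{Im}z_1=\beta-\pi,\ \log|z_2|^2=\beta-\frac\pi2\}$, $E_3=\{\operatorname{Im}z_1=-\beta,\ \log|z_2|^2=-(\beta-\frac\pi2)\}$, $E_4=\{\operatorname{Im}z_1=-(\beta-\pi),\ \log|z_2|^2=-(\beta-\frac\pi2)\}$. The Hardy space $H^2(D'_\beta)$ is the space of holomorphic $F$ on $D'_\beta$ with $\sup_{(t,s)\in[0,\frac\pi2)\times[0,\beta-\frac\pi2)}\mathcal{L}_2F(t,s)<\infty$, where $$\begin{aligned}\mathcal{L}_2F(t,s)=&\int_{\mathbb R}\int_0^1|F(x+i(s+t),e^{\frac s2}e^{2\pi i\theta})|^2\,d\theta dx+\int_{\mathbb R}\int_0^1|F(x-i(s+t),e^{-\frac s2}e^{2\pi i\theta})|^2\,d\theta dx\\&+\int_{\mathbb R}\int_0^1|F(x+i(s-t),e^{\frac s2}e^{2\pi i\theta})|^2\,d\theta dx+\int_{\mathbb R}\int_0^1|F(x-i(s-t),e^{-\frac s2}e^{2\pi i\theta})|^2\,d\theta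 dx.\end{aligned}$$ It is a reproducing kernel Hilbert space with inner product $\langle F,G\rangle=\langle\widetilde F,\widetilde G\rangle_{L^2(\partial D'_\beta)}$, where $\widetilde F,\widetilde G$ are the boundary values of $F,G$ on $\partial D'_\beta$ (and $\partial D'_\beta$ carries the measure $d\theta\,dx$ on each $E_i$, with $x=\operatorname{Re}z_1$, $z_2=|z_2|e^{2\pi i\theta}$). Its reproducing kernel, the Szegő kernel, is (known fact) $$K_{D'_\beta}(w,z)=K_{D'_\beta}[(w_1,w_2),(z_1,z_2)]=\sum_{j\in\mathbb Z}\frac{w_2^j\overline{z_2}^j}{8\pi}\int_{\mathbb R}\frac{e^{i(w_1-\overline{z_1})\xi}}{\cosh[\pi\xi]\cosh[(2\beta-\pi)(\xi-\frac j2)]}\,d\xi,$$ the series converging in $H^2(D'_\beta)$ for every fixed $(z_1,z_2)\in D'_\beta$. Here $\operatorname{sgn}$ is the sign function, with the convention $\operatorname{sgn}(0)=1$.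
   Formalization: The functions ρ₁, ρ₂, G₁,…,G₈, E, Ẽ may depend on sgn[Re(w₁−z̄₁)]: one (anti-)holomorphic family is given for each sign, since a single family for both signs is impossible by the identity theorem. *)

theory Defs
  imports "HOL-Analysis.Analysis"
begin

section \<open>Holomorphic functions of two complex variables\<close>

text \<open>Meant for open \<open>S\<close>: the real Frechet derivative exists and is complex-linear at every
  point of \<open>S\<close>.\<close>

definition holo2_on :: "(complex \<times> complex \<Rightarrow> complex) \<Rightarrow> (complex \<times> complex) set \<Rightarrow> bool" where
  "holo2_on f S \<longleftrightarrow>
     (\<forall>p\<in>S. \<exists>a b. (f has_derivative (\<lambda>v. a * fst v + b * snd v)) (at p))"

definition antiholo2_on :: "(complex \<times> complex \<Rightarrow> complex) \<Rightarrow> (complex \<times> complex) set \<Rightarrow> bool" where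
  "antiholo2_on f S \<longleftrightarrow> holo2_on (\<lambda>p. cnj (f p)) S"

type_synonym kernel = "complex \<times> complex \<Rightarrow> complex \<times> complex \<Rightarrow> complex"

definition holo_antiholo_on :: "kernel \<Rightarrow> (complex \<times> complex) set \<Rightarrow> bool" where
  "holo_antiholo_on f U \<longleftrightarrow>
     (\<forall>z\<in>U. holo2_on (\<lambda>w. f w z) U) \<and> (\<forall>w\<in>U. antiholo2_on (\<lambda>z. f w z) U)"

text \<open>For \<open>f w z\<close> holomorphic in \<open>w\<close> and anti-holomorphic in \<open>z\<close> the Wirtinger derivatives in
  \<open>cnj w\<^sub>k\<close> and in \<open>z\<^sub>k\<close> vanish. The remaining ones are those in \<open>w\<^sub>1\<close>, \<open>w\<^sub>2\<close>, \<open>cnj z\<^sub>1\<close>, \<open>cnj z\<^sub>2\<close>;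
  the last two are complex derivatives with respect to \<open>s = cnj z\<^sub>k\<close>.\<close>

definition d_w1 :: "kernel \<Rightarrow> kernel" where
  "d_w1 f = (\<lambda>w z. deriv (\<lambda>s. f (s, snd w) z) (fst w))"

definition d_w2 :: "kernel \<Rightarrow> kernel" where
  "d_w2 f = (\<lambda>w z. deriv (\<lambda>s. f (fst w, s) z) (snd w))"

definition d_cnj_z1 :: "kernel \<Rightarrow> kernel" where
  "d_cnj_z1 f = (\<lambda>w z. deriv (\<lambda>s. f w (cnj s, snd z)) (cnj (fst z)))"

definition d_cnj_z2 :: "kernel \<Rightarrow> kernel" where
  "d_cnj_z2 f = (\<lambda>w z. deriv (\<lambda>s. f w (fst z, cnj s)) (cnj (snd z)))"


section \<open>The non-smooth worm domain and its Hardy space\<close>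

text \<open>The condition \<open>z\<^sub>2 \<noteq> 0\<close> has to be explicit because \<open>ln 0 = 0\<close>.\<close>

definition worm :: "real \<Rightarrow> (complex \<times> complex) set" where
  "worm \<beta> = {(z1, z2). z2 \<noteq> 0 \<and> \<bar>Im z1 - ln ((cmod z2)\<^sup>2)\<bar> < pi / 2
                        \<and> \<bar>ln ((cmod z2)\<^sup>2)\<bar> < \<beta> - pi / 2}"

text \<open>For signs \<open>a, b \<in> {1, -1}\<close> the map below sends \<open>(x, \<theta>)\<close> to
  \<open>(x + i a (s + b t), e\<^bsup>a s / 2\<^esup> e\<^bsup>2 \<pi> i \<theta>\<^esup>)\<close>. The pairs \<open>(1,1)\<close>, \<open>(-1,1)\<close>, \<open>(1,-1)\<close>, \<open>(-1,-1)\<close> give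
  the four integrals of \<open>L\<^sub>2 F (t, s)\<close>, in this order. For \<open>t = \<pi> / 2\<close>, \<open>s = \<beta> - \<pi> / 2\<close> they
  parametrize the components \<open>E\<^sub>1\<close>, \<open>E\<^sub>3\<close>, \<open>E\<^sub>2\<close>, \<open>E\<^sub>4\<close> of the distinguished boundary.\<close>

definition level_map :: "real \<Rightarrow> real \<Rightarrow> real \<Rightarrow> real \<Rightarrow> real \<times> real \<Rightarrow> complex \<times> complex" where
  "level_map a b t s = (\<lambda>(x, \<theta>).
     (Complex x (a * (s + b * t)), of_real (exp (a * s / 2)) * cis (2 * pi * \<theta>)))"

abbreviation boundary_map :: "real \<Rightarrow> real \<Rightarrow> real \<Rightarrow> real \<times> real \<Rightarrow> complex \<times> complex" where
  "boundary_map \<beta> a b \<equiv> level_map a b (pi / 2) (\<beta> - pi / 2)"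

definition param_measure :: "(real \<times> real) measure" where
  "param_measure = restrict_space lborel (UNIV \<times> {0..1})"

definition L2_level :: "(complex \<times> complex \<Rightarrow> complex) \<Rightarrow> real \<Rightarrow> real \<Rightarrow> ennreal" where
  "L2_level F t s = (\<Sum>a\<in>{1, -1}. \<Sum>b\<in>{1, -1}.
     \<integral>\<^sup>+ p. ennreal ((cmod (F (level_map a b t s p)))\<^sup>2) \<partial>param_measure)"

definition hardy :: "real \<Rightarrow> (complex \<times> complex \<Rightarrow> complex) set" where
  "hardy \<beta> = {F. holo2_on F (worm \<beta>) \<and>
      (SUP (t, s)\<in>{0..<pi / 2} \<times> {0..<\<beta> - pi / 2}. L2_level F t s) < \<infinity>}"

text \<open>Boundary values are taken in the sense of \<open>L\<^sup>2\<close>, as \<open>(t, s)\<close> tends to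
  \<open>(\<pi> / 2, \<beta> - \<pi> / 2)\<close>. They are unique up to null sets on the distinguished boundary, so
  the choice made in \<open>boundary_fun\<close> does not affect \<open>hardy_inner\<close>.\<close>

definition is_boundary_value ::
    "real \<Rightarrow> (complex \<times> complex \<Rightarrow> complex) \<Rightarrow> (complex \<times> complex \<Rightarrow> complex) \<Rightarrow> bool" where
  "is_boundary_value \<beta> F \<phi> \<longleftrightarrow> (\<forall>a\<in>{1, -1}. \<forall>b\<in>{1, -1}.
     (\<lambda>p. \<phi> (boundary_map \<beta> a b p)) \<in> borel_measurable param_measure \<and>
     ((\<lambda>(t, s). \<integral>\<^sup>+ p. ennreal ((cmod (F (level_map a b t s p) - \<phi> (boundary_map \<beta> a b p)))\<^sup>2)
                   \<partial>param_measure) \<longlongrightarrow> 0)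
       (at (pi / 2, \<beta> - pi / 2) within {0..<pi / 2} \<times> {0..<\<beta> - pi / 2}))"

definition boundary_fun ::
    "real \<Rightarrow> (complex \<times> complex \<Rightarrow> complex) \<Rightarrow> complex \<times> complex \<Rightarrow> complex" where
  "boundary_fun \<beta> F = (SOME \<phi>. is_boundary_value \<beta> F \<phi>)"

definition hardy_inner ::
    "real \<Rightarrow> (complex \<times> complex \<Rightarrow> complex) \<Rightarrow> (complex \<times> complex \<Rightarrow> complex) \<Rightarrow> complex" where
  "hardy_inner \<beta> F G = (\<Sum>a\<in>{1, -1}. \<Sum>b\<in>{1, -1}.
     (\<integral>p. boundary_fun \<beta> F (boundary_map \<beta> a b p)
            * cnj (boundary_fun \<beta> G (boundary_map \<beta> a b p)) \<partial>param_measure))"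

text \<open>The Szego kernel is the reproducing kernel of the Hardy space; it is determined on
  \<open>worm \<beta> \<times> worm \<beta>\<close>.\<close>

definition is_szego_kernel :: "real \<Rightarrow> kernel \<Rightarrow> bool" where
  "is_szego_kernel \<beta> K \<longleftrightarrow> (\<forall>z\<in>worm \<beta>. (\<lambda>w. K w z) \<in> hardy \<beta> \<and>
     (\<forall>F\<in>hardy \<beta>. F z = hardy_inner \<beta> F (\<lambda>w. K w z)))"

definition szego_term :: "real \<Rightarrow> int \<Rightarrow> kernel" where
  "szego_term \<beta> j w z =
     (snd w powi j * cnj (snd z) powi j) / (8 * of_real pi) *
     (\<integral>\<xi>. exp (\<i> * (fst w - cnj (fst z)) * of_real \<xi>) /
           of_real (cosh (pi * \<xi>) * cosh ((2 * \<beta> - pi) * (\<xi> - of_int j / 2))) \<partial>lborel)"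


section \<open>Functions in the decomposition\<close>

text \<open>Every derivative remains bounded on the closure of the domain as
  \<open>\<bar>Re (w\<^sub>1 - cnj z\<^sub>1)\<bar> \<longlonglongrightarrow> \<infinity>\<close>. The threshold \<open>R\<close> and the bound \<open>C\<close> may depend on the derivative.\<close>

definition bounded_derivs_at_infinity :: "real \<Rightarrow> kernel \<Rightarrow> bool" where
  "bounded_derivs_at_infinity \<beta> f \<longleftrightarrow> (\<forall>k l m n. \<exists>R C. \<forall>w\<in>closure (worm \<beta>). \<forall>z\<in>closure (worm \<beta>).
     \<bar>Re (fst w - cnj (fst z))\<bar> \<ge> R \<longrightarrow>
       cmod ((d_w1 ^^ k) ((d_w2 ^^ l) ((d_cnj_z1 ^^ m) ((d_cnj_z2 ^^ n) f))) w z) \<le> C)"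

definition admissible :: "real \<Rightarrow> (complex \<times> complex) set \<Rightarrow> kernel \<Rightarrow> bool" where
  "admissible \<beta> U f \<longleftrightarrow> holo_antiholo_on f U \<and> bounded_derivs_at_infinity \<beta> f"

definition sgn1 :: "real \<Rightarrow> real" where
  "sgn1 x = (if x \<ge> 0 then 1 else -1)"

definition nu :: "real \<Rightarrow> real" where
  "nu \<beta> = pi / (2 * \<beta> - pi)"

end

theory Submission
  imports Defs "HOL-Complex_Analysis.Complex_Analysis"
begin

text \<open>Put \<open>u = w\<^sub>1 - cnj z\<^sub>1\<close>, \<open>p = w\<^sub>2 cnj z\<^sub>2\<close>, \<open>c = 2 \<beta> - \<pi>\<close>, so that \<open>\<nu>\<^sub>\<beta> = \<pi> / c\<close>. The kernel is a function
of \<open>u\<close> and \<open>p\<close> only, namely the sum over \<open>j\<close> of \<open>p\<^sup>j / (8 \<pi>)\<close> times the integral of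
\<open>e\<^bsup>iu\<xi>\<^esup> sech (\<pi> \<xi>) sech (c (\<xi> - j / 2))\<close> over the real line, and on the closed domain
\<open>\<bar>Im u - log \<bar>p\<bar>\<^sup>2\<bar> \<le> \<pi>\<close> and \<open>\<bar>log \<bar>p\<bar>\<^sup>2\<bar> \<le> c\<close>.

Leading term. Moving the line of integration to \<open>Im \<xi> = \<sigma> h\<close>, for a sign \<open>\<sigma>\<close>, crosses exactly one
pole, \<open>j / 2 + i \<sigma> \<nu>\<^sub>\<beta> / 2\<close>, of the second factor. The residues carry \<open>e\<^bsup>-\<sigma> u \<nu>\<^sub>\<beta> / 2\<^esup>\<close>, the integrals over
the new line carry \<open>e\<^bsup>-\<sigma> u h\<^esup>\<close> (\<open>line_integral_shift_signed\<close>); both factors decay when \<open>\<sigma>\<close> is the sign of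
\<open>Re u\<close>.
The residues add up to a Laurent series in \<open>q = p e\<^bsup>iu/2\<^esup>\<close> with coefficients
\<open>sech (\<pi> j / 2 + i \<theta>)\<close>. Up to an error of size \<open>e\<^bsup>-3 \<pi> \<bar>j\<bar> / 2\<^esup>\<close> these are two one-sided geometric
sequences, which produce the two poles, while the error produces \<open>E\<close> (\<open>residue_sum\<close>).

The remaining integrals. They are a value of the bilinear pairing
\<open>\<Psi>(\<alpha>, \<beta>) = \<Sum>\<^sub>j p\<^sup>j \<integral> e\<^bsup>iu\<xi>\<^esup> \<alpha>(\<xi>) \<beta>(\<xi> - j / 2) d\<xi>\<close>, and everything rests on the bound
\<open>\<bar>p\<^sup>j e\<^bsup>iu\<xi>\<^esup>\<bar> \<le> exp (\<bar>log \<bar>p\<bar>\<^sup>2\<bar> \<bar>\<xi> - j / 2\<bar> + \<bar>Im u - log \<bar>p\<bar>\<^sup>2\<bar> \<bar>\<xi>\<bar>)\<close>. Hence \<open>\<Psi>\<close> converges inside the domain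
when \<open>\<alpha>\<close> and \<open>\<beta>\<close> decay at the critical rates \<open>\<pi>\<close> and \<open>c\<close>, and it is bounded and holomorphic on a
neighbourhood of the closed domain when both rates are larger (\<open>bholo_pairing\<close>). The shifted
secants split into two one-sided exponentials of exactly critical rate and a rest that decays
three times as fast. Subtracting from a one-sided exponential a multiple of its translate by
\<open>1 / 2\<close> leaves a function supported in an interval of length \<open>1 / 2\<close>, and translating \<open>\<alpha>\<close> or \<open>\<beta>\<close> by
\<open>1 / 2\<close> multiplies \<open>\<Psi>\<close> by a power of \<open>q\<close> or of \<open>p\<close>. So every one-sided exponential costs one
of the denominators \<open>A - p\<close>, \<open>B - p\<close>, \<open>e\<^bsup>c/2\<^esup> - p\<close>, \<open>e\<^bsup>-c/2\<^esup> - p\<close> and leaves a value of \<open>\<Psi>\<close> at rapidly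
decaying functions. For the two products of exponentials on the same side this value is
elementary, and a partial fraction decomposition trades the product of denominators that do not
occur together in the theorem for products with \<open>iu + 2 \<beta>\<close> or \<open>iu - 2 \<beta>\<close>. The nine
products of the three pieces of \<open>\<alpha>\<close> with the three pieces of \<open>\<beta>\<close> give \<open>G\<^sub>1, \<dots>, G\<^sub>8\<close> and the
error term (\<open>pairing_sech\<close>).

Boundedness of derivatives. All coefficients are bounded and holomorphic on one neighbourhood of
the closed domain which has a uniform width. By the Cauchy estimates this property passes to every partial
derivative, at the cost of a smaller width (\<open>sep_bounded_pderivative\<close>).\<close>

section \<open>Cauchy estimates and parameter integrals\<close>

text \<open>Both bounds are proportional to a bound \<open>C\<close> of the function itself. In \<open>holomorphic_lebesgue_integral\<close>
this makes them integrable in the parameter, and in \<open>sep_bounded_pderivative\<close> it makes difference quotients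
converge uniformly.\<close>

lemma cauchy_estimates:
  assumes hol: "f holomorphic_on ball z r" and r: "0 < r"
    and bd: "\<And>x. x \<in> ball z r \<Longrightarrow> cmod (f x) \<le> C"
  shows deriv_bound: "cmod (deriv f z) \<le> 2 * C / r"
    and second_order: "\<And>h. cmod h < r / 2 \<Longrightarrow>
      cmod (f (z + h) - f z - h * deriv f z) \<le> 32 * C / r\<^sup>2 * (cmod h)\<^sup>2"
proof -
  have cauchy: "cmod ((deriv ^^ n) f x) \<le> fact n * C / s ^ n"
    if "cball x s \<subseteq> ball z r" "0 < s" for x s n
  proof (rule Cauchy_inequality)
    show "f holomorphic_on ball x s"
      using that by (intro holomorphic_on_subset[OF hol]) auto
    show "continuous_on (cball x s) f"
      using holomorphic_on_imp_continuous_on[OF hol] that by (auto intro: continuous_on_subset)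
    show "cmod (f y) \<le> C" if "cmod (x - y) = s" for y
      using that \<open>cball x s \<subseteq> ball z r\<close> by (intro bd) (auto simp: dist_norm subset_iff)
  qed (use that in auto)
  show "cmod (deriv f z) \<le> 2 * C / r"
  proof -
    have "cball z (r/2) \<subseteq> ball z r" using r by auto
    from cauchy[OF this, of 1] r show ?thesis by (simp add: mult.commute)
  qed
  show "cmod (f (z + h) - f z - h * deriv f z) \<le> 32 * C / r\<^sup>2 * (cmod h)\<^sup>2" if h: "cmod h < r / 2" for h
  proof -
    have "cmod ((deriv ^^ 0) f (z+h) - (\<Sum>i\<le>1. (deriv ^^ i) f z * ((z+h)-z) ^ i / fact i))
        \<le> (32 * C / r\<^sup>2) * cmod ((z+h) - z) ^ (Suc 1) / fact 1"
    proof (rule complex_Taylor[of "ball z (r/2)"])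
      fix i x assume x: "x \<in> ball z (r/2)"
      have xr: "x \<in> ball z r" using x r by auto
      have "(deriv ^^ i) f holomorphic_on ball z r"
        by (intro holomorphic_higher_deriv hol) auto
      then have "((deriv ^^ i) f has_field_derivative (deriv ^^ Suc i) f x) (at x)"
        using holomorphic_derivI[of _ "ball z r" x] xr by simp
      then show "((deriv ^^ i) f has_field_derivative (deriv ^^ Suc i) f x) (at x within ball z (r / 2))"
        by (rule has_field_derivative_at_within)
    next
      fix x assume x: "x \<in> ball z (r/2)"
      have "cball x (r/4) \<subseteq> ball z r"
      proof
        fix y assume "y \<in> cball x (r/4)"
        then show "y \<in> ball z r" using x r dist_triangle[of z y x] by auto
      qed
      from cauchy[OF this, of 2] r show "cmod ((deriv ^^ Suc 1) f x) \<le> 32 * C / r\<^sup>2"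
        by (simp add: numeral_2_eq_2 power2_eq_square)
    qed (use h r in \<open>auto simp: dist_norm\<close>)
    then show ?thesis by (simp add: algebra_simps power2_eq_square)
  qed
qed

lemma dominated_integral:
  fixes f :: "'a \<Rightarrow> complex"
  assumes f: "f \<in> borel_measurable M" and g: "integrable M g" and le: "\<And>x. cmod (f x) \<le> g x"
  shows "integrable M f" "cmod (\<integral>x. f x \<partial>M) \<le> (\<integral>x. g x \<partial>M)"
proof -
  have "cmod (f x) \<le> norm (g x)" for x using order_trans[OF le abs_ge_self] by simp
  then show i: "integrable M f"
    by (intro Bochner_Integration.integrable_bound[OF g f] AE_I2)
  have "cmod (\<integral>x. f x \<partial>M) \<le> (\<integral>x. cmod (f x) \<partial>M)" by (rule integral_norm_bound)
  also have "\<dots> \<le> (\<integral>x. g x \<partial>M)"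
    by (rule integral_mono[OF integrable_norm[OF i] g le])
  finally show "cmod (\<integral>x. f x \<partial>M) \<le> (\<integral>x. g x \<partial>M)" .
qed

text \<open>The second-order estimate can be integrated against the dominating function, so the integral of
the derivatives is the derivative of the integral. No bound on the derivatives has to be given.\<close>

lemma holomorphic_lebesgue_integral:
  fixes F :: "'a \<Rightarrow> complex \<Rightarrow> complex"
  assumes S: "open S" and hol: "\<And>\<omega>. F \<omega> holomorphic_on S"
    and meas: "\<And>z. z \<in> S \<Longrightarrow> (\<lambda>\<omega>. F \<omega> z) \<in> borel_measurable M"
    and int: "integrable M g" and bd: "\<And>\<omega> z. z \<in> S \<Longrightarrow> cmod (F \<omega> z) \<le> g \<omega>"
  shows "(\<lambda>z. \<integral>\<omega>. F \<omega> z \<partial>M) holomorphic_on S"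
proof -
  have "\<exists>D. ((\<lambda>z. \<integral>\<omega>. F \<omega> z \<partial>M) has_field_derivative D) (at z)" if z: "z \<in> S" for z
  proof -
    obtain r where r: "0 < r" "ball z r \<subseteq> S"
      using S z by (auto simp: open_contains_ball)
    have hol': "F \<omega> holomorphic_on ball z r" for \<omega>
      using hol r holomorphic_on_subset by blast
    have ce: "cmod (deriv (F \<omega>) z) \<le> 2 * g \<omega> / r"
      "\<And>h. cmod h < r / 2 \<Longrightarrow>
      cmod (F \<omega> (z + h) - F \<omega> z - h * deriv (F \<omega>) z) \<le> 32 * g \<omega> / r\<^sup>2 * (cmod h)\<^sup>2" for \<omega>
      using cauchy_estimates[OF hol' r(1), of \<omega> "g \<omega>"] bd r(2) by blast+
    have iF: "integrable M (\<lambda>\<omega>. F \<omega> x)" if "x \<in> S" for x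
      by (rule dominated_integral(1)[OF meas[OF that] int bd[OF that]])
    \<comment> \<open>The derivative is measurable in the parameter as a limit of difference quotients.\<close>
    have dm: "(\<lambda>\<omega>. deriv (F \<omega>) z) \<in> borel_measurable M"
    proof (rule borel_measurable_LIMSEQ_metric)
      define h where "h n = complex_of_real (r / 2 / (real n + 2))" for n
      have h: "cmod (h n) < r / 2" "h n \<noteq> 0" "z + h n \<in> S" for n
      proof -
        have "0 < r / 2 / (real n + 2)" "r / 2 / (real n + 2) < r / 2"
          using r(1) by (auto simp: divide_simps)
        then show 1: "cmod (h n) < r / 2" "h n \<noteq> 0"
          unfolding h_def norm_of_real of_real_eq_0_iff by linarith+
        have "z + h n \<in> ball z r" using 1 r(1) by (auto simp: dist_norm)
        then show "z + h n \<in> S" using r by auto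
      qed
      show "(\<lambda>\<omega>. (F \<omega> (z + h n) - F \<omega> z) / h n) \<in> borel_measurable M" for n
        using meas[OF h(3)] meas[OF z] by measurable
      fix \<omega>
      have "(F \<omega> has_field_derivative deriv (F \<omega>) z) (at z)"
        using holomorphic_derivI[OF hol S z] .
      moreover have "h \<longlonglongrightarrow> 0"
      proof -
        have "(\<lambda>n. r / 2 / (real n + 2)) \<longlonglongrightarrow> 0" by real_asymp
        from tendsto_of_real[OF this, where 'a=complex] show ?thesis unfolding h_def by simp
      qed
      then have "filterlim h (at 0) sequentially"
        using h(2) by (auto simp: filterlim_at)
      ultimately show "(\<lambda>n. (F \<omega> (z + h n) - F \<omega> z) / h n) \<longlonglongrightarrow> deriv (F \<omega>) z"
        unfolding DERIV_def using filterlim_compose by blast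
    qed
    have dint: "integrable M (\<lambda>\<omega>. deriv (F \<omega>) z)"
      by (rule dominated_integral(1)[OF dm _ ce(1)]) (use int in simp)
    define D where "D = (\<integral>\<omega>. deriv (F \<omega>) z \<partial>M)"
    define K where "K = (\<integral>\<omega>. 32 * g \<omega> / r\<^sup>2 \<partial>M)"
    have est: "cmod ((\<integral>\<omega>. F \<omega> (z + h) \<partial>M) - (\<integral>\<omega>. F \<omega> z \<partial>M) - h * D) \<le> K * (cmod h)\<^sup>2"
      if h: "cmod h < r / 2" for h
    proof -
      have "z + h \<in> ball z r" using h r(1) by (auto simp: dist_norm)
      then have zh: "z + h \<in> S" using r by auto
      have "(\<integral>\<omega>. F \<omega> (z + h) \<partial>M) - (\<integral>\<omega>. F \<omega> z \<partial>M) - h * D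
          = (\<integral>\<omega>. F \<omega> (z + h) - F \<omega> z - h * deriv (F \<omega>) z \<partial>M)"
        unfolding D_def using iF[OF z] iF[OF zh] dint by simp
      also have "cmod \<dots> \<le> (\<integral>\<omega>. 32 * g \<omega> / r\<^sup>2 * (cmod h)\<^sup>2 \<partial>M)"
        by (rule order_trans[OF integral_norm_bound integral_mono])
           (use iF[OF z] iF[OF zh] dint int ce(2)[OF h] in auto)
      also have "\<dots> = K * (cmod h)\<^sup>2"
        unfolding K_def by simp
      finally show ?thesis .
    qed
    have "((\<lambda>z. \<integral>\<omega>. F \<omega> z \<partial>M) has_field_derivative D) (at z)"
      unfolding DERIV_def
    proof (subst LIM_zero_iff[symmetric], rule Lim_null_comparison)
      show "((\<lambda>h::complex. K * cmod h) \<longlongrightarrow> 0) (at 0)"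
        by (auto intro!: tendsto_eq_intros)
      have "\<forall>\<^sub>F h in at (0::complex). h \<in> ball 0 (r/2) - {0}"
        using r(1) by (intro eventually_at_in_open) auto
      then show "\<forall>\<^sub>F h in at 0. cmod (((\<integral>\<omega>. F \<omega> (z + h) \<partial>M) - (\<integral>\<omega>. F \<omega> z \<partial>M)) / h - D) \<le> K * cmod h"
      proof eventually_elim
        case (elim h)
        then have h: "cmod h < r/2" "h \<noteq> 0" by auto
        have "((\<integral>\<omega>. F \<omega> (z + h) \<partial>M) - (\<integral>\<omega>. F \<omega> z \<partial>M)) / h - D
           = ((\<integral>\<omega>. F \<omega> (z + h) \<partial>M) - (\<integral>\<omega>. F \<omega> z \<partial>M) - h * D) / h"
          using h by (simp add: field_simps)
        also have "cmod \<dots> \<le> K * (cmod h)\<^sup>2 / cmod h"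
          using est[OF h(1)] h(2) by (auto simp: norm_divide intro!: divide_right_mono)
        also have "\<dots> = K * cmod h" using h(2) by (simp add: power2_eq_square)
        finally show ?case .
      qed
    qed
    then show ?thesis by blast
  qed
  then show ?thesis
    by (meson S field_differentiable_def holomorphic_on_def field_differentiable_at_within)
qed

section \<open>Bounded functions that are holomorphic in each of several variables\<close>

text \<open>The open \<open>r\<close>-neighbourhood of \<open>X\<close> in the supremum distance. The intermediate bound \<open>q\<close> makes the distance
strictly smaller than \<open>r\<close> although there are infinitely many coordinates. Points are sequences,
of which only the first four coordinates will be used; this treats all variables alike.\<close>

definition thickening :: "(nat \<Rightarrow> complex) set \<Rightarrow> real \<Rightarrow> (nat \<Rightarrow> complex) set" where
  "thickening X r = {s. \<exists>t\<in>X. \<exists>q<r. \<forall>i. cmod (s i - t i) \<le> q}"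

definition sep_bounded :: "((nat \<Rightarrow> complex) \<Rightarrow> complex) \<Rightarrow> (nat \<Rightarrow> complex) set \<Rightarrow> bool" where
  "sep_bounded g \<Omega> \<longleftrightarrow> (\<exists>C. \<forall>s\<in>\<Omega>. cmod (g s) \<le> C) \<and>
     (\<forall>s\<in>\<Omega>. \<forall>i. (\<lambda>x. g (s(i := x))) field_differentiable at (s i))"

definition pderivative :: "nat \<Rightarrow> ((nat \<Rightarrow> complex) \<Rightarrow> complex) \<Rightarrow> (nat \<Rightarrow> complex) \<Rightarrow> complex" where
  "pderivative i g s = deriv (\<lambda>x. g (s(i := x))) (s i)"

lemma thickening_update:
  assumes "s \<in> thickening X r'" "cmod (x - s i) < r - r'"
  shows "s(i := x) \<in> thickening X r"
proof -
  from assms(1) obtain t q where t: "t \<in> X" "q < r'" "\<And>i. cmod (s i - t i) \<le> q"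
    by (auto simp: thickening_def)
  have "cmod ((s(i := x)) k - t k) \<le> q + cmod (x - s i)" for k
  proof (cases "k = i")
    case True
    have "x - t i = (x - s i) + (s i - t i)" by simp
    then have "cmod (x - t i) \<le> cmod (x - s i) + cmod (s i - t i)"
      by (metis norm_triangle_ineq)
    with t(3)[of i] True show ?thesis by simp
  next
    case False
    with t(3)[of k] show ?thesis by (simp add: add_increasing2)
  qed
  moreover have "q + cmod (x - s i) < r" using t(2) assms(2) by simp
  ultimately show ?thesis using t(1) unfolding thickening_def by blast
qed

lemma thickening_mono: "r' \<le> r \<Longrightarrow> thickening X r' \<subseteq> thickening X r"
  unfolding thickening_def by force

lemma thickening_base: "t \<in> X \<Longrightarrow> 0 < r \<Longrightarrow> t \<in> thickening X r"
  unfolding thickening_def by (auto intro!: bexI[of _ t] exI[of _ 0])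

lemma sep_bounded_holomorphic:
  assumes g: "sep_bounded g (thickening X r)" and s: "s \<in> thickening X r'"
  shows "(\<lambda>x. g (s(i := x))) holomorphic_on ball (s i) (r - r')"
proof (rule holomorphic_on_subset)
  have "(\<lambda>x. g (s(i := x))) field_differentiable at x" if "x \<in> ball (s i) (r - r')" for x
  proof -
    have "s(i := x) \<in> thickening X r"
      using that by (intro thickening_update[OF s]) (simp add: dist_norm norm_minus_commute)
    then have "(\<lambda>y. g (s(i := x, i := y))) field_differentiable at ((s(i := x)) i)"
      using g unfolding sep_bounded_def by blast
    then show ?thesis by simp
  qed
  then show "(\<lambda>x. g (s(i := x))) holomorphic_on ball (s i) (r - r')"
    by (simp add: holomorphic_on_def field_differentiable_at_within)
qed auto

text \<open>Differentiability of the \<open>i\<close>-th partial derivative in another variable is obtained without joint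
continuity: the difference quotients in the \<open>i\<close>-th variable are holomorphic in the \<open>k\<close>-th one and
converge uniformly, because the second-order estimate is uniform on the thickening.\<close>

lemma sep_bounded_pderivative:
  assumes g: "sep_bounded g (thickening X r)" and r': "r' < r"
  shows "sep_bounded (pderivative i g) (thickening X r')"
proof -
  define \<rho> where "\<rho> = (r - r') / 2"
  \<comment> \<open>Half of the margin is used for the variable of differentiation, the other half for the second variable.\<close>
  define m where "m = r' + \<rho>"
  have \<rho>: "0 < \<rho>" "r - m = \<rho>" "m - r' = \<rho>" "r' \<le> m" "m \<le> r" "\<rho> < r - r'"
    using r' by (auto simp: \<rho>_def m_def field_simps)
  from g obtain C where C: "\<And>s. s \<in> thickening X r \<Longrightarrow> cmod (g s) \<le> C"
    unfolding sep_bounded_def by blast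
  have bd: "cmod (g (s(k := x))) \<le> C" if "s \<in> thickening X m" "x \<in> ball (s k) \<rho>" for s k x
    using that \<rho> by (intro C thickening_update[OF that(1)]) (simp add: dist_norm norm_minus_commute)
  have hol: "(\<lambda>x. g (s(k := x))) holomorphic_on ball (s k) \<rho>" if "s \<in> thickening X m" for s k
    using sep_bounded_holomorphic[OF g that] \<rho> by simp
  have ce: "cmod (pderivative i g s) \<le> 2 * C / \<rho>"
    "\<And>h. cmod h < \<rho> / 2 \<Longrightarrow>
      cmod (g (s(i := s i + h)) - g s - h * pderivative i g s) \<le> 32 * C / \<rho>\<^sup>2 * (cmod h)\<^sup>2"
    if "s \<in> thickening X m" for s
    using cauchy_estimates[OF hol[OF that] \<rho>(1) bd[OF that]] unfolding pderivative_def by auto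
  have "(\<lambda>y. pderivative i g (s(k := y))) field_differentiable at (s k)" if s: "s \<in> thickening X r'" for s k
  proof (cases "k = i")
    case True
    have "deriv (\<lambda>x. g (s(i := x))) holomorphic_on ball (s i) \<rho>"
      using hol[of s i] s thickening_mono[OF \<rho>(4)] by (intro holomorphic_deriv) auto
    then show ?thesis using True \<rho>(1)
      by (auto simp: pderivative_def holomorphic_on_def at_within_open[of _ "ball _ _"])
  next
    case False
    define h where "h n = complex_of_real (\<rho> / 4 / (real n + 1))" for n
    have h: "cmod (h n) < \<rho> / 2" "h n \<noteq> 0" for n
    proof -
      have "0 < \<rho> / 4 / (real n + 1)" "\<rho> / 4 / (real n + 1) < \<rho> / 2"
        using \<rho>(1) by (auto simp: divide_simps add_pos_nonneg)
      then show "cmod (h n) < \<rho> / 2" "h n \<noteq> 0"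
        unfolding h_def norm_of_real of_real_eq_0_iff by linarith+
    qed
    have up: "s(k := y) \<in> thickening X m" if "y \<in> ball (s k) \<rho>" for y
      using that \<rho> by (intro thickening_update[OF s]) (simp add: dist_norm norm_minus_commute)
    have "(\<lambda>y. pderivative i g (s(k := y))) holomorphic_on ball (s k) \<rho>"
    proof (rule holomorphic_uniform_sequence)
      fix n
      have 1: "s(i := s i + h n) \<in> thickening X m"
        using \<rho> h[of n] by (intro thickening_update[OF s]) auto
      have "(\<lambda>y. g (s(i := s i + h n, k := y))) holomorphic_on ball (s k) \<rho>"
        using hol[OF 1, of k] False by simp
      moreover have "(\<lambda>y. g (s(k := y))) holomorphic_on ball (s k) \<rho>"
        using s thickening_mono[OF \<rho>(4)] by (intro hol) auto
      ultimately show "(\<lambda>y. (g (s(i := s i + h n, k := y)) - g (s(k := y))) / h n) holomorphic_on ball (s k) \<rho>"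
        by (intro holomorphic_intros) (auto simp: h)
    next
      fix x assume x: "x \<in> ball (s k) \<rho>"
      then obtain d where d: "0 < d" "cball x d \<subseteq> ball (s k) \<rho>"
        using open_contains_cball by (metis open_ball)
      have "uniform_limit (cball x d) (\<lambda>n y. (g (s(i := s i + h n, k := y)) - g (s(k := y))) / h n)
           (\<lambda>y. pderivative i g (s(k := y))) sequentially"
      proof (rule uniform_limitI)
        fix e :: real assume e: "0 < e"
        have "(\<lambda>n. 32 * C / \<rho>\<^sup>2 * (\<rho> / 4 / (real n + 1))) \<longlonglongrightarrow> 0" by real_asymp
        then have "\<forall>\<^sub>F n in sequentially. 32 * C / \<rho>\<^sup>2 * (\<rho> / 4 / (real n + 1)) < e"
          using e by (rule order_tendstoD)
        then show "\<forall>\<^sub>F n in sequentially. \<forall>y\<in>cball x d.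
          dist ((g (s(i := s i + h n, k := y)) - g (s(k := y))) / h n) (pderivative i g (s(k := y))) < e"
        proof (rule eventually_mono, intro ballI)
          fix n y assume elim: "32 * C / \<rho>\<^sup>2 * (\<rho> / 4 / (real n + 1)) < e" "y \<in> cball x d"
          then have y: "y \<in> ball (s k) \<rho>" using d by blast
          let ?D = "pderivative i g (s(k := y))"
          have "cmod (g (s(i := s i + h n, k := y)) - g (s(k := y)) - h n * ?D)
              \<le> 32 * C / \<rho>\<^sup>2 * (cmod (h n))\<^sup>2"
            using ce(2)[OF up[OF y] h(1)[of n]] False by (simp add: fun_upd_twist)
          then have "cmod (g (s(i := s i + h n, k := y)) - g (s(k := y)) - h n * ?D) / cmod (h n)
              \<le> 32 * C / \<rho>\<^sup>2 * (cmod (h n))\<^sup>2 / cmod (h n)"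
            by (rule divide_right_mono) auto
          also have "\<dots> = 32 * C / \<rho>\<^sup>2 * cmod (h n)"
            using h(2)[of n] by (simp add: power2_eq_square)
          also have "\<dots> = 32 * C / \<rho>\<^sup>2 * (\<rho> / 4 / (real n + 1))"
            unfolding h_def norm_of_real using \<rho>(1) by simp
          finally have "cmod (g (s(i := s i + h n, k := y)) - g (s(k := y)) - h n * ?D) / cmod (h n) < e"
            using elim(1) by linarith
          moreover have "cmod (g (s(i := s i + h n, k := y)) - g (s(k := y)) - h n * ?D) / cmod (h n)
             = dist ((g (s(i := s i + h n, k := y)) - g (s(k := y))) / h n) ?D"
            using h(2)[of n] by (simp add: dist_norm norm_divide[symmetric] diff_divide_distrib)
          ultimately show "dist ((g (s(i := s i + h n, k := y)) - g (s(k := y))) / h n) ?D < e"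
            by simp
        qed
      qed
      then show "\<exists>d>0. cball x d \<subseteq> ball (s k) \<rho> \<and> uniform_limit (cball x d)
          (\<lambda>n y. (g (s(i := s i + h n, k := y)) - g (s(k := y))) / h n)
           (\<lambda>y. pderivative i g (s(k := y))) sequentially"
        using d by blast
    qed auto
    then show ?thesis using \<rho>(1)
      by (auto simp: holomorphic_on_def at_within_open[of _ "ball _ _"])
  qed
  moreover have "\<forall>s\<in>thickening X r'. cmod (pderivative i g s) \<le> 2 * C / \<rho>"
    using ce(1) thickening_mono[OF \<rho>(4)] by blast
  ultimately show ?thesis unfolding sep_bounded_def by blast
qed

lemma sep_bounded_lipschitz:
  assumes g: "sep_bounded g (thickening X r)" and r': "r' < r"
  obtains L \<rho> where "0 < \<rho>" "\<rho> < r - r'" "0 \<le> L"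
    "\<And>s i x. s \<in> thickening X r' \<Longrightarrow> cmod (x - s i) < \<rho> \<Longrightarrow> cmod (g (s(i := x)) - g s) \<le> L * cmod (x - s i)"
proof -
  define \<rho> where "\<rho> = (r - r') / 2"
  have \<rho>: "0 < \<rho>" "\<rho> < r - r'" using r' by (auto simp: \<rho>_def)
  from g obtain C0 where C0: "\<And>s. s \<in> thickening X r \<Longrightarrow> cmod (g s) \<le> C0"
    unfolding sep_bounded_def by blast
  define C where "C = max C0 0"
  have C: "s \<in> thickening X r \<Longrightarrow> cmod (g s) \<le> C" "0 \<le> C" for s using C0[of s] by (auto simp: C_def)
  have "cmod (g (s(i := x)) - g s) \<le> (2 * C / \<rho> + 32 * C / \<rho>\<^sup>2 * \<rho>) * cmod (x - s i)"
    if s: "s \<in> thickening X r'" and x: "cmod (x - s i) < \<rho> / 2" for s i x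
  proof -
    define D where "D = deriv (\<lambda>x. g (s(i := x))) (s i)"
    define h where "h = x - s i"
    have "(\<lambda>x. g (s(i := x))) holomorphic_on ball (s i) \<rho>"
      using sep_bounded_holomorphic[OF g s, of i] \<rho> by (auto elim: holomorphic_on_subset)
    moreover have "cmod (g (s(i := y))) \<le> C" if "y \<in> ball (s i) \<rho>" for y
      using that \<rho> by (intro C thickening_update[OF s]) (simp add: dist_norm norm_minus_commute)
    ultimately have est: "cmod D \<le> 2 * C / \<rho>"
        "cmod h < \<rho> / 2 \<Longrightarrow>
          cmod (g (s(i := s i + h)) - g (s(i := s i)) - h * D) \<le> 32 * C / \<rho>\<^sup>2 * (cmod h)\<^sup>2"
      unfolding D_def using cauchy_estimates[of "\<lambda>x. g (s(i := x))" "s i" \<rho> C] \<rho>(1) by blast+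
    have "cmod h < \<rho> / 2" using x by (simp add: h_def)
    from est(1) est(2)[OF this] have ce: "cmod D \<le> 2 * C / \<rho>"
      "cmod (g (s(i := x)) - g s - h * D) \<le> 32 * C / \<rho>\<^sup>2 * (cmod h)\<^sup>2"
      by (simp_all add: h_def)
    have "cmod (g (s(i := x)) - g s) \<le> cmod (g (s(i := x)) - g s - h * D) + cmod (h * D)"
      by (metis add.commute diff_add_cancel norm_triangle_ineq)
    also have "\<dots> \<le> 32 * C / \<rho>\<^sup>2 * (\<rho> * cmod h) + cmod h * (2 * C / \<rho>)"
    proof (rule add_mono)
      have "(cmod h)\<^sup>2 \<le> \<rho> * cmod h"
        unfolding power2_eq_square using x \<rho> by (intro mult_right_mono) (auto simp: h_def)
      then have "32 * C / \<rho>\<^sup>2 * (cmod h)\<^sup>2 \<le> 32 * C / \<rho>\<^sup>2 * (\<rho> * cmod h)"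
        using C(2) by (intro mult_left_mono) auto
      with ce(2) show "cmod (g (s(i := x)) - g s - h * D) \<le> 32 * C / \<rho>\<^sup>2 * (\<rho> * cmod h)"
        by linarith
      show "cmod (h * D) \<le> cmod h * (2 * C / \<rho>)"
        unfolding norm_mult using ce(1) by (intro mult_left_mono) auto
    qed
    finally show ?thesis unfolding h_def by (simp add: algebra_simps)
  qed
  then show ?thesis using \<rho> C(2) by (intro that[of "\<rho>/2" "2 * C / \<rho> + 32 * C / \<rho>\<^sup>2 * \<rho>"]) auto
qed

text \<open>A bounded function that is holomorphic in each variable is differentiable in pairs of variables: one of
the partial derivatives is again of this kind, hence Lipschitz in each variable, hence continuous
in both.\<close>

lemma sep_bounded_has_derivative:
  assumes g: "sep_bounded g (thickening X r)" and s: "s \<in> thickening X r'" and r': "r' < r" and ik: "i \<noteq> k"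
  shows "((\<lambda>(x, y). g (s(i := x, k := y))) has_derivative
     (\<lambda>(a, b). pderivative i g s * a + pderivative k g s * b)) (at (s i, s k))"
proof -
  define m where "m = (r + r') / 2"
  define m' where "m' = (m + r') / 2"
  have m: "r' < m'" "m' < m" "m < r" using r' by (auto simp: m_def m'_def)
  have gk: "sep_bounded (pderivative k g) (thickening X m)"
    using sep_bounded_pderivative[OF g] m by simp
  obtain \<rho> L where L: "0 < \<rho>" "\<rho> < m - m'" "0 \<le> L"
    "\<And>s i x. s \<in> thickening X m' \<Longrightarrow> cmod (x - s i) < \<rho> \<Longrightarrow>
      cmod (pderivative k g (s(i := x)) - pderivative k g s) \<le> L * cmod (x - s i)"
    using sep_bounded_lipschitz[OF gk] m(2) by metis
  define d where "d = min \<rho> (m' - r')"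
  have d: "0 < d" "d \<le> \<rho>" "d \<le> m' - r'" using L m by (auto simp: d_def)
  define G where "G x y = g (s(i := x, k := y))" for x y
  have in_m': "s(i := x) \<in> thickening X m'" if "x \<in> ball (s i) d" for x
    using that d by (intro thickening_update[OF s]) (simp add: dist_norm norm_minus_commute)
  have in_m: "s(i := x, k := y) \<in> thickening X m" if "x \<in> ball (s i) d" "y \<in> ball (s k) d" for x y
    using that d L ik by (intro thickening_update[OF in_m']) (auto simp: dist_norm norm_minus_commute)
  have sm': "s \<in> thickening X m'" and sm: "s \<in> thickening X m"
    using s thickening_mono[of r' m' X] thickening_mono[of r' m X] m by auto
  define A where "A x y = blinfun_mult_right (pderivative k g (s(i := x, k := y)))" for x y
  have diff: "((\<lambda>x. g (t(j := x))) has_field_derivative pderivative j g t) (at (t j))"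
    if "t \<in> thickening X m" for t j
  proof -
    have "t \<in> thickening X r" using that thickening_mono[of m r X] m by auto
    then show ?thesis using g unfolding sep_bounded_def pderivative_def
      by (simp add: DERIV_deriv_iff_field_differentiable)
  qed
  have "((\<lambda>(x, y). G x y) has_derivative (\<lambda>(tx, ty). pderivative i g s * tx + blinfun_apply (A (s i) (s k)) ty))
      (at (s i, s k) within ball (s i) d \<times> ball (s k) d)"
  proof (rule has_derivative_partialsI)
    show "((\<lambda>x. G x (s k)) has_derivative (*) (pderivative i g s)) (at (s i) within ball (s i) d)"
    proof -
      have "((\<lambda>x. g (s(i := x))) has_field_derivative pderivative i g s) (at (s i) within ball (s i) d)"
        by (rule has_field_derivative_at_within[OF diff[OF sm]])
      moreover have "G x (s k) = g (s(i := x))" for x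
        unfolding G_def using ik by (metis fun_upd_triv fun_upd_twist)
      ultimately show ?thesis by (simp add: has_field_derivative_def)
    qed
  next
    fix x y assume xy: "x \<in> ball (s i) d" "y \<in> ball (s k) d"
    have "((\<lambda>x'. g (s(i := x, k := y, k := x'))) has_field_derivative pderivative k g (s(i := x, k := y)))
        (at ((s(i := x, k := y)) k) within ball (s k) d)"
      by (rule has_field_derivative_at_within[OF diff[OF in_m[OF xy]]])
    then show "((\<lambda>y. G x y) has_derivative blinfun_apply (A x y)) (at y within ball (s k) d)"
      by (simp add: has_field_derivative_def A_def G_def)
  next
    have "((\<lambda>p. pderivative k g (s(i := fst p, k := snd p))) \<longlongrightarrow> pderivative k g s)
       (at (s i, s k) within ball (s i) d \<times> ball (s k) d)"
    proof (rule LIM_zero_cancel, rule Lim_null_comparison)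
      show "((\<lambda>p. L * cmod (snd p - s k) + L * cmod (fst p - s i)) \<longlongrightarrow> 0)
          (at (s i, s k) within ball (s i) d \<times> ball (s k) d)"
        by (rule tendsto_eq_intros tendsto_within_subset[OF _ subset_UNIV] refl | simp)+
      have "cmod (pderivative k g (s(i := fst p, k := snd p)) - pderivative k g s)
         \<le> L * cmod (snd p - s k) + L * cmod (fst p - s i)"
        if p: "p \<in> ball (s i) d \<times> ball (s k) d" for p
      proof -
        from p have p': "fst p \<in> ball (s i) d" "snd p \<in> ball (s k) d" by auto
        have "cmod (pderivative k g (s(i := fst p, k := snd p)) - pderivative k g (s(i := fst p)))
            \<le> L * cmod (snd p - s k)"
          using L(4)[OF in_m'[OF p'(1)], of "snd p" k] p'(2) d ik
          by (auto simp: dist_norm norm_minus_commute)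
        moreover have "cmod (pderivative k g (s(i := fst p)) - pderivative k g s) \<le> L * cmod (fst p - s i)"
          using L(4)[OF sm', of "fst p" i] p'(1) d by (auto simp: dist_norm norm_minus_commute)
        ultimately show ?thesis
          using norm_triangle_ineq[of "pderivative k g (s(i := fst p, k := snd p)) - pderivative k g (s(i := fst p))"
            "pderivative k g (s(i := fst p)) - pderivative k g s"] by simp
      qed
      then show "\<forall>\<^sub>F p in at (s i, s k) within ball (s i) d \<times> ball (s k) d.
        cmod (pderivative k g (s(i := fst p, k := snd p)) - pderivative k g s)
         \<le> L * cmod (snd p - s k) + L * cmod (fst p - s i)"
        by (auto simp: eventually_at_filter)
    qed
    then show "continuous (at (s i, s k) within ball (s i) d \<times> ball (s k) d) (\<lambda>(x, y). A x y)"
      unfolding continuous_within A_def case_prod_unfold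
      by (auto intro!: tendsto_intros bounded_linear.tendsto[OF bounded_linear_blinfun_mult_right])
  qed (use d in auto)
  moreover have "at (s i, s k) within ball (s i) d \<times> ball (s k) d = at (s i, s k)"
    using d by (intro at_within_open open_Times) auto
  ultimately show ?thesis by (simp add: G_def A_def)
qed

section \<open>Kernels near the closure of the worm domain\<close>

text \<open>The complex coordinates in which a kernel that is holomorphic in \<open>w\<close> and anti-holomorphic in \<open>z\<close>
becomes holomorphic. All four derivatives of kernels turn into partial derivatives.\<close>

definition coords :: "complex \<times> complex \<Rightarrow> complex \<times> complex \<Rightarrow> nat \<Rightarrow> complex" where
  "coords w z = (\<lambda>_. 0)(0 := fst w, 1 := snd w, 2 := cnj (fst z), 3 := cnj (snd z))"

definition kernel_of :: "((nat \<Rightarrow> complex) \<Rightarrow> complex) \<Rightarrow> kernel" where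
  "kernel_of g = (\<lambda>w z. g (coords w z))"

lemma coords_simps [simp]:
  "coords w z 0 = fst w" "coords w z (Suc 0) = snd w" "coords w z 2 = cnj (fst z)" "coords w z 3 = cnj (snd z)"
  by (simp_all add: coords_def)

lemma coords_upd [simp]:
  "(coords w z)(0 := s) = coords (s, snd w) z"
  "(coords w z)(Suc 0 := s) = coords (fst w, s) z"
  "(coords w z)(2 := s) = coords w (cnj s, snd z)"
  "(coords w z)(3 := s) = coords w (fst z, cnj s)"
  by (auto simp: coords_def)

lemma derivs_kernel_of:
  "d_w1 (kernel_of g) = kernel_of (pderivative 0 g)"
  "d_w2 (kernel_of g) = kernel_of (pderivative (Suc 0) g)"
  "d_cnj_z1 (kernel_of g) = kernel_of (pderivative 2 g)"
  "d_cnj_z2 (kernel_of g) = kernel_of (pderivative 3 g)"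
  by (simp_all add: kernel_of_def d_w1_def d_w2_def d_cnj_z1_def d_cnj_z2_def pderivative_def)

definition nbhd :: "(complex \<times> complex) set \<Rightarrow> real \<Rightarrow> (complex \<times> complex) set" where
  "nbhd S r = {w. \<exists>w0\<in>S. \<exists>q<r. cmod (fst w - fst w0) \<le> q \<and> cmod (snd w - snd w0) \<le> q}"

abbreviation coord_pairs :: "(complex \<times> complex) set \<Rightarrow> (nat \<Rightarrow> complex) set" where
  "coord_pairs S \<equiv> {coords w z |w z. w \<in> S \<and> z \<in> S}"

lemma open_nbhd: "open (nbhd S r)"
proof -
  have "nbhd S r = (\<Union>w0\<in>S. ball (fst w0) r \<times> ball (snd w0) r)"
  proof -
    have "(\<exists>q<r. cmod (fst w - fst w0) \<le> q \<and> cmod (snd w - snd w0) \<le> q) \<longleftrightarrow>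
      cmod (fst w - fst w0) < r \<and> cmod (snd w - snd w0) < r" for w w0 :: "complex \<times> complex"
      by (auto intro: exI[of _ "max (cmod (fst w - fst w0)) (cmod (snd w - snd w0))"])
    then show ?thesis unfolding nbhd_def by (fastforce simp: dist_norm norm_minus_commute)
  qed
  then show ?thesis by (auto intro!: open_Times)
qed

lemma subset_nbhd: "0 < r \<Longrightarrow> S \<subseteq> nbhd S r"
  unfolding nbhd_def by force

lemma coords_thickening:
  assumes "w \<in> nbhd S r" "z \<in> nbhd S r"
  shows "coords w z \<in> thickening (coord_pairs S) r"
proof -
  from assms obtain w0 z0 q q' where
    *: "w0 \<in> S" "z0 \<in> S" "q < r" "q' < r" "cmod (fst w - fst w0) \<le> q" "cmod (snd w - snd w0) \<le> q"
     "cmod (fst z - fst z0) \<le> q'" "cmod (snd z - snd z0) \<le> q'"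
    unfolding nbhd_def by blast
  then have "0 \<le> q" using norm_ge_zero[of "fst w - fst w0"] by linarith
  with * have "cmod (coords w z i - coords w0 z0 i) \<le> max q q'" for i
    by (auto simp: coords_def complex_cnj_diff[symmetric] simp del: complex_cnj_diff)
  moreover have "max q q' < r" using * by auto
  ultimately show ?thesis using *(1,2) unfolding thickening_def by blast
qed

lemma thickening_coords:
  assumes "s \<in> thickening (coord_pairs S) r"
  shows "(s 0, s (Suc 0)) \<in> nbhd S r" "(cnj (s 2), cnj (s 3)) \<in> nbhd S r"
proof -
  from assms obtain w z q where *: "w \<in> S" "z \<in> S" "q < r" "\<And>i. cmod (s i - coords w z i) \<le> q"
    unfolding thickening_def by blast
  have c: "cmod (cnj (s 2) - fst z) = cmod (s 2 - cnj (fst z))" "cmod (cnj (s 3) - snd z) = cmod (s 3 - cnj (snd z))"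
    by (metis complex_cnj_cnj complex_cnj_diff complex_mod_cnj)+
  show "(s 0, s (Suc 0)) \<in> nbhd S r"
    using *(1,3) *(4)[of 0] *(4)[of "Suc 0"] unfolding nbhd_def by auto
  show "(cnj (s 2), cnj (s 3)) \<in> nbhd S r"
    using *(2,3) *(4)[of 2] *(4)[of 3] c unfolding nbhd_def by (auto intro!: bexI[of _ z] exI[of _ q])
qed

lemma pderivative_funpow:
  assumes "\<exists>r>0. sep_bounded g (thickening X r)"
  shows "\<exists>r>0. sep_bounded ((pderivative i ^^ n) g) (thickening X r)"
proof (induction n)
  case (Suc n)
  then obtain r where "r > 0" "sep_bounded ((pderivative i ^^ n) g) (thickening X r)" by blast
  then have "sep_bounded (pderivative i ((pderivative i ^^ n) g)) (thickening X (r/2))"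
    by (intro sep_bounded_pderivative[of _ _ r]) auto
  then show ?case using \<open>r > 0\<close> by (auto intro!: exI[of _ "r/2"])
qed (use assms in simp)

text \<open>The closure lies in every thickening. So although each derivative costs some width, a derivative of any order
is still bounded on the closed domain.\<close>

lemma admissible_kernel_of:
  assumes g: "sep_bounded g (thickening (coord_pairs (closure (worm \<beta>))) r)" and r: "0 < r'" "r' < r"
  shows "admissible \<beta> (nbhd (closure (worm \<beta>)) r') (kernel_of g)"
proof -
  let ?X = "coord_pairs (closure (worm \<beta>))" and ?U = "nbhd (closure (worm \<beta>)) r'"
  note der = sep_bounded_has_derivative[OF g coords_thickening r(2)]
  have "holo2_on (\<lambda>w. kernel_of g w z) ?U" if z: "z \<in> ?U" for z
    unfolding holo2_on_def
  proof
    fix w assume w: "w \<in> ?U"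
    show "\<exists>a b. ((\<lambda>w. kernel_of g w z) has_derivative (\<lambda>v. a * fst v + b * snd v)) (at w)"
      using der[OF w z, of 0 1] by (auto simp: kernel_of_def case_prod_unfold)
  qed
  moreover have "antiholo2_on (\<lambda>z. kernel_of g w z) ?U" if w: "w \<in> ?U" for w
    unfolding holo2_on_def antiholo2_on_def
  proof
    fix z assume z: "z \<in> ?U"
    let ?a = "pderivative 2 g (coords w z)" and ?b = "pderivative 3 g (coords w z)"
    have "((\<lambda>p. g (coords w (cnj (fst p), cnj (snd p)))) has_derivative (\<lambda>v. ?a * fst v + ?b * snd v))
        (at (cnj (fst z), cnj (snd z)))"
      using der[OF w z, of 2 3] by (simp add: case_prod_unfold)
    moreover have "((\<lambda>p. (cnj (fst p), cnj (snd p))) has_derivative (\<lambda>v. (cnj (fst v), cnj (snd v)))) (at z)"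
      by (auto intro!: derivative_eq_intros)
    ultimately have "((\<lambda>p. g (coords w (cnj (cnj (fst p)), cnj (cnj (snd p))))) has_derivative
        (\<lambda>v. ?a * cnj (fst v) + ?b * cnj (snd v))) (at z)"
      using has_derivative_compose[of "\<lambda>p. (cnj (fst p), cnj (snd p))" _ z UNIV
        "\<lambda>p. g (coords w (cnj (fst p), cnj (snd p)))"] by fastforce
    from has_derivative_cnj[OF this]
    have "((\<lambda>z. cnj (kernel_of g w z)) has_derivative (\<lambda>v. cnj ?a * fst v + cnj ?b * snd v)) (at z)"
      by (simp add: kernel_of_def)
    then show "\<exists>a b. ((\<lambda>z. cnj (kernel_of g w z)) has_derivative (\<lambda>v. a * fst v + b * snd v)) (at z)"
      by blast
  qed
  moreover have "bounded_derivs_at_infinity \<beta> (kernel_of g)"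
    unfolding bounded_derivs_at_infinity_def
  proof (intro allI)
    fix k l m n
    have fp: "(d_w1 ^^ k) (kernel_of g) = kernel_of ((pderivative 0 ^^ k) g)"
     "(d_w2 ^^ k) (kernel_of g) = kernel_of ((pderivative (Suc 0) ^^ k) g)"
     "(d_cnj_z1 ^^ k) (kernel_of g) = kernel_of ((pderivative 2 ^^ k) g)"
     "(d_cnj_z2 ^^ k) (kernel_of g) = kernel_of ((pderivative 3 ^^ k) g)" for k g
      by (induction k) (simp_all add: derivs_kernel_of)
    define G where "G = (pderivative 0 ^^ k) ((pderivative (Suc 0) ^^ l) ((pderivative 2 ^^ m) ((pderivative 3 ^^ n) g)))"
    have "\<exists>r>0. sep_bounded g (thickening ?X r)" using g r by (intro exI[of _ r]) auto
    then have "\<exists>r>0. sep_bounded G (thickening ?X r)" unfolding G_def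
      by (intro pderivative_funpow)
    then obtain r1 C where C: "0 < r1" "\<And>s. s \<in> thickening ?X r1 \<Longrightarrow> cmod (G s) \<le> C"
      unfolding sep_bounded_def by blast
    have "cmod (kernel_of G w z) \<le> C" if "w \<in> closure (worm \<beta>)" "z \<in> closure (worm \<beta>)" for w z
      unfolding kernel_of_def using that C(1) by (intro C(2) thickening_base) blast+
    then show "\<exists>R C. \<forall>w\<in>closure (worm \<beta>). \<forall>z\<in>closure (worm \<beta>).
       \<bar>Re (fst w - cnj (fst z))\<bar> \<ge> R \<longrightarrow>
       cmod ((d_w1 ^^ k) ((d_w2 ^^ l) ((d_cnj_z1 ^^ m) ((d_cnj_z2 ^^ n) (kernel_of g)))) w z) \<le> C"
      unfolding fp G_def[symmetric] by blast
  qed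
  ultimately show ?thesis unfolding admissible_def holo_antiholo_on_def by blast
qed

text \<open>The points \<open>(u, p)\<close> that come from \<open>w\<close> and \<open>z\<close> in the closed domain satisfy
\<open>\<bar>Im u - log \<bar>p\<bar>\<^sup>2\<bar> \<le> \<pi>\<close> and \<open>\<bar>log \<bar>p\<bar>\<^sup>2\<bar> \<le> c\<close>. The margin \<open>1\<close> is an arbitrary choice that is small enough for
the threefold decay of the remainders below.\<close>

definition strip :: "real \<Rightarrow> (complex \<times> complex) set" where
  "strip c = {(u, p). p \<noteq> 0 \<and> \<bar>Im u - ln ((cmod p)\<^sup>2)\<bar> < pi + 1 \<and> \<bar>ln ((cmod p)\<^sup>2)\<bar> < c + 1}"

definition bholo :: "real \<Rightarrow> (complex \<Rightarrow> complex \<Rightarrow> complex) \<Rightarrow> bool" where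
  "bholo c \<Phi> \<longleftrightarrow> (\<exists>C. \<forall>(u, p)\<in>strip c. cmod (\<Phi> u p) \<le> C) \<and>
     (\<forall>(u, p)\<in>strip c. (\<lambda>s. \<Phi> s p) field_differentiable at u \<and> \<Phi> u field_differentiable at p)"

lemma closure_worm:
  assumes "z \<in> closure (worm \<beta>)"
  shows "exp (- ((\<beta> - pi / 2) / 2)) \<le> cmod (snd z)"
    "\<bar>Im (fst z) - ln ((cmod (snd z))\<^sup>2)\<bar> \<le> pi / 2" "\<bar>ln ((cmod (snd z))\<^sup>2)\<bar> \<le> \<beta> - pi / 2"
proof -
  obtain x where x: "\<And>n. x n \<in> worm \<beta>" "x \<longlonglongrightarrow> z"
    using assms unfolding closure_sequential by blast
  have x1: "(\<lambda>n. Im (fst (x n))) \<longlonglongrightarrow> Im (fst z)" and x2: "(\<lambda>n. cmod (snd (x n))) \<longlonglongrightarrow> cmod (snd z)"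
    using x(2) by (auto intro!: tendsto_intros)
  have xw: "snd (x n) \<noteq> 0" "\<bar>Im (fst (x n)) - ln ((cmod (snd (x n)))\<^sup>2)\<bar> < pi / 2"
      "\<bar>ln ((cmod (snd (x n)))\<^sup>2)\<bar> < \<beta> - pi / 2" for n
    using x(1)[of n] unfolding worm_def by (auto simp: case_prod_unfold)
  have "exp (- ((\<beta> - pi / 2) / 2)) \<le> cmod (snd (x n))" for n
  proof -
    have "ln ((cmod (snd (x n)))\<^sup>2) = 2 * ln (cmod (snd (x n)))"
      using xw(1)[of n] by (simp add: ln_realpow)
    then have "- ((\<beta> - pi / 2) / 2) \<le> ln (cmod (snd (x n)))" using xw(3)[of n]
      by (simp add: abs_less_iff field_simps)
    then show ?thesis using xw(1)[of n] by (simp add: ln_ge_iff)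
  qed
  then show 1: "exp (- ((\<beta> - pi / 2) / 2)) \<le> cmod (snd z)"
    using x2 by (intro LIMSEQ_le_const) auto
  then have nz: "cmod (snd z) \<noteq> 0" using exp_gt_zero[of "- ((\<beta> - pi / 2) / 2)"] by linarith
  have l: "(\<lambda>n. ln ((cmod (snd (x n)))\<^sup>2)) \<longlonglongrightarrow> ln ((cmod (snd z))\<^sup>2)"
    using nz x2 by (intro tendsto_ln tendsto_power) auto
  show "\<bar>Im (fst z) - ln ((cmod (snd z))\<^sup>2)\<bar> \<le> pi / 2"
    using less_imp_le[OF xw(2)] by (intro LIMSEQ_le_const2[OF tendsto_rabs[OF tendsto_diff[OF x1 l]]]) blast
  show "\<bar>ln ((cmod (snd z))\<^sup>2)\<bar> \<le> \<beta> - pi / 2"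
    using less_imp_le[OF xw(3)] by (intro LIMSEQ_le_const2[OF tendsto_rabs[OF l]]) blast
qed

text \<open>On the closed domain \<open>\<bar>z\<^sub>2\<bar> \<ge> e\<^bsup>-(\<beta> - \<pi>/2)/2\<^esup>\<close>, so a change of \<open>z\<^sub>2\<close> by at most this radius is a
change by at most one twentieth in relative size, and \<open>log \<bar>z\<^sub>2\<bar>\<^sup>2\<close> changes by less than \<open>1 / 4\<close>. The absolute value
keeps the radius at most \<open>1 / 20\<close> for every \<open>\<beta>\<close>.\<close>

definition worm_radius :: "real \<Rightarrow> real" where
  "worm_radius \<beta> = exp (- (\<bar>\<beta> - pi / 2\<bar> / 2)) / 20"

lemma nbhd_worm:
  assumes "w \<in> nbhd (closure (worm \<beta>)) (worm_radius \<beta>)"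
  shows "snd w \<noteq> 0" "\<bar>Im (fst w) - ln ((cmod (snd w))\<^sup>2)\<bar> < pi / 2 + 1 / 2"
    "\<bar>ln ((cmod (snd w))\<^sup>2)\<bar> < \<beta> - pi / 2 + 1 / 2"
proof -
  from assms obtain z q where z: "z \<in> closure (worm \<beta>)"
    and q: "q < worm_radius \<beta>" "cmod (fst w - fst z) \<le> q" "cmod (snd w - snd z) \<le> q"
    unfolding nbhd_def by blast
  note cl = closure_worm[OF z]
  define a b where "a = cmod (snd w)" and "b = cmod (snd z)"
  have ab: "\<bar>a - b\<bar> \<le> q" using q(3) norm_triangle_ineq3[of "snd w" "snd z"] unfolding a_def b_def by linarith
  have "\<beta> - pi / 2 \<ge> 0" using cl(3) by linarith
  then have e: "20 * worm_radius \<beta> \<le> b" "worm_radius \<beta> \<le> 1 / 20" using cl(1) by (auto simp: worm_radius_def b_def)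
  have "0 < worm_radius \<beta>" by (simp add: worm_radius_def)
  with e ab q have b: "0 < b" "19 / 20 * b \<le> a" "a \<le> 21 / 20 * b" by linarith+
  then have a: "0 < a" by linarith
  then show "snd w \<noteq> 0" by (auto simp: a_def)
  have "ln (a / b) \<le> a / b - 1" using a b by (intro ln_le_minus_one) auto
  also have "\<dots> \<le> 1 / 20" using b by (simp add: field_simps)
  finally have 1: "ln a - ln b \<le> 1 / 20" using a b by (simp add: ln_div)
  have "ln (b / a) \<le> b / a - 1" using a b by (intro ln_le_minus_one) auto
  also have "\<dots> \<le> 1 / 19" using a b by (simp add: field_simps)
  finally have 2: "ln b - ln a \<le> 1 / 19" using a b by (simp add: ln_div)
  have 3: "\<bar>Im (fst w) - Im (fst z)\<bar> \<le> 1 / 20"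
    using q e abs_Im_le_cmod[of "fst w - fst z"] by simp
  have sq: "ln ((cmod (snd w))\<^sup>2) = 2 * ln a" "ln ((cmod (snd z))\<^sup>2) = 2 * ln b"
    using a b unfolding a_def b_def by (simp_all add: ln_realpow)
  show "\<bar>Im (fst w) - ln ((cmod (snd w))\<^sup>2)\<bar> < pi / 2 + 1 / 2"
    using cl(2) 1 2 3 unfolding sq by arith
  show "\<bar>ln ((cmod (snd w))\<^sup>2)\<bar> < \<beta> - pi / 2 + 1 / 2"
    using cl(3) 1 2 3 unfolding sq by arith
qed

lemma admissible_bholo:
  assumes "bholo (2 * \<beta> - pi) \<Phi>"
  shows "admissible \<beta> (nbhd (closure (worm \<beta>)) (worm_radius \<beta> / 2))
    (\<lambda>w z. \<Phi> (fst w - cnj (fst z)) (snd w * cnj (snd z)))"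
proof -
  let ?X = "coord_pairs (closure (worm \<beta>))"
  define g :: "(nat \<Rightarrow> complex) \<Rightarrow> complex" where "g = (\<lambda>s. \<Phi> (s 0 - s 2) (s (Suc 0) * s 3))"
  have strip: "(s 0 - s 2, s (Suc 0) * s 3) \<in> strip (2 * \<beta> - pi)" if "s \<in> thickening ?X (worm_radius \<beta>)" for s
  proof -
    note 1 = nbhd_worm[OF thickening_coords(1)[OF that]] and 2 = nbhd_worm[OF thickening_coords(2)[OF that]]
    have "ln ((cmod (s (Suc 0) * s 3))\<^sup>2) = ln ((cmod (s (Suc 0)))\<^sup>2) + ln ((cmod (s 3))\<^sup>2)"
      using 1(1) 2(1) by (simp add: norm_mult power_mult_distrib ln_mult)
    with 1 2 show ?thesis unfolding strip_def by auto
  qed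
  obtain C where C: "\<And>u p. (u, p) \<in> strip (2 * \<beta> - pi) \<Longrightarrow> cmod (\<Phi> u p) \<le> C"
    and d1: "\<And>u p. (u, p) \<in> strip (2 * \<beta> - pi) \<Longrightarrow> (\<lambda>s. \<Phi> s p) field_differentiable at u"
    and d2: "\<And>u p. (u, p) \<in> strip (2 * \<beta> - pi) \<Longrightarrow> \<Phi> u field_differentiable at p"
    using assms unfolding bholo_def by blast
  have "sep_bounded g (thickening ?X (worm_radius \<beta>))"
    unfolding sep_bounded_def
  proof (intro conjI ballI allI exI)
    show "cmod (g s) \<le> C" if "s \<in> thickening ?X (worm_radius \<beta>)" for s
      unfolding g_def by (rule C[OF strip[OF that]])
  next
    fix s i assume s: "s \<in> thickening ?X (worm_radius \<beta>)"
    let ?u = "s 0 - s 2" and ?p = "s (Suc 0) * s 3"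
    have c1: "(\<lambda>x. \<Phi> (f x) ?p) field_differentiable at (s i)"
      if "f (s i) = ?u" "f field_differentiable at (s i)" for f
      using field_differentiable_compose[of f "s i" "\<lambda>s. \<Phi> s ?p"] that d1[OF strip[OF s]] by (simp add: o_def)
    have c2: "(\<lambda>x. \<Phi> ?u (f x)) field_differentiable at (s i)"
      if "f (s i) = ?p" "f field_differentiable at (s i)" for f
      using field_differentiable_compose[of f "s i" "\<Phi> ?u"] that d2[OF strip[OF s]] by (simp add: o_def)
    consider "i = 0" | "i = Suc 0" | "i = 2" | "i = 3" | "i \<notin> {0, Suc 0, 2, 3}" by blast
    then show "(\<lambda>x. g (s(i := x))) field_differentiable at (s i)"
    proof cases
      case 1
      then show ?thesis unfolding g_def
        using c1[of "\<lambda>x. x - s 2"] by (simp add: field_differentiable_diff field_differentiable_ident)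
    next
      case 2
      then show ?thesis unfolding g_def
        using c2[of "\<lambda>x. x * s 3"] by (simp add: field_differentiable_mult field_differentiable_ident)
    next
      case 3
      then show ?thesis unfolding g_def
        using c1[of "\<lambda>x. s 0 - x"] by (simp add: field_differentiable_diff field_differentiable_ident)
    next
      case 4
      then show ?thesis unfolding g_def
        using c2[of "\<lambda>x. s (Suc 0) * x"] by (simp add: field_differentiable_mult field_differentiable_ident)
    next
      case 5
      then show ?thesis unfolding g_def by simp
    qed
  qed
  then have "admissible \<beta> (nbhd (closure (worm \<beta>)) (worm_radius \<beta> / 2)) (kernel_of g)"
    by (rule admissible_kernel_of) (simp_all add: worm_radius_def)
  then show ?thesis by (simp add: kernel_of_def g_def)
qed

section \<open>Bounded holomorphic functions of \<open>u\<close> and \<open>p\<close>\<close>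

lemma bholoI:
  assumes "\<And>u p. (u, p) \<in> strip c \<Longrightarrow> cmod (\<Phi> u p) \<le> C"
    and "\<And>u p. (u, p) \<in> strip c \<Longrightarrow> (\<lambda>s. \<Phi> s p) field_differentiable at u"
    and "\<And>u p. (u, p) \<in> strip c \<Longrightarrow> \<Phi> u field_differentiable at p"
  shows "bholo c \<Phi>"
  using assms unfolding bholo_def by blast

lemma bholo_bounded:
  assumes "bholo c \<Phi>"
  shows "\<exists>C\<ge>0. \<forall>u p. (u, p) \<in> strip c \<longrightarrow> cmod (\<Phi> u p) \<le> C"
proof -
  from assms obtain C where C: "\<forall>u p. (u, p) \<in> strip c \<longrightarrow> cmod (\<Phi> u p) \<le> C"
    unfolding bholo_def by blast
  then show ?thesis by (intro exI[of _ "max 0 C"]) (auto simp: le_max_iff_disj)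
qed

lemma bholo_diff1: "bholo c \<Phi> \<Longrightarrow> (u, p) \<in> strip c \<Longrightarrow> (\<lambda>s. \<Phi> s p) field_differentiable at u"
  and bholo_diff2: "bholo c \<Phi> \<Longrightarrow> (u, p) \<in> strip c \<Longrightarrow> (\<lambda>s. \<Phi> u s) field_differentiable at p"
  unfolding bholo_def by blast+

lemma bholo_const: "bholo c (\<lambda>u p. k)"
  by (rule bholoI[of _ _ "cmod k"]) auto

lemma bholo_add:
  assumes "bholo c \<Phi>" "bholo c \<Psi>"
  shows "bholo c (\<lambda>u p. \<Phi> u p + \<Psi> u p)"
proof -
  from assms(1) obtain C where C: "0 \<le> C" "\<forall>u p. (u, p) \<in> strip c \<longrightarrow> cmod (\<Phi> u p) \<le> C"
    using bholo_bounded by blast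
  from assms(2) obtain D where D: "0 \<le> D" "\<forall>u p. (u, p) \<in> strip c \<longrightarrow> cmod (\<Psi> u p) \<le> D"
    using bholo_bounded by blast
  show ?thesis
  proof (rule bholoI)
    fix u p assume up: "(u, p) \<in> strip c"
    note d1 = bholo_diff1[OF assms(1) up] bholo_diff1[OF assms(2) up]
    note d2 = bholo_diff2[OF assms(1) up] bholo_diff2[OF assms(2) up]
    show "cmod (\<Phi> u p + \<Psi> u p) \<le> C + D"
      using C D up by (intro norm_triangle_mono) auto
    show "(\<lambda>s. \<Phi> s p + \<Psi> s p) field_differentiable at u" by (intro field_differentiable_add d1)
    show "(\<lambda>s. \<Phi> u s + \<Psi> u s) field_differentiable at p" by (intro field_differentiable_add d2)
  qed
qed

lemma bholo_mult:
  assumes "bholo c \<Phi>" "bholo c \<Psi>"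
  shows "bholo c (\<lambda>u p. \<Phi> u p * \<Psi> u p)"
proof -
  from assms(1) obtain C where C: "0 \<le> C" "\<forall>u p. (u, p) \<in> strip c \<longrightarrow> cmod (\<Phi> u p) \<le> C"
    using bholo_bounded by blast
  from assms(2) obtain D where D: "0 \<le> D" "\<forall>u p. (u, p) \<in> strip c \<longrightarrow> cmod (\<Psi> u p) \<le> D"
    using bholo_bounded by blast
  show ?thesis
  proof (rule bholoI)
    fix u p assume up: "(u, p) \<in> strip c"
    note d1 = bholo_diff1[OF assms(1) up] bholo_diff1[OF assms(2) up]
    note d2 = bholo_diff2[OF assms(1) up] bholo_diff2[OF assms(2) up]
    show "cmod (\<Phi> u p * \<Psi> u p) \<le> C * D"
      using C D up by (auto simp: norm_mult intro!: mult_mono)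
    show "(\<lambda>s. \<Phi> s p * \<Psi> s p) field_differentiable at u" by (intro field_differentiable_mult d1)
    show "(\<lambda>s. \<Phi> u s * \<Psi> u s) field_differentiable at p" by (intro field_differentiable_mult d2)
  qed
qed

lemma bholo_uminus: "bholo c \<Phi> \<Longrightarrow> bholo c (\<lambda>u p. - \<Phi> u p)"
  using bholo_mult[OF bholo_const[of c "-1"], of \<Phi>] by simp

lemma bholo_diff: "bholo c \<Phi> \<Longrightarrow> bholo c \<Psi> \<Longrightarrow> bholo c (\<lambda>u p. \<Phi> u p - \<Psi> u p)"
  using bholo_add[OF _ bholo_uminus, of c \<Phi> \<Psi>] by simp

lemma strip_Im: "(u, p) \<in> strip c \<Longrightarrow> \<bar>Im u\<bar> \<le> pi + c + 2"
  by (auto simp: strip_def)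

lemma cmod_eq_exp: "p \<noteq> 0 \<Longrightarrow> cmod p = exp (ln ((cmod p)\<^sup>2) / 2)"
  by (simp add: ln_realpow)

lemma bholo_exp: "bholo c (\<lambda>u p. exp (a + of_real k * \<i> * u))"
proof (rule bholoI)
  fix u p assume "(u, p) \<in> strip c"
  then have "\<bar>k * Im u\<bar> \<le> \<bar>k\<bar> * (pi + c + 2)"
    unfolding abs_mult by (intro mult_left_mono strip_Im) auto
  then show "cmod (exp (a + of_real k * \<i> * u)) \<le> exp (Re a + \<bar>k\<bar> * (pi + c + 2))" by auto
qed (auto intro!: derivative_intros field_differentiable_compose[of _ _ exp, unfolded o_def]
      field_differentiable_within_exp)

lemma bholo_snd: "bholo c (\<lambda>u p. p)"
proof (rule bholoI)
  fix u p assume "(u, p) \<in> strip c"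
  then show "cmod p \<le> exp ((c + 1) / 2)"
    by (subst cmod_eq_exp) (auto simp: strip_def)
qed auto

lemma open_strip: "open (strip c)"
proof -
  have lt: "open {x. x \<in> UNIV \<times> (UNIV - {0}) \<and> f x < (k::real)}"
    if "continuous_on (UNIV \<times> (UNIV - {0})) f" for f :: "complex \<times> complex \<Rightarrow> real" and k
  proof -
    have "open (UNIV \<times> (UNIV - {0::complex}) :: (complex \<times> complex) set)"
      by (intro open_Times) auto
    from continuous_open_preimage[OF that this, of "{..<k}"] show ?thesis
      by (simp add: vimage_def Int_def)
  qed
  have eq: "strip c = {x. x \<in> UNIV \<times> (UNIV - {0}) \<and> \<bar>Im (fst x) - ln ((cmod (snd x))\<^sup>2)\<bar> < pi + 1}
     \<inter> {x. x \<in> UNIV \<times> (UNIV - {0}) \<and> \<bar>ln ((cmod (snd x))\<^sup>2)\<bar> < c + 1}"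
    by (auto simp: strip_def)
  show ?thesis unfolding eq
  proof (rule open_Int)
    show "open {x::complex \<times> complex. x \<in> UNIV \<times> (UNIV - {0}) \<and> \<bar>Im (fst x) - ln ((cmod (snd x))\<^sup>2)\<bar> < pi + 1}"
      by (rule lt) (auto intro!: continuous_intros)
    show "open {x::complex \<times> complex. x \<in> UNIV \<times> (UNIV - {0}) \<and> \<bar>ln ((cmod (snd x))\<^sup>2)\<bar> < c + 1}"
      by (rule lt) (auto intro!: continuous_intros)
  qed
qed

lemma open_strip_slices: "open {s. (s, p) \<in> strip c}" "open {s. (u, s) \<in> strip c}"
proof -
  have "open ((\<lambda>s. (s, p)) -` strip c)" "open ((\<lambda>s. (u, s)) -` strip c)"
    by (intro open_vimage[OF open_strip] continuous_intros)+
  then show "open {s. (s, p) \<in> strip c}" "open {s. (u, s) \<in> strip c}" by (simp_all add: vimage_def)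
qed

lemma bholo_cong:
  assumes \<Phi>: "bholo c \<Phi>" and eq: "\<And>u p. (u, p) \<in> strip c \<Longrightarrow> \<Phi> u p = \<Psi> u p"
  shows "bholo c \<Psi>"
proof -
  from \<Phi> obtain C where C: "0 \<le> C" "\<forall>u p. (u, p) \<in> strip c \<longrightarrow> cmod (\<Phi> u p) \<le> C"
    using bholo_bounded by blast
  have tr: "g field_differentiable at x"
    if "f field_differentiable at x" "open S" "x \<in> S" "\<And>y. y \<in> S \<Longrightarrow> f y = g y"
    for f g :: "complex \<Rightarrow> complex" and S x
  proof -
    from that(1) obtain D where "(f has_field_derivative D) (at x)" unfolding field_differentiable_def ..
    from has_field_derivative_transform_within_open[OF this that(2,3,4)]
    show ?thesis unfolding field_differentiable_def by blast
  qed
  show ?thesis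
  proof (rule bholoI)
    fix u p assume up: "(u, p) \<in> strip c"
    show "cmod (\<Psi> u p) \<le> C" using C(2) up eq[OF up] by metis
    show "(\<lambda>s. \<Psi> s p) field_differentiable at u"
      by (rule tr[OF bholo_diff1[OF \<Phi> up] open_strip_slices(1)[of p c]]) (use up eq in auto)
    show "\<Psi> u field_differentiable at p"
      by (rule tr[OF bholo_diff2[OF \<Phi> up] open_strip_slices(2)[of u c]]) (use up eq in auto)
  qed
qed

lemma bholo_integral:
  fixes F :: "'a \<Rightarrow> complex \<Rightarrow> complex \<Rightarrow> complex"
  assumes meas: "\<And>u p. (u, p) \<in> strip c \<Longrightarrow> (\<lambda>\<omega>. F \<omega> u p) \<in> borel_measurable M"
    and int: "integrable M g" and bd: "\<And>\<omega> u p. (u, p) \<in> strip c \<Longrightarrow> cmod (F \<omega> u p) \<le> g \<omega>"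
    and d1: "\<And>\<omega> u p. (u, p) \<in> strip c \<Longrightarrow> (\<lambda>s. F \<omega> s p) field_differentiable at u"
    and d2: "\<And>\<omega> u p. (u, p) \<in> strip c \<Longrightarrow> F \<omega> u field_differentiable at p"
  shows "bholo c (\<lambda>u p. \<integral>\<omega>. F \<omega> u p \<partial>M)"
proof (rule bholoI)
  fix u p assume up: "(u, p) \<in> strip c"
  show "cmod (\<integral>\<omega>. F \<omega> u p \<partial>M) \<le> (\<integral>\<omega>. g \<omega> \<partial>M)"
    by (rule dominated_integral(2)[OF meas[OF up] int bd[OF up]])
  let ?S = "{s. (s, p) \<in> strip c}" and ?T = "{s. (u, s) \<in> strip c}"
  have S: "open ?S" and T: "open ?T" by (rule open_strip_slices)+
  have "(\<lambda>s. \<integral>\<omega>. F \<omega> s p \<partial>M) holomorphic_on ?S"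
    by (rule holomorphic_lebesgue_integral[OF S _ _ int])
       (use meas bd d1 in \<open>auto simp: holomorphic_on_def intro: field_differentiable_at_within\<close>)
  then show "(\<lambda>s. \<integral>\<omega>. F \<omega> s p \<partial>M) field_differentiable at u"
    using S up by (auto simp: holomorphic_on_def at_within_open[of _ ?S])
  have "(\<lambda>s. \<integral>\<omega>. F \<omega> u s \<partial>M) holomorphic_on ?T"
    by (rule holomorphic_lebesgue_integral[OF T _ _ int])
       (use meas bd d2 in \<open>auto simp: holomorphic_on_def intro: field_differentiable_at_within\<close>)
  then show "(\<lambda>s. \<integral>\<omega>. F \<omega> u s \<partial>M) field_differentiable at p"
    using T up by (auto simp: holomorphic_on_def at_within_open[of _ ?T])
qed

text \<open>A sum is an integral for the counting measure.\<close>

lemma bholo_infsum: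
  fixes F :: "'a \<Rightarrow> complex \<Rightarrow> complex \<Rightarrow> complex"
  assumes sum: "g summable_on UNIV" and bd: "\<And>j u p. (u, p) \<in> strip c \<Longrightarrow> cmod (F j u p) \<le> g j"
    and d1: "\<And>j u p. (u, p) \<in> strip c \<Longrightarrow> (\<lambda>s. F j s p) field_differentiable at u"
    and d2: "\<And>j u p. (u, p) \<in> strip c \<Longrightarrow> F j u field_differentiable at p"
  shows "bholo c (\<lambda>u p. \<Sum>\<^sub>\<infinity>j. F j u p)"
proof (cases "strip c = {}")
  case True
  then show ?thesis by (simp add: bholo_def)
next
  case False
  then have g0: "0 \<le> g j" for j
    using bd order_trans[OF norm_ge_zero] by fast
  have "Infinite_Sum.abs_summable_on g UNIV" using sum g0 by simp
  then have int: "integrable (count_space UNIV) g"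
    unfolding abs_summable_equivalent by (simp add: abs_summable_on_def)
  have "bholo c (\<lambda>u p. \<integral>j. F j u p \<partial>count_space UNIV)"
    by (rule bholo_integral[OF _ int bd d1 d2]) auto
  then show ?thesis
  proof (rule bholo_cong)
    fix u p assume up: "(u, p) \<in> strip c"
    have "(\<lambda>j. norm (F j u p)) summable_on UNIV"
      using bd[OF up] by (intro summable_on_comparison_test[OF sum]) auto
    then have "Infinite_Set_Sum.abs_summable_on (\<lambda>j. F j u p) UNIV"
      by (simp add: abs_summable_equivalent[symmetric])
    from infsetsum_infsum[OF this]
    show "(\<integral>j. F j u p \<partial>count_space UNIV) = (\<Sum>\<^sub>\<infinity>j. F j u p)" by (simp add: infsetsum_def)
  qed
qed

section \<open>The pairing of two decaying functions\<close>

lemma integrable_exp_abs: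
  assumes a: "0 < a"
  shows "integrable lborel (\<lambda>x::real. exp (- (a * \<bar>x\<bar>)))"
proof -
  define g :: "real \<Rightarrow> real" where "g = (\<lambda>x. indicator {0..} x * exp (- a * x))"
  have meas: "g \<in> borel_measurable lborel" unfolding g_def by measurable
  have "(\<lambda>x. exp (- a * x)) integrable_on {0..}"
    by (rule integrable_on_exp_minus_to_infinity[OF a])
  then have "(\<lambda>x. exp (- a * x)) absolutely_integrable_on {0..}"
    by (rule nonnegative_absolutely_integrable_1) simp
  then have "integrable lebesgue g"
    unfolding set_integrable_def g_def real_scaleR_def .
  then have 1: "integrable lborel g"
    by (rule iffD1[OF integrable_completion[OF meas]])
  then have 2: "integrable lborel (\<lambda>x. g (0 + (-1) * x))"
    by (rule lborel_integrable_real_affine) simp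
  show ?thesis
  proof (rule Bochner_Integration.integrable_bound[OF Bochner_Integration.integrable_add[OF 1 2]])
    show "(\<lambda>x. exp (- (a * \<bar>x\<bar>))) \<in> borel_measurable lborel" by measurable
    have "exp (- (a * \<bar>x\<bar>)) \<le> g x + g (0 + (-1) * x)" for x
      by (cases "0 \<le> x") (auto simp: g_def indicator_def)
    moreover have "0 \<le> g x" for x by (simp add: g_def)
    ultimately show "AE x in lborel. norm (exp (- (a * \<bar>x\<bar>))) \<le> norm (g x + g (0 + (-1) * x))"
      by (intro AE_I2) (metis abs_exp_cancel abs_ge_self order_trans real_norm_def)
  qed
qed

lemma summable_exp_abs_int:
  assumes a: "0 < a"
  shows "(\<lambda>j::int. exp (- (a * \<bar>real_of_int j\<bar>))) summable_on UNIV"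
proof -
  have "summable (\<lambda>n. exp (- a) ^ n)" using a by (intro summable_geometric) simp
  moreover have "exp (- a) ^ n = exp (- (a * real n))" for n
    by (simp add: exp_of_nat_mult[symmetric] mult.commute)
  ultimately have "(\<lambda>n::nat. exp (- (a * real n))) summable_on UNIV"
    by (simp add: summable_on_UNIV_nonneg_real_iff)
  then have s: "((\<lambda>j::int. exp (- (a * \<bar>real_of_int j\<bar>))) \<circ> int) summable_on UNIV"
      "((\<lambda>j::int. exp (- (a * \<bar>real_of_int j\<bar>))) \<circ> (\<lambda>n. - int n)) summable_on UNIV"
    by (simp_all add: o_def)
  have 1: "(\<lambda>j::int. exp (- (a * \<bar>real_of_int j\<bar>))) summable_on (range int)"
    by (rule iffD2[OF summable_on_reindex s(1)]) (simp add: inj_def)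
  have 2: "(\<lambda>j::int. exp (- (a * \<bar>real_of_int j\<bar>))) summable_on (range (\<lambda>n. - int n))"
    by (rule iffD2[OF summable_on_reindex s(2)]) (simp add: inj_def)
  have "(UNIV::int set) = range int \<union> (range (\<lambda>n. - int n) - range int)"
  proof -
    have "j \<in> range int \<union> (range (\<lambda>n. - int n) - range int)" for j :: int
    proof (cases "0 \<le> j")
      case True
      then have "j = int (nat j)" by simp
      then show ?thesis by blast
    next
      case False
      then have "j = - int (nat (- j))" "j \<notin> range int" by auto
      then show ?thesis by blast
    qed
    then show ?thesis by blast
  qed
  moreover have "(\<lambda>j::int. exp (- (a * \<bar>real_of_int j\<bar>))) summable_on (range (\<lambda>n. - int n) - range int)"
    by (rule summable_on_subset_banach[OF 2]) blast
  ultimately show ?thesis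
    using summable_on_Un_disjoint[OF 1, of "range (\<lambda>n. - int n) - range int"] by fastforce
qed

definition decay :: "real \<Rightarrow> (real \<Rightarrow> complex) \<Rightarrow> bool" where
  "decay \<kappa> \<alpha> \<longleftrightarrow> \<alpha> \<in> borel_measurable borel \<and> (\<exists>C. \<forall>x. cmod (\<alpha> x) \<le> C * exp (- (\<kappa> * \<bar>x\<bar>)))"

lemma decay_measurable: "decay \<kappa> \<alpha> \<Longrightarrow> \<alpha> \<in> borel_measurable borel"
  by (simp add: decay_def)

lemma decay_bound:
  assumes "decay \<kappa> \<alpha>"
  shows "\<exists>C\<ge>0. \<forall>x. cmod (\<alpha> x) \<le> C * exp (- (\<kappa> * \<bar>x\<bar>))"
proof -
  from assms obtain C where C: "\<forall>x. cmod (\<alpha> x) \<le> C * exp (- (\<kappa> * \<bar>x\<bar>))" unfolding decay_def by blast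
  have "0 \<le> C * exp (- (\<kappa> * \<bar>0\<bar>))" using order_trans[OF norm_ge_zero C[rule_format]] .
  then show ?thesis using C by (intro exI[of _ C]) simp
qed

lemma decay_mono: "decay \<kappa> \<alpha> \<Longrightarrow> \<kappa>' \<le> \<kappa> \<Longrightarrow> decay \<kappa>' \<alpha>"
proof -
  assume d: "decay \<kappa> \<alpha>" and le: "\<kappa>' \<le> \<kappa>"
  from decay_bound[OF d] obtain C where C: "0 \<le> C" "\<forall>x. cmod (\<alpha> x) \<le> C * exp (- (\<kappa> * \<bar>x\<bar>))" by blast
  have "cmod (\<alpha> x) \<le> C * exp (- (\<kappa>' * \<bar>x\<bar>))" for x
  proof -
    have "C * exp (- (\<kappa> * \<bar>x\<bar>)) \<le> C * exp (- (\<kappa>' * \<bar>x\<bar>))"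
      using C(1) le by (intro mult_left_mono) (auto intro!: mult_right_mono)
    then show ?thesis using C(2) order_trans by blast
  qed
  then show ?thesis using d unfolding decay_def by blast
qed

lemma decay_add:
  assumes "decay \<kappa> \<alpha>" "decay \<kappa> \<beta>"
  shows "decay \<kappa> (\<lambda>x. \<alpha> x + \<beta> x)"
proof -
  from assms obtain C D where C: "\<forall>x. cmod (\<alpha> x) \<le> C * exp (- (\<kappa> * \<bar>x\<bar>))" "\<forall>x. cmod (\<beta> x) \<le> D * exp (- (\<kappa> * \<bar>x\<bar>))"
    unfolding decay_def by blast
  have "cmod (\<alpha> x + \<beta> x) \<le> (C + D) * exp (- (\<kappa> * \<bar>x\<bar>))" for x
    unfolding distrib_right using C by (intro norm_triangle_mono) auto
  then show ?thesis using assms unfolding decay_def by (auto intro!: exI[of _ "C + D"])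
qed

lemma decay_cmult:
  assumes "decay \<kappa> \<alpha>"
  shows "decay \<kappa> (\<lambda>x. k * \<alpha> x)"
proof -
  from assms obtain C where C: "\<forall>x. cmod (\<alpha> x) \<le> C * exp (- (\<kappa> * \<bar>x\<bar>))"
    unfolding decay_def by blast
  have "cmod (k * \<alpha> x) \<le> (cmod k * C) * exp (- (\<kappa> * \<bar>x\<bar>))" for x
    unfolding norm_mult mult.assoc using C by (intro mult_left_mono) auto
  moreover have "(\<lambda>x. k * \<alpha> x) \<in> borel_measurable borel"
    using decay_measurable[OF assms] by simp
  ultimately show ?thesis unfolding decay_def by blast
qed

lemma decay_shift:
  assumes "decay \<kappa> \<alpha>" "0 \<le> \<kappa>"
  shows "decay \<kappa> (\<lambda>x. \<alpha> (x + h))"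
proof -
  from decay_bound[OF assms(1)] obtain C where C: "0 \<le> C" "\<forall>x. cmod (\<alpha> x) \<le> C * exp (- (\<kappa> * \<bar>x\<bar>))" by blast
  have "cmod (\<alpha> (x + h)) \<le> (C * exp (\<kappa> * \<bar>h\<bar>)) * exp (- (\<kappa> * \<bar>x\<bar>))" for x
  proof -
    have "\<kappa> * \<bar>x\<bar> \<le> \<kappa> * (\<bar>x + h\<bar> + \<bar>h\<bar>)" using assms(2) by (intro mult_left_mono) auto
    then have "exp (- (\<kappa> * \<bar>x + h\<bar>)) \<le> exp (\<kappa> * \<bar>h\<bar> + - (\<kappa> * \<bar>x\<bar>))" by (simp add: algebra_simps)
    then have "C * exp (- (\<kappa> * \<bar>x + h\<bar>)) \<le> C * exp (\<kappa> * \<bar>h\<bar> + - (\<kappa> * \<bar>x\<bar>))"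
      using C(1) by (rule mult_left_mono)
    then show ?thesis using C(2) order_trans unfolding exp_add mult.assoc by blast
  qed
  moreover have "(\<lambda>x. \<alpha> (x + h)) \<in> borel_measurable borel" using decay_measurable[OF assms(1)] by simp
  ultimately show ?thesis unfolding decay_def by blast
qed

text \<open>For \<open>\<alpha> = sech (\<pi> \<xi>)\<close> and \<open>\<beta> = sech (c \<xi>)\<close> the pairing is \<open>8 \<pi>\<close> times the Szego kernel. Keeping the two
functions arbitrary allows to cut them into pieces and to translate them. The factor
\<open>p\<^sup>j\<close> stands inside the integral, where it balances the growth of \<open>e\<^bsup>iu\<xi>\<^esup>\<close>.\<close>

definition pairing_integrand :: "(real \<Rightarrow> complex) \<Rightarrow> (real \<Rightarrow> complex) \<Rightarrow> int \<Rightarrow> complex \<Rightarrow> complex \<Rightarrow> real \<Rightarrow> complex" where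
  "pairing_integrand \<alpha> \<beta> j u p = (\<lambda>\<xi>. p powi j * (exp (\<i> * u * of_real \<xi>) * \<alpha> \<xi> * \<beta> (\<xi> - of_int j / 2)))"

definition pairing_term :: "(real \<Rightarrow> complex) \<Rightarrow> (real \<Rightarrow> complex) \<Rightarrow> int \<Rightarrow> complex \<Rightarrow> complex \<Rightarrow> complex" where
  "pairing_term \<alpha> \<beta> j u p = (\<integral>\<xi>. pairing_integrand \<alpha> \<beta> j u p \<xi> \<partial>lborel)"

definition pairing :: "(real \<Rightarrow> complex) \<Rightarrow> (real \<Rightarrow> complex) \<Rightarrow> complex \<Rightarrow> complex \<Rightarrow> complex" where
  "pairing \<alpha> \<beta> u p = (\<Sum>\<^sub>\<infinity>j. pairing_term \<alpha> \<beta> j u p)"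

lemma norm_power_int_exp:
  assumes "p \<noteq> 0"
  shows "cmod (p powi j * exp (\<i> * u * of_real \<xi>)) = exp (ln ((cmod p)\<^sup>2) * (of_int j / 2) - Im u * \<xi>)"
proof -
  have "cmod (p powi j) = exp (ln (cmod p)) powi j"
    using assms by (simp add: norm_power_int)
  also have "\<dots> = exp (of_int j * ln (cmod p))" by (rule exp_power_int)
  also have "of_int j * ln (cmod p) = ln ((cmod p)\<^sup>2) * (of_int j / 2)"
    using assms by (simp add: ln_realpow)
  finally have 1: "cmod (p powi j) = exp (ln ((cmod p)\<^sup>2) * (of_int j / 2))" .
  have 2: "cmod (exp (\<i> * u * of_real \<xi>)) = exp (- (Im u * \<xi>))" by simp
  show ?thesis unfolding norm_mult 1 2 exp_add[symmetric] by simp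
qed

text \<open>Write \<open>P = log \<bar>p\<bar>\<^sup>2\<close>. Then \<open>\<bar>p\<^sup>j e\<^bsup>iu\<xi>\<^esup>\<bar> = exp (P (j / 2 - \<xi>) + (P - Im u) \<xi>)\<close>, and the two summands are
absorbed by the decay of \<open>\<beta>(\<xi> - j / 2)\<close> and of \<open>\<alpha>(\<xi>)\<close>. The surplus \<open>\<epsilon> (\<bar>\<xi> - j / 2\<bar> + \<bar>\<xi>\<bar>)\<close> is at least
\<open>\<epsilon> \<bar>j\<bar> / 4 + \<epsilon> \<bar>\<xi>\<bar> / 2\<close>, so the bound separates \<open>j\<close> from \<open>\<xi>\<close>.\<close>

lemma pairing_integrand_bound:
  assumes \<alpha>: "0 \<le> C" "\<And>x. cmod (\<alpha> x) \<le> C * exp (- (\<kappa> * \<bar>x\<bar>))"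
    and \<beta>: "0 \<le> D" "\<And>x. cmod (\<beta> x) \<le> D * exp (- (\<mu> * \<bar>x\<bar>))"
    and p: "p \<noteq> 0" "\<bar>Im u - ln ((cmod p)\<^sup>2)\<bar> \<le> \<kappa> - \<epsilon>" "\<bar>ln ((cmod p)\<^sup>2)\<bar> \<le> \<mu> - \<epsilon>" and \<epsilon>: "0 \<le> \<epsilon>"
  shows "cmod (pairing_integrand \<alpha> \<beta> j u p \<xi>)
     \<le> C * D * (exp (- (\<epsilon> / 4 * \<bar>real_of_int j\<bar>)) * exp (- (\<epsilon> / 2 * \<bar>\<xi>\<bar>)))"
proof -
  define P where "P = ln ((cmod p)\<^sup>2)"
  define y where "y = real_of_int j / 2"
  have "cmod (pairing_integrand \<alpha> \<beta> j u p \<xi>)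
      = cmod (p powi j * exp (\<i> * u * of_real \<xi>)) * cmod (\<alpha> \<xi>) * cmod (\<beta> (\<xi> - y))"
    by (simp add: pairing_integrand_def norm_mult y_def)
  also have "\<dots> \<le> exp (P * y - Im u * \<xi>) * (C * exp (- (\<kappa> * \<bar>\<xi>\<bar>))) * (D * exp (- (\<mu> * \<bar>\<xi> - y\<bar>)))"
    unfolding norm_power_int_exp[OF p(1)] P_def y_def
    using \<alpha> \<beta> by (intro mult_mono) (auto intro!: mult_nonneg_nonneg)
  also have "\<dots> = C * D * exp (P * y - Im u * \<xi> - \<kappa> * \<bar>\<xi>\<bar> - \<mu> * \<bar>\<xi> - y\<bar>)"
    by (simp add: exp_diff exp_minus exp_add field_simps)
  also have "\<dots> \<le> C * D * exp (- (\<epsilon> / 4 * \<bar>real_of_int j\<bar>) + - (\<epsilon> / 2 * \<bar>\<xi>\<bar>))"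
  proof (intro mult_left_mono iffD2[OF exp_le_cancel_iff])
    have 1: "P * (y - \<xi>) \<le> (\<mu> - \<epsilon>) * \<bar>\<xi> - y\<bar>"
      using abs_ge_self[of "P * (y - \<xi>)"] mult_right_mono[OF p(3), of "\<bar>\<xi> - y\<bar>"]
      by (simp add: abs_mult abs_minus_commute P_def)
    have 2: "(P - Im u) * \<xi> \<le> (\<kappa> - \<epsilon>) * \<bar>\<xi>\<bar>"
      using abs_ge_self[of "(P - Im u) * \<xi>"] mult_right_mono[OF p(2), of "\<bar>\<xi>\<bar>"]
      by (simp add: abs_mult abs_minus_commute P_def)
    have "\<epsilon> * (\<bar>y\<bar> / 2 + \<bar>\<xi>\<bar> / 2) \<le> \<epsilon> * (\<bar>\<xi> - y\<bar> + \<bar>\<xi>\<bar>)"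
      using \<epsilon> by (intro mult_left_mono) auto
    then have 3: "\<epsilon> / 4 * \<bar>real_of_int j\<bar> + \<epsilon> / 2 * \<bar>\<xi>\<bar> \<le> \<epsilon> * \<bar>\<xi> - y\<bar> + \<epsilon> * \<bar>\<xi>\<bar>"
      by (simp add: y_def algebra_simps)
    show "P * y - Im u * \<xi> - \<kappa> * \<bar>\<xi>\<bar> - \<mu> * \<bar>\<xi> - y\<bar> \<le> - (\<epsilon> / 4 * \<bar>real_of_int j\<bar>) + - (\<epsilon> / 2 * \<bar>\<xi>\<bar>)"
      using 1 2 3 by (simp add: algebra_simps)
  qed (use \<alpha> \<beta> in auto)
  finally show ?thesis by (simp only: exp_add)
qed

lemma pairing_integrand_measurable:
  assumes "decay \<kappa> \<alpha>" "decay \<mu> \<beta>"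
  shows "pairing_integrand \<alpha> \<beta> j u p \<in> borel_measurable lborel"
proof -
  note [measurable] = decay_measurable[OF assms(1)] decay_measurable[OF assms(2)]
  show ?thesis unfolding pairing_integrand_def by measurable
qed

lemma pairing_estimates:
  assumes \<alpha>: "decay \<kappa> \<alpha>" and \<beta>: "decay \<mu> \<beta>" and p: "p \<noteq> 0"
    and lt: "\<bar>Im u - ln ((cmod p)\<^sup>2)\<bar> < \<kappa>" "\<bar>ln ((cmod p)\<^sup>2)\<bar> < \<mu>"
  shows pairing_integrable: "integrable lborel (pairing_integrand \<alpha> \<beta> j u p)"
    and pairing_has_sum: "((\<lambda>j. pairing_term \<alpha> \<beta> j u p) has_sum pairing \<alpha> \<beta> u p) UNIV"
proof -
  define \<epsilon> where "\<epsilon> = min (\<kappa> - \<bar>Im u - ln ((cmod p)\<^sup>2)\<bar>) (\<mu> - \<bar>ln ((cmod p)\<^sup>2)\<bar>)"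
  have \<epsilon>: "0 < \<epsilon>" "\<bar>Im u - ln ((cmod p)\<^sup>2)\<bar> \<le> \<kappa> - \<epsilon>" "\<bar>ln ((cmod p)\<^sup>2)\<bar> \<le> \<mu> - \<epsilon>"
    using lt by (auto simp: \<epsilon>_def)
  obtain C where C: "0 \<le> C" "\<forall>x. cmod (\<alpha> x) \<le> C * exp (- (\<kappa> * \<bar>x\<bar>))" using decay_bound[OF \<alpha>] by blast
  obtain D where D: "0 \<le> D" "\<forall>x. cmod (\<beta> x) \<le> D * exp (- (\<mu> * \<bar>x\<bar>))" using decay_bound[OF \<beta>] by blast
  note bd = pairing_integrand_bound[OF C(1) C(2)[rule_format] D(1) D(2)[rule_format] p \<epsilon>(2,3) less_imp_le[OF \<epsilon>(1)]]
  let ?g = "\<lambda>j \<xi>. C * D * (exp (- (\<epsilon> / 4 * \<bar>real_of_int j\<bar>)) * exp (- (\<epsilon> / 2 * \<bar>\<xi>\<bar>)))"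
  have ie: "integrable lborel (\<lambda>\<xi>. exp (- (\<epsilon> / 2 * \<bar>\<xi>\<bar>)))"
    by (rule integrable_exp_abs) (use \<epsilon>(1) in simp)
  have ig: "integrable lborel (?g j)" for j
    by (intro integrable_mult_right ie)
  note dom = dominated_integral[OF pairing_integrand_measurable[OF \<alpha> \<beta>] ig bd]
  show i: "integrable lborel (pairing_integrand \<alpha> \<beta> j u p)" for j
    by (rule dom(1))
  define K where "K = C * D * (\<integral>\<xi>. exp (- (\<epsilon> / 2 * \<bar>\<xi>\<bar>)) \<partial>lborel)"
  have nb: "cmod (pairing_term \<alpha> \<beta> j u p) \<le> K * exp (- (\<epsilon> / 4 * \<bar>real_of_int j\<bar>))" for j
  proof -
    have "cmod (pairing_term \<alpha> \<beta> j u p) \<le> (\<integral>\<xi>. ?g j \<xi> \<partial>lborel)"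
      unfolding pairing_term_def by (rule dom(2))
    also have "\<dots> = K * exp (- (\<epsilon> / 4 * \<bar>real_of_int j\<bar>))"
      unfolding K_def integral_mult_right_zero by (simp only: mult_ac)
    finally show ?thesis .
  qed
  have "(\<lambda>j. K * exp (- (\<epsilon> / 4 * \<bar>real_of_int j\<bar>))) summable_on UNIV"
    using \<epsilon>(1) by (intro summable_on_cmult_right summable_exp_abs_int) auto
  then have "(\<lambda>j. norm (pairing_term \<alpha> \<beta> j u p)) summable_on UNIV"
    by (rule summable_on_comparison_test[OF _ nb norm_ge_zero])
  then show "((\<lambda>j. pairing_term \<alpha> \<beta> j u p) has_sum pairing \<alpha> \<beta> u p) UNIV"
    unfolding pairing_def by (rule has_sum_infsum[OF abs_summable_summable])
qed

text \<open>On the strip the rates \<open>\<pi> + 2\<close> and \<open>c + 2\<close> exceed what is needed by \<open>1\<close>, so one dominating function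
serves all points of the strip.\<close>

lemma bholo_pairing:
  assumes \<alpha>: "decay (pi + 2) \<alpha>" and \<beta>: "decay (c + 2) \<beta>"
  shows "bholo c (pairing \<alpha> \<beta>)"
proof -
  obtain C where C: "0 \<le> C" "\<forall>x. cmod (\<alpha> x) \<le> C * exp (- ((pi + 2) * \<bar>x\<bar>))" using decay_bound[OF \<alpha>] by blast
  obtain D where D: "0 \<le> D" "\<forall>x. cmod (\<beta> x) \<le> D * exp (- ((c + 2) * \<bar>x\<bar>))" using decay_bound[OF \<beta>] by blast
  let ?g = "\<lambda>j \<xi>. C * D * (exp (- (1 / 4 * \<bar>real_of_int j\<bar>)) * exp (- (1 / 2 * \<bar>\<xi>\<bar>)))"
  have bd: "cmod (pairing_integrand \<alpha> \<beta> j u p \<xi>) \<le> ?g j \<xi>" if "(u, p) \<in> strip c" for j u p \<xi>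
    using that by (intro pairing_integrand_bound[OF C(1) C(2)[rule_format] D(1) D(2)[rule_format], where \<epsilon> = 1]) (auto simp: strip_def)
  have ie: "integrable lborel (\<lambda>\<xi>::real. exp (- (1 / 2 * \<bar>\<xi>\<bar>)))"
    by (rule integrable_exp_abs) simp
  have ig: "integrable lborel (?g j)" for j
    by (intro integrable_mult_right ie)
  have bt: "bholo c (pairing_term \<alpha> \<beta> j)" for j
    unfolding pairing_term_def
  proof (rule bholo_integral[OF _ ig[of j]])
    show "(\<lambda>\<xi>. pairing_integrand \<alpha> \<beta> j u p \<xi>) \<in> borel_measurable lborel" for u p
      by (rule pairing_integrand_measurable[OF \<alpha> \<beta>])
    show "cmod (pairing_integrand \<alpha> \<beta> j u p \<xi>) \<le> ?g j \<xi>" if "(u, p) \<in> strip c" for u p \<xi>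
      by (rule bd[OF that])
    show "(\<lambda>s. pairing_integrand \<alpha> \<beta> j s p \<xi>) field_differentiable at u" for \<xi> u p
      unfolding pairing_integrand_def field_differentiable_def
      by (rule exI) (rule derivative_eq_intros refl | simp)+
    show "(\<lambda>s. pairing_integrand \<alpha> \<beta> j u s \<xi>) field_differentiable at p" if "(u, p) \<in> strip c" for \<xi> u p
      using that unfolding pairing_integrand_def field_differentiable_def
      by (intro exI) (rule derivative_eq_intros refl | simp add: strip_def)+
  qed
  define K where "K = C * D * (\<integral>\<xi>. exp (- (1 / 2 * \<bar>\<xi>\<bar>)) \<partial>lborel)"
  have nb: "cmod (pairing_term \<alpha> \<beta> j u p) \<le> K * exp (- (1 / 4 * \<bar>real_of_int j\<bar>))"
    if up: "(u, p) \<in> strip c" for j u p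
  proof -
    have "cmod (pairing_term \<alpha> \<beta> j u p) \<le> (\<integral>\<xi>. ?g j \<xi> \<partial>lborel)"
      unfolding pairing_term_def
      by (rule dominated_integral(2)[OF pairing_integrand_measurable[OF \<alpha> \<beta>] ig bd[OF up]])
    also have "\<dots> = K * exp (- (1 / 4 * \<bar>real_of_int j\<bar>))"
      unfolding K_def integral_mult_right_zero by (simp only: mult_ac)
    finally show ?thesis .
  qed
  show ?thesis unfolding pairing_def
  proof (rule bholo_infsum[OF _ nb])
    show "(\<lambda>j. K * exp (- (1 / 4 * \<bar>real_of_int j\<bar>))) summable_on UNIV"
      by (intro summable_on_cmult_right summable_exp_abs_int) auto
  qed (use bholo_diff1[OF bt] bholo_diff2[OF bt] in auto)
qed

text \<open>Substituting \<open>\<xi> + 1 / 2\<close> for \<open>\<xi>\<close> translates both functions; the translation of \<open>\<beta>\<close> is undone by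
\<open>j \<mapsto> j - 1\<close>. The identity holds even where the sum diverges, because the default values of integrals and sums
are compatible with these substitutions.\<close>

lemma pairing_shift_first:
  assumes p: "p \<noteq> 0"
  shows "pairing (\<lambda>x. \<alpha> (x - 1 / 2)) \<beta> u p = p * exp (\<i> * u / 2) * pairing \<alpha> \<beta> u p"
proof -
  have t: "pairing_term (\<lambda>x. \<alpha> (x - 1 / 2)) \<beta> j u p = p * exp (\<i> * u / 2) * pairing_term \<alpha> \<beta> (j - 1) u p" for j
  proof -
    have "pairing_term (\<lambda>x. \<alpha> (x - 1 / 2)) \<beta> j u p
      = (\<integral>\<xi>. pairing_integrand (\<lambda>x. \<alpha> (x - 1 / 2)) \<beta> j u p (1/2 + 1 * \<xi>) \<partial>lborel)"
      unfolding pairing_term_def by (subst lborel_integral_real_affine[where c = 1 and t = "1/2"]) auto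
    also have "\<dots> = (\<integral>\<xi>. p * exp (\<i> * u / 2) * pairing_integrand \<alpha> \<beta> (j - 1) u p \<xi> \<partial>lborel)"
    proof (rule arg_cong[where f = "integral\<^sup>L lborel"], rule ext)
      fix \<xi> :: real
      have e: "exp (\<i> * u * of_real (1/2 + 1 * \<xi>)) = exp (\<i> * u / 2) * exp (\<i> * u * of_real \<xi>)"
        unfolding exp_add[symmetric] by (simp add: algebra_simps)
      define q where "q = p powi (j - 1)"
      have pj: "p powi j = p * q"
        using p by (simp add: power_int_diff q_def)
      have b: "\<beta> (1/2 + 1 * \<xi> - of_int j / 2) = \<beta> (\<xi> - of_int (j - 1) / 2)"
        by (rule arg_cong[where f = \<beta>]) (simp add: field_simps)
      show "pairing_integrand (\<lambda>x. \<alpha> (x - 1 / 2)) \<beta> j u p (1/2 + 1 * \<xi>)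
         = p * exp (\<i> * u / 2) * pairing_integrand \<alpha> \<beta> (j - 1) u p \<xi>"
        unfolding pairing_integrand_def e b pj q_def[symmetric] by simp
    qed
    finally show ?thesis by (simp add: pairing_term_def)
  qed
  have "pairing (\<lambda>x. \<alpha> (x - 1 / 2)) \<beta> u p = p * exp (\<i> * u / 2) * (\<Sum>\<^sub>\<infinity>j. pairing_term \<alpha> \<beta> (j - 1) u p)"
    unfolding pairing_def t by (rule infsum_cmult_right')
  also have "(\<Sum>\<^sub>\<infinity>j. pairing_term \<alpha> \<beta> (j - 1) u p) = pairing \<alpha> \<beta> u p"
    unfolding pairing_def by (rule infsum_reindex_bij_betw) (auto simp: bij_betw_def surj_def intro: exI[of _ "_ + 1"])
  finally show ?thesis .
qed

lemma pairing_shift_second: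
  assumes p: "p \<noteq> 0"
  shows "pairing \<alpha> (\<lambda>x. \<beta> (x + 1 / 2)) u p = p * pairing \<alpha> \<beta> u p"
proof -
  have t: "pairing_term \<alpha> (\<lambda>x. \<beta> (x + 1 / 2)) j u p = p * pairing_term \<alpha> \<beta> (j - 1) u p" for j
  proof -
    define q where "q = p powi (j - 1)"
    have pj: "p powi j = p * q"
      using p by (simp add: power_int_diff q_def)
    have b: "\<beta> (\<xi> - of_int j / 2 + 1 / 2) = \<beta> (\<xi> - of_int (j - 1) / 2)" for \<xi> :: real
      by (rule arg_cong[where f = \<beta>]) (simp add: field_simps)
    have "pairing_integrand \<alpha> (\<lambda>x. \<beta> (x + 1 / 2)) j u p = (\<lambda>\<xi>. p * pairing_integrand \<alpha> \<beta> (j - 1) u p \<xi>)"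
      unfolding pairing_integrand_def b pj q_def[symmetric] by (simp add: mult_ac)
    then show ?thesis by (simp add: pairing_term_def)
  qed
  have "pairing \<alpha> (\<lambda>x. \<beta> (x + 1 / 2)) u p = p * (\<Sum>\<^sub>\<infinity>j. pairing_term \<alpha> \<beta> (j - 1) u p)"
    unfolding pairing_def t by (rule infsum_cmult_right')
  also have "(\<Sum>\<^sub>\<infinity>j. pairing_term \<alpha> \<beta> (j - 1) u p) = pairing \<alpha> \<beta> u p"
    unfolding pairing_def by (rule infsum_reindex_bij_betw) (auto simp: bij_betw_def surj_def intro: exI[of _ "_ + 1"])
  finally show ?thesis .
qed

lemma pairing_linear_first:
  assumes \<alpha>: "decay \<kappa> \<alpha>" "decay \<kappa> \<alpha>'" and \<beta>: "decay \<mu> \<beta>" and p: "p \<noteq> 0"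
    and lt: "\<bar>Im u - ln ((cmod p)\<^sup>2)\<bar> < \<kappa>" "\<bar>ln ((cmod p)\<^sup>2)\<bar> < \<mu>"
  shows "pairing (\<lambda>x. k * \<alpha> x + k' * \<alpha>' x) \<beta> u p = k * pairing \<alpha> \<beta> u p + k' * pairing \<alpha>' \<beta> u p"
proof -
  have "pairing_term (\<lambda>x. k * \<alpha> x + k' * \<alpha>' x) \<beta> j u p = k * pairing_term \<alpha> \<beta> j u p + k' * pairing_term \<alpha>' \<beta> j u p" for j
  proof -
    have "pairing_integrand (\<lambda>x. k * \<alpha> x + k' * \<alpha>' x) \<beta> j u p
      = (\<lambda>\<xi>. k * pairing_integrand \<alpha> \<beta> j u p \<xi> + k' * pairing_integrand \<alpha>' \<beta> j u p \<xi>)"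
      by (auto simp: pairing_integrand_def algebra_simps)
    then show ?thesis unfolding pairing_term_def
      using pairing_integrable[OF \<alpha>(1) \<beta> p lt] pairing_integrable[OF \<alpha>(2) \<beta> p lt] by simp
  qed
  moreover have "((\<lambda>j. k * pairing_term \<alpha> \<beta> j u p + k' * pairing_term \<alpha>' \<beta> j u p) has_sum
      k * pairing \<alpha> \<beta> u p + k' * pairing \<alpha>' \<beta> u p) UNIV"
    by (intro has_sum_add has_sum_cmult_right pairing_has_sum[OF _ \<beta> p lt] \<alpha>)
  ultimately show ?thesis unfolding pairing_def[of "\<lambda>x. k * \<alpha> x + k' * \<alpha>' x"] by (simp add: infsumI)
qed

lemma pairing_linear_second:
  assumes \<alpha>: "decay \<kappa> \<alpha>" and \<beta>: "decay \<mu> \<beta>" "decay \<mu> \<beta>'" and p: "p \<noteq> 0"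
    and lt: "\<bar>Im u - ln ((cmod p)\<^sup>2)\<bar> < \<kappa>" "\<bar>ln ((cmod p)\<^sup>2)\<bar> < \<mu>"
  shows "pairing \<alpha> (\<lambda>x. k * \<beta> x + k' * \<beta>' x) u p = k * pairing \<alpha> \<beta> u p + k' * pairing \<alpha> \<beta>' u p"
proof -
  have "pairing_term \<alpha> (\<lambda>x. k * \<beta> x + k' * \<beta>' x) j u p = k * pairing_term \<alpha> \<beta> j u p + k' * pairing_term \<alpha> \<beta>' j u p" for j
  proof -
    have "pairing_integrand \<alpha> (\<lambda>x. k * \<beta> x + k' * \<beta>' x) j u p
      = (\<lambda>\<xi>. k * pairing_integrand \<alpha> \<beta> j u p \<xi> + k' * pairing_integrand \<alpha> \<beta>' j u p \<xi>)"
      by (auto simp: pairing_integrand_def algebra_simps)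
    then show ?thesis unfolding pairing_term_def
      using pairing_integrable[OF \<alpha> \<beta>(1) p lt] pairing_integrable[OF \<alpha> \<beta>(2) p lt] by simp
  qed
  moreover have "((\<lambda>j. k * pairing_term \<alpha> \<beta> j u p + k' * pairing_term \<alpha> \<beta>' j u p) has_sum
      k * pairing \<alpha> \<beta> u p + k' * pairing \<alpha> \<beta>' u p) UNIV"
    by (intro has_sum_add has_sum_cmult_right pairing_has_sum[OF \<alpha> _ p lt] \<beta>)
  ultimately show ?thesis unfolding pairing_def[of \<alpha> "\<lambda>x. k * \<beta> x + k' * \<beta>' x"] by (simp add: infsumI)
qed

section \<open>One-sided exponentials and the hyperbolic secant\<close>

definition right_exp :: "real \<Rightarrow> real \<Rightarrow> complex" where
  "right_exp \<mu> x = (if 0 < x then of_real (exp (- (\<mu> * x))) else 0)"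

definition left_exp :: "real \<Rightarrow> real \<Rightarrow> complex" where
  "left_exp \<mu> x = (if x \<le> 0 then of_real (exp (\<mu> * x)) else 0)"

definition right_cell :: "real \<Rightarrow> real \<Rightarrow> complex" where
  "right_cell \<mu> x = (if 0 < x \<and> x \<le> 1 / 2 then of_real (exp (- (\<mu> * x))) else 0)"

definition left_cell :: "real \<Rightarrow> real \<Rightarrow> complex" where
  "left_cell \<mu> x = (if - 1 / 2 < x \<and> x \<le> 0 then of_real (exp (\<mu> * x)) else 0)"

definition sech :: "real \<Rightarrow> real \<Rightarrow> real \<Rightarrow> complex" where
  "sech \<mu> \<phi> x = inverse (cosh (Complex (\<mu> * x) \<phi>))"

definition sech_rest :: "real \<Rightarrow> real \<Rightarrow> real \<Rightarrow> complex" where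
  "sech_rest \<mu> \<phi> x = sech \<mu> \<phi> x - 2 * cis (- \<phi>) * right_exp \<mu> x - 2 * cis \<phi> * left_exp \<mu> x"

lemma decay_right_exp: "0 \<le> \<mu> \<Longrightarrow> decay \<mu> (right_exp \<mu>)"
  and decay_left_exp: "0 \<le> \<mu> \<Longrightarrow> decay \<mu> (left_exp \<mu>)"
proof -
  have "right_exp \<mu> \<in> borel_measurable borel" "left_exp \<mu> \<in> borel_measurable borel"
    unfolding right_exp_def left_exp_def by measurable
  moreover have "cmod (right_exp \<mu> x) \<le> 1 * exp (- (\<mu> * \<bar>x\<bar>))" for x
    by (simp add: right_exp_def)
  moreover have "cmod (left_exp \<mu> x) \<le> 1 * exp (- (\<mu> * \<bar>x\<bar>))" for x
    by (simp add: left_exp_def)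
  ultimately show "decay \<mu> (right_exp \<mu>)" "decay \<mu> (left_exp \<mu>)"
    unfolding decay_def by blast+
qed

lemma decay_cell:
  assumes "0 \<le> \<mu>" "0 \<le> \<kappa>"
  shows decay_right_cell: "decay \<kappa> (right_cell \<mu>)" and decay_left_cell: "decay \<kappa> (left_cell \<mu>)"
proof -
  have *: "exp (- (\<mu> * \<bar>x\<bar>)) \<le> exp (\<kappa> / 2) * exp (- (\<kappa> * \<bar>x\<bar>))" if "\<bar>x\<bar> \<le> 1 / 2" for x
  proof -
    have "\<kappa> * \<bar>x\<bar> \<le> \<kappa> * (1 / 2)" using that assms by (intro mult_left_mono) auto
    moreover have "0 \<le> \<mu> * \<bar>x\<bar>" using assms by simp
    ultimately have "- (\<mu> * \<bar>x\<bar>) \<le> \<kappa> / 2 + - (\<kappa> * \<bar>x\<bar>)" by linarith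
    then show ?thesis unfolding exp_add[symmetric] by simp
  qed
  have "cmod (right_cell \<mu> x) \<le> exp (\<kappa> / 2) * exp (- (\<kappa> * \<bar>x\<bar>))" for x
  proof (cases "0 < x \<and> x \<le> 1 / 2")
    case True
    then show ?thesis using *[of x] by (simp add: right_cell_def)
  qed (simp only: right_cell_def if_False, simp)
  moreover have "cmod (left_cell \<mu> x) \<le> exp (\<kappa> / 2) * exp (- (\<kappa> * \<bar>x\<bar>))" for x
  proof (cases "- 1 / 2 < x \<and> x \<le> 0")
    case True
    then show ?thesis using *[of x] by (simp add: left_cell_def)
  qed (simp only: left_cell_def if_False, simp)
  moreover have "right_cell \<mu> \<in> borel_measurable borel" "left_cell \<mu> \<in> borel_measurable borel"
    unfolding right_cell_def left_cell_def by measurable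
  ultimately show "decay \<kappa> (right_cell \<mu>)" "decay \<kappa> (left_cell \<mu>)"
    unfolding decay_def by blast+
qed

lemma cosh_Complex: "cosh (Complex a b) = Complex (cosh a * cos b) (sinh a * sin b)"
  by (simp add: cosh_def sinh_def exp_eq_polar[of "Complex a b"] complex_eq_iff Re_exp Im_exp scaleR_conv_of_real field_simps)

text \<open>\<open>\<bar>cosh (a + ib)\<bar>\<^sup>2 = cosh\<^sup>2 a cos\<^sup>2 b + sinh\<^sup>2 a sin\<^sup>2 b\<close>.\<close>

lemma norm_cosh_ge: "\<bar>cos b\<bar> * cosh a \<le> cmod (cosh (Complex a b))"
  unfolding cosh_Complex cmod_def
  by (rule real_le_rsqrt) (simp add: power_mult_distrib)

lemma norm_cosh_ge_exp: "\<bar>cos b\<bar> * exp \<bar>a\<bar> / 2 \<le> cmod (cosh (Complex a b))"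
proof -
  have "exp \<bar>a\<bar> / 2 \<le> cosh a" by (cases "0 \<le> a") (auto simp: cosh_def)
  then have "\<bar>cos b\<bar> * (exp \<bar>a\<bar> / 2) \<le> \<bar>cos b\<bar> * cosh a" by (rule mult_left_mono) simp
  with norm_cosh_ge[of b a] show ?thesis by simp
qed

lemma norm_sech_le:
  assumes "cos \<phi> \<noteq> 0"
  shows "cmod (sech \<mu> \<phi> x) \<le> 2 / \<bar>cos \<phi>\<bar> * exp (- \<bar>\<mu> * x\<bar>)" "cosh (Complex (\<mu> * x) \<phi>) \<noteq> 0"
proof -
  have pos: "0 < \<bar>cos \<phi>\<bar> * exp \<bar>\<mu> * x\<bar> / 2" using assms by simp
  with norm_cosh_ge_exp[of \<phi> "\<mu> * x"] show "cosh (Complex (\<mu> * x) \<phi>) \<noteq> 0" by auto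
  have "cmod (sech \<mu> \<phi> x) \<le> inverse (\<bar>cos \<phi>\<bar> * exp \<bar>\<mu> * x\<bar> / 2)"
    unfolding sech_def norm_inverse using norm_cosh_ge_exp pos by (rule le_imp_inverse_le)
  also have "\<dots> = 2 / \<bar>cos \<phi>\<bar> * exp (- \<bar>\<mu> * x\<bar>)" by (simp add: exp_minus field_simps)
  finally show "cmod (sech \<mu> \<phi> x) \<le> 2 / \<bar>cos \<phi>\<bar> * exp (- \<bar>\<mu> * x\<bar>)" .
qed

lemma measurable_sech: "sech \<mu> \<phi> \<in> borel_measurable borel"
proof -
  have "sech \<mu> \<phi> = (\<lambda>x. inverse (cosh (of_real (\<mu> * x) + \<i> * of_real \<phi>)))"
    by (auto simp: sech_def Complex_eq)
  also have "\<dots> \<in> borel_measurable borel"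
    unfolding cosh_def by measurable
  finally show ?thesis .
qed

text \<open>The secant minus its leading exponential is \<open>1 / cosh y - 2 e\<^bsup>-y\<^esup> = - e\<^bsup>-2y\<^esup> / cosh y\<close>, of size \<open>e\<^bsup>-3 Re y\<^esup>\<close>
for \<open>Re y \<ge> 0\<close>. On the left half line this is applied to \<open>-y\<close>.\<close>

lemma decay_sech_rest:
  assumes \<phi>: "cos \<phi> \<noteq> 0" and \<mu>: "0 < \<mu>"
  shows "decay (3 * \<mu>) (sech_rest \<mu> \<phi>)"
proof -
  have aux: "inverse (cosh y) - 2 * exp (- y) = - (exp (- 2 * y) * inverse (cosh y))"
    if "cosh y \<noteq> 0" for y :: complex
  proof -
    have "2 * exp (- y) * cosh y = 1 + exp (- 2 * y)"
      by (simp add: cosh_def scaleR_conv_of_real exp_add[symmetric] field_simps flip: exp_add)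
    then show ?thesis using that by (simp add: field_simps)
  qed
  have *: "cmod (sech \<mu> \<phi> x - 2 * exp (- y)) \<le> 2 / \<bar>cos \<phi>\<bar> * exp (- (3 * \<mu> * \<bar>x\<bar>))"
    if "y = Complex (\<mu> * x) \<phi> \<or> y = - Complex (\<mu> * x) \<phi>" "Re y = \<mu> * \<bar>x\<bar>" for x y
  proof -
    have cy: "cosh y = cosh (Complex (\<mu> * x) \<phi>)" using that(1) by auto
    have "cmod (sech \<mu> \<phi> x - 2 * exp (- y)) = cmod (- (exp (- 2 * y) * sech \<mu> \<phi> x))"
      using aux[of y] norm_sech_le(2)[OF \<phi>] unfolding sech_def cy by simp
    also have "\<dots> = exp (- (2 * \<mu> * \<bar>x\<bar>)) * cmod (sech \<mu> \<phi> x)"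
      using that(2) by (simp add: norm_mult)
    also have "\<dots> \<le> exp (- (2 * \<mu> * \<bar>x\<bar>)) * (2 / \<bar>cos \<phi>\<bar> * exp (- \<bar>\<mu> * x\<bar>))"
      by (intro mult_left_mono norm_sech_le \<phi>) simp
    also have "\<dots> = 2 / \<bar>cos \<phi>\<bar> * (exp (- (2 * \<mu> * \<bar>x\<bar>)) * exp (- \<bar>\<mu> * x\<bar>))" by (simp add: mult_ac)
    also have "exp (- (2 * \<mu> * \<bar>x\<bar>)) * exp (- \<bar>\<mu> * x\<bar>) = exp (- (3 * \<mu> * \<bar>x\<bar>))"
      unfolding exp_add[symmetric] using \<mu> by (simp add: abs_mult algebra_simps)
    finally show ?thesis .
  qed
  have "cmod (sech_rest \<mu> \<phi> x) \<le> 2 / \<bar>cos \<phi>\<bar> * exp (- (3 * \<mu> * \<bar>x\<bar>))" for x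
  proof (cases "0 < x")
    case True
    have "exp (- Complex (\<mu> * x) \<phi>) = cis (- \<phi>) * right_exp \<mu> x"
      using True by (simp add: right_exp_def exp_eq_polar mult.commute)
    then have "sech_rest \<mu> \<phi> x = sech \<mu> \<phi> x - 2 * exp (- Complex (\<mu> * x) \<phi>)"
      using True by (simp add: sech_rest_def left_exp_def)
    then show ?thesis using *[of "Complex (\<mu> * x) \<phi>" x] True by simp
  next
    case False
    have "exp (- (- Complex (\<mu> * x) \<phi>)) = cis \<phi> * left_exp \<mu> x"
      using False by (simp add: left_exp_def exp_eq_polar mult.commute)
    then have "sech_rest \<mu> \<phi> x = sech \<mu> \<phi> x - 2 * exp (- (- Complex (\<mu> * x) \<phi>))"
      using False by (simp add: sech_rest_def right_exp_def)
    then show ?thesis using *[of "- Complex (\<mu> * x) \<phi>" x] False by simp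
  qed
  moreover have "sech_rest \<mu> \<phi> \<in> borel_measurable borel"
  proof -
    note [measurable] = measurable_sech decay_measurable[OF decay_right_exp[OF less_imp_le[OF \<mu>]]]
      decay_measurable[OF decay_left_exp[OF less_imp_le[OF \<mu>]]]
    show ?thesis unfolding sech_rest_def by measurable
  qed
  ultimately show ?thesis unfolding decay_def by blast
qed

lemma right_cell_eq:
  "right_cell \<mu> = (\<lambda>x. 1 * right_exp \<mu> x + (- of_real (exp (- (\<mu> / 2)))) * right_exp \<mu> (x - 1 / 2))"
proof
  fix x
  have "exp (- (\<mu> * x)) = exp (- (\<mu> / 2)) * exp (- (\<mu> * (x - 1 / 2)))"
    unfolding exp_add[symmetric] by (simp add: algebra_simps)
  then show "right_cell \<mu> x = 1 * right_exp \<mu> x + (- of_real (exp (- (\<mu> / 2)))) * right_exp \<mu> (x - 1 / 2)"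
    by (simp add: right_cell_def right_exp_def)
qed

lemma left_cell_eq:
  "left_cell \<mu> = (\<lambda>x. 1 * left_exp \<mu> x + (- of_real (exp (- (\<mu> / 2)))) * left_exp \<mu> (x + 1 / 2))"
proof
  fix x
  have "exp (\<mu> * x) = exp (- (\<mu> / 2)) * exp (\<mu> * (x + 1 / 2))"
    unfolding exp_add[symmetric] by (simp add: algebra_simps)
  then show "left_cell \<mu> x = 1 * left_exp \<mu> x + (- of_real (exp (- (\<mu> / 2)))) * left_exp \<mu> (x + 1 / 2)"
    by (simp add: left_cell_def left_exp_def)
qed

text \<open>The inequalities that hold for \<open>w\<close> and \<open>z\<close> in the open domain. All pairings of functions with
the critical rates converge at such points, and no denominator vanishes.\<close>

locale inner_point =
  fixes c :: real and u p :: complex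
  assumes c: "0 < c" and p: "p \<noteq> 0"
    and lt1: "\<bar>Im u - ln ((cmod p)\<^sup>2)\<bar> < pi" and lt2: "\<bar>ln ((cmod p)\<^sup>2)\<bar> < c"
begin

text \<open>The values of \<open>p\<close> at which the denominators of the decomposition vanish, and the constant \<open>2 \<beta>\<close>,
which is \<open>\<pi> + c\<close>.\<close>

definition "A = exp ((of_real pi - \<i> * u) / 2)"
definition "B = exp (- ((\<i> * u + of_real pi) / 2))"
definition "cc = complex_of_real (exp (c / 2))"
definition "dd = complex_of_real (exp (- (c / 2)))"
definition "bb = complex_of_real (pi + c)"

lemma cmod_p: "cmod p = exp (ln ((cmod p)\<^sup>2) / 2)"
  by (rule cmod_eq_exp[OF p])

lemma cmod_less: "cmod p < cmod A" "cmod B < cmod p" "cmod p < cmod cc" "cmod dd < cmod p"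
proof -
  have "ln ((cmod p)\<^sup>2) / 2 < (pi + Im u) / 2" "(Im u - pi) / 2 < ln ((cmod p)\<^sup>2) / 2"
    "ln ((cmod p)\<^sup>2) / 2 < c / 2" "- (c / 2) < ln ((cmod p)\<^sup>2) / 2"
    using lt1 lt2 by (simp_all add: abs_less_iff)
  moreover have "cmod A = exp ((pi + Im u) / 2)" "cmod B = exp ((Im u - pi) / 2)"
    "cmod cc = exp (c / 2)" "cmod dd = exp (- (c / 2))"
    unfolding A_def B_def cc_def dd_def by (simp_all add: field_simps)
  ultimately show "cmod p < cmod A" "cmod B < cmod p" "cmod p < cmod cc" "cmod dd < cmod p"
    by (subst cmod_p, simp)+
qed

lemma nonzero: "A - p \<noteq> 0" "B - p \<noteq> 0" "cc - p \<noteq> 0" "dd - p \<noteq> 0" "A \<noteq> 0" "B \<noteq> 0" "cc \<noteq> 0" "dd \<noteq> 0"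
  using cmod_less by (auto simp: A_def B_def cc_def dd_def)

lemma nonzero_bb: "\<i> * u - bb \<noteq> 0" "\<i> * u + bb \<noteq> 0"
proof -
  have "Re (\<i> * u - bb) < 0" "Re (\<i> * u + bb) > 0"
    using lt1 lt2 by (simp_all add: bb_def abs_less_iff)
  then show "\<i> * u - bb \<noteq> 0" "\<i> * u + bb \<noteq> 0" by (metis less_irrefl zero_complex.sel(1))+
qed

lemma exp_half_pi:
  "A * (of_real (exp (- (pi / 2))) * exp (\<i> * u / 2)) = 1"
  "of_real (exp (- (pi / 2))) = B * exp (\<i> * u / 2)"
  unfolding A_def B_def exp_of_real[symmetric] exp_add[symmetric] by (simp_all add: field_simps)

text \<open>By \<open>right_cell_eq\<close> and the behaviour under translations,
\<open>\<Psi>(right_cell, \<beta>) = (1 - e\<^bsup>-\<pi>/2\<^esup> p e\<^bsup>iu/2\<^esup>) \<Psi>(right_exp, \<beta>)\<close>, and the factor is \<open>1 - p / A\<close>. The three lemmas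
that follow do the same for the other side and for the second argument, with the factors
\<open>1 - B / p\<close>, \<open>1 - p / cc\<close> and \<open>1 - dd / p\<close>.\<close>

lemma pairing_right_exp_first:
  assumes \<beta>: "decay c \<beta>"
  shows "(A - p) * pairing (right_exp pi) \<beta> u p = A * pairing (right_cell pi) \<beta> u p"
proof -
  let ?P = "pairing (right_exp pi) \<beta> u p" and ?k = "of_real (exp (- (pi / 2))) :: complex"
  have d: "decay pi (right_exp pi)" by (rule decay_right_exp) simp
  have "pairing (right_cell pi) \<beta> u p = 1 * ?P + (- ?k) * pairing (\<lambda>x. right_exp pi (x - 1 / 2)) \<beta> u p"
    unfolding right_cell_eq
    using decay_shift[OF d, of "- 1 / 2"] by (intro pairing_linear_first[OF d _ \<beta> p lt1 lt2]) simp
  also have "\<dots> = ?P - (?k * exp (\<i> * u / 2)) * p * ?P"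
    unfolding pairing_shift_first[OF p] by (simp add: algebra_simps)
  finally have X: "pairing (right_cell pi) \<beta> u p = ?P - (?k * exp (\<i> * u / 2)) * p * ?P" .
  have "A * pairing (right_cell pi) \<beta> u p = A * ?P - (A * (?k * exp (\<i> * u / 2))) * p * ?P"
    unfolding X by (simp only: right_diff_distrib mult.assoc)
  then show ?thesis unfolding exp_half_pi(1) by (simp add: algebra_simps)
qed

lemma pairing_left_exp_first:
  assumes \<beta>: "decay c \<beta>"
  shows "(B - p) * pairing (left_exp pi) \<beta> u p = - p * pairing (left_cell pi) \<beta> u p"
proof -
  let ?P = "pairing (left_exp pi) \<beta> u p" and ?k = "of_real (exp (- (pi / 2))) :: complex"
  let ?Q = "pairing (\<lambda>x. left_exp pi (x + 1 / 2)) \<beta> u p"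
  have d: "decay pi (left_exp pi)" by (rule decay_left_exp) simp
  have X: "pairing (left_cell pi) \<beta> u p = 1 * ?P + (- ?k) * ?Q"
    unfolding left_cell_eq
    using decay_shift[OF d, of "1 / 2"] by (intro pairing_linear_first[OF d _ \<beta> p lt1 lt2]) simp
  have Y: "p * exp (\<i> * u / 2) * ?Q = ?P"
    using pairing_shift_first[OF p, of "\<lambda>x. left_exp pi (x + 1 / 2)" \<beta> u] by simp
  have "- p * pairing (left_cell pi) \<beta> u p = B * (p * exp (\<i> * u / 2) * ?Q) - p * ?P"
    unfolding X exp_half_pi(2) by (simp add: algebra_simps)
  then show ?thesis unfolding Y by (simp add: algebra_simps)
qed

lemma pairing_left_exp_second:
  assumes \<alpha>: "decay pi \<alpha>"
  shows "(cc - p) * pairing \<alpha> (left_exp c) u p = cc * pairing \<alpha> (left_cell c) u p"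
proof -
  let ?P = "pairing \<alpha> (left_exp c) u p"
  have d: "decay c (left_exp c)" by (rule decay_left_exp) (use c in simp)
  have "pairing \<alpha> (left_cell c) u p = 1 * ?P + (- dd) * pairing \<alpha> (\<lambda>x. left_exp c (x + 1 / 2)) u p"
    unfolding left_cell_eq dd_def
    using decay_shift[OF d, of "1 / 2"] c by (intro pairing_linear_second[OF \<alpha> d _ p lt1 lt2]) simp
  also have "\<dots> = ?P - dd * p * ?P"
    unfolding pairing_shift_second[OF p] by (simp add: algebra_simps)
  finally have X: "pairing \<alpha> (left_cell c) u p = ?P - dd * p * ?P" .
  have "cc * dd = 1"
    unfolding cc_def dd_def by (simp add: exp_of_real[symmetric] flip: exp_add)
  moreover have "cc * pairing \<alpha> (left_cell c) u p = cc * ?P - (cc * dd) * p * ?P"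
    unfolding X by (simp only: right_diff_distrib mult.assoc)
  ultimately show ?thesis by (simp add: algebra_simps)
qed

lemma pairing_right_exp_second:
  assumes \<alpha>: "decay pi \<alpha>"
  shows "(dd - p) * pairing \<alpha> (right_exp c) u p = - p * pairing \<alpha> (right_cell c) u p"
proof -
  let ?P = "pairing \<alpha> (right_exp c) u p" and ?Q = "pairing \<alpha> (\<lambda>x. right_exp c (x - 1 / 2)) u p"
  have d: "decay c (right_exp c)" by (rule decay_right_exp) (use c in simp)
  have X: "pairing \<alpha> (right_cell c) u p = 1 * ?P + (- dd) * ?Q"
    unfolding right_cell_eq dd_def
    using decay_shift[OF d, of "- 1 / 2"] c by (intro pairing_linear_second[OF \<alpha> d _ p lt1 lt2]) simp
  have Y: "p * ?Q = ?P"
    using pairing_shift_second[OF p, of \<alpha> "\<lambda>x. right_exp c (x - 1 / 2)" u] by simp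
  have "- p * pairing \<alpha> (right_cell c) u p = dd * (p * ?Q) - p * ?P"
    unfolding X by (simp add: algebra_simps)
  then show ?thesis unfolding Y by (simp add: algebra_simps)
qed

end

lemma pairing_only_zero:
  assumes "\<And>j. j \<noteq> 0 \<Longrightarrow> pairing_term \<alpha> \<beta> j u p = 0"
  shows "pairing \<alpha> \<beta> u p = pairing_term \<alpha> \<beta> 0 u p"
proof -
  have "pairing \<alpha> \<beta> u p = (\<Sum>\<^sub>\<infinity>j\<in>{0}. pairing_term \<alpha> \<beta> j u p)"
    unfolding pairing_def by (rule infsum_cong_neutral) (use assms in auto)
  then show ?thesis by simp
qed

lemma integral_exp_cell:
  fixes k :: complex
  assumes "a \<le> b"
  shows "k * (\<integral>x. indicator {a..b} x *\<^sub>R exp (k * of_real x) \<partial>lborel) = exp (k * of_real b) - exp (k * of_real a)"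
proof -
  have d: "((\<lambda>x. exp (k * of_real x)) has_vector_derivative k * exp (k * of_real x)) (at x within {a..b})" for x :: real
  proof -
    have "((\<lambda>z. exp (k * z)) has_field_derivative k * exp (k * of_real x)) (at (of_real x))"
      by (rule derivative_eq_intros refl | simp)+
    then show ?thesis
      by (rule has_vector_derivative_real_field[THEN has_vector_derivative_at_within])
  qed
  have c: "continuous_on {a..b} (\<lambda>x. k * exp (k * of_real x))"
    by (intro continuous_intros)
  from has_bochner_integral_FTC_Icc[OF assms _ c, OF d]
  have 1: "(\<integral>x. indicator {a..b} x *\<^sub>R (k * exp (k * of_real x)) \<partial>lborel) = exp (k * of_real b) - exp (k * of_real a)"
    by (rule has_bochner_integral_integral_eq)
  have e: "(\<lambda>x. indicator {a..b} x *\<^sub>R (k * exp (k * of_real x))) = (\<lambda>x. k * (indicator {a..b} x *\<^sub>R exp (k * of_real x)))"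
    by (rule ext) (simp only: mult_scaleR_right)
  show ?thesis using 1 unfolding e integral_mult_right_zero .
qed

text \<open>Two cells on the same side overlap for \<open>j = 0\<close> only, so the pairing is a single integral of
an exponential over a cell. Multiplying by the exponent avoids the case in which it vanishes.\<close>

lemma pairing_right_cells:
  "(\<i> * u - of_real (\<mu> + \<nu>)) * pairing (right_cell \<mu>) (right_cell \<nu>) u p
     = exp ((\<i> * u - of_real (\<mu> + \<nu>)) / 2) - 1"
proof -
  let ?k = "\<i> * u - of_real (\<mu> + \<nu>)"
  have "pairing_integrand (right_cell \<mu>) (right_cell \<nu>) j u p = (\<lambda>_. 0)" if "j \<noteq> 0" for j
  proof
    fix \<xi> :: real
    have "\<not> (0 < \<xi> \<and> \<xi> \<le> 1 / 2) \<or> \<not> (0 < \<xi> - of_int j / 2 \<and> \<xi> - of_int j / 2 \<le> 1 / 2)"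
      using that by (cases "1 \<le> j") auto
    then show "pairing_integrand (right_cell \<mu>) (right_cell \<nu>) j u p \<xi> = 0"
      by (auto simp: pairing_integrand_def right_cell_def)
  qed
  then have "pairing (right_cell \<mu>) (right_cell \<nu>) u p = pairing_term (right_cell \<mu>) (right_cell \<nu>) 0 u p"
    by (intro pairing_only_zero) (simp add: pairing_term_def)
  also have "\<dots> = (\<integral>x. indicator {0..1/2} x *\<^sub>R exp (?k * of_real x) \<partial>lborel)"
    unfolding pairing_term_def
  proof (rule integral_cong_AE)
    have "AE x in lborel. x \<noteq> (0::real)" by (rule AE_lborel_singleton)
    then show "AE x in lborel. pairing_integrand (right_cell \<mu>) (right_cell \<nu>) 0 u p x
      = indicator {0..1/2} x *\<^sub>R exp (?k * of_real x)"
    proof eventually_elim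
      case (elim x)
      have "exp (?k * of_real x) = exp (\<i> * u * of_real x) * of_real (exp (- (\<mu> * x))) * of_real (exp (- (\<nu> * x)))"
        unfolding exp_of_real[symmetric] exp_add[symmetric] by (simp add: algebra_simps)
      then show ?case using elim by (auto simp: pairing_integrand_def right_cell_def indicator_def)
    qed
    have [measurable]: "right_cell \<mu> \<in> borel_measurable borel" for \<mu>
      unfolding right_cell_def by measurable
    show "pairing_integrand (right_cell \<mu>) (right_cell \<nu>) 0 u p \<in> borel_measurable lborel"
      unfolding pairing_integrand_def by measurable
  qed measurable
  finally show ?thesis using integral_exp_cell[of 0 "1/2" ?k] by simp
qed

lemma pairing_left_cells:
  "(\<i> * u + of_real (\<mu> + \<nu>)) * pairing (left_cell \<mu>) (left_cell \<nu>) u p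
     = 1 - exp (- ((\<i> * u + of_real (\<mu> + \<nu>)) / 2))"
proof -
  let ?k = "\<i> * u + of_real (\<mu> + \<nu>)"
  have "pairing_integrand (left_cell \<mu>) (left_cell \<nu>) j u p = (\<lambda>_. 0)" if "j \<noteq> 0" for j
  proof
    fix \<xi> :: real
    have "\<not> (- 1 / 2 < \<xi> \<and> \<xi> \<le> 0) \<or> \<not> (- 1 / 2 < \<xi> - of_int j / 2 \<and> \<xi> - of_int j / 2 \<le> 0)"
      using that by (cases "1 \<le> j") auto
    then show "pairing_integrand (left_cell \<mu>) (left_cell \<nu>) j u p \<xi> = 0"
      by (auto simp: pairing_integrand_def left_cell_def)
  qed
  then have "pairing (left_cell \<mu>) (left_cell \<nu>) u p = pairing_term (left_cell \<mu>) (left_cell \<nu>) 0 u p"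
    by (intro pairing_only_zero) (simp add: pairing_term_def)
  also have "\<dots> = (\<integral>x. indicator {- (1/2)..0} x *\<^sub>R exp (?k * of_real x) \<partial>lborel)"
    unfolding pairing_term_def
  proof (rule integral_cong_AE)
    have "AE x in lborel. x \<noteq> (- (1/2)::real)" by (rule AE_lborel_singleton)
    then show "AE x in lborel. pairing_integrand (left_cell \<mu>) (left_cell \<nu>) 0 u p x
      = indicator {- (1/2)..0} x *\<^sub>R exp (?k * of_real x)"
    proof eventually_elim
      case (elim x)
      have "exp (?k * of_real x) = exp (\<i> * u * of_real x) * of_real (exp (\<mu> * x)) * of_real (exp (\<nu> * x))"
        unfolding exp_of_real[symmetric] exp_add[symmetric] by (simp add: algebra_simps)
      then show ?case using elim by (auto simp: pairing_integrand_def left_cell_def indicator_def)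
    qed
    have [measurable]: "left_cell \<mu> \<in> borel_measurable borel" for \<mu>
      unfolding left_cell_def by measurable
    show "pairing_integrand (left_cell \<mu>) (left_cell \<nu>) 0 u p \<in> borel_measurable lborel"
      unfolding pairing_integrand_def by measurable
  qed measurable
  finally show ?thesis using integral_exp_cell[of "- (1/2)" 0 ?k] by simp
qed

section \<open>Expansion of the two sums over \<open>j\<close>\<close>

lemma sech_eq: "sech \<mu> \<phi> = (\<lambda>x. 2 * cis (- \<phi>) * right_exp \<mu> x + 1 * (2 * cis \<phi> * left_exp \<mu> x + 1 * sech_rest \<mu> \<phi> x))"
  by (simp add: sech_rest_def)

context inner_point
begin

lemma exp_bb:
  "exp ((\<i> * u - bb) / 2) = dd / A" "exp (- ((\<i> * u + bb) / 2)) = B / cc"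
  unfolding bb_def A_def B_def cc_def dd_def exp_of_real[symmetric] exp_diff[symmetric]
  by (rule arg_cong[where f = exp], simp add: field_simps)+

text \<open>The value \<open>(e\<^bsup>(iu - 2\<beta>)/2\<^esup> - 1) / (iu - 2\<beta>)\<close> at the cells has the numerator \<open>dd / A - 1\<close>, which is what
the partial fraction decomposition of \<open>1 / ((A - p) (dd - p))\<close> needs. Thus the product of these two denominators never
occurs.\<close>

lemma pairing_right_right:
  "pairing (right_exp pi) (right_exp c) u p = p / ((\<i> * u - bb) * (dd - p)) - p / ((A - p) * (\<i> * u - bb))"
proof -
  have d: "decay pi (right_cell pi)" "decay c (right_exp c)"
    using c by (auto intro: decay_right_cell decay_right_exp)
  have "(\<i> * u - bb) * ((dd - p) * ((A - p) * pairing (right_exp pi) (right_exp c) u p))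
    = A * ((\<i> * u - bb) * ((dd - p) * pairing (right_cell pi) (right_exp c) u p))"
    unfolding pairing_right_exp_first[OF d(2)] by simp
  also have "\<dots> = - p * A * ((\<i> * u - bb) * pairing (right_cell pi) (right_cell c) u p)"
    unfolding pairing_right_exp_second[OF d(1)] by simp
  also have "\<dots> = - p * (dd - A)"
    using pairing_right_cells[of u pi c p, folded bb_def, unfolded exp_bb] nonzero
    by (simp only:) (simp add: field_simps)
  finally show ?thesis using nonzero nonzero_bb
    by (simp add: divide_simps) (simp add: algebra_simps)
qed

lemma pairing_left_left:
  "pairing (left_exp pi) (left_exp c) u p = p / ((\<i> * u + bb) * (cc - p)) - p / ((B - p) * (\<i> * u + bb))"
proof -
  have d: "decay pi (left_cell pi)" "decay c (left_exp c)"
    using c by (auto intro: decay_left_cell decay_left_exp)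
  have "(\<i> * u + bb) * ((cc - p) * ((B - p) * pairing (left_exp pi) (left_exp c) u p))
    = - p * ((\<i> * u + bb) * ((cc - p) * pairing (left_cell pi) (left_exp c) u p))"
    unfolding pairing_left_exp_first[OF d(2)] by simp
  also have "\<dots> = - p * cc * ((\<i> * u + bb) * pairing (left_cell pi) (left_cell c) u p)"
    unfolding pairing_left_exp_second[OF d(1)] by simp
  also have "\<dots> = - p * (cc - B)"
    using pairing_left_cells[of u pi c p, folded bb_def, unfolded exp_bb] nonzero
    by (simp only:) (simp add: field_simps)
  finally show ?thesis using nonzero nonzero_bb
    by (simp add: divide_simps) (simp add: algebra_simps)
qed

lemma pairing_right_left:
  "pairing (right_exp pi) (left_exp c) u p = A * cc * pairing (right_cell pi) (left_cell c) u p / ((A - p) * (cc - p))"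
proof -
  have d: "decay pi (right_cell pi)" "decay c (left_exp c)"
    using c by (auto intro: decay_right_cell decay_left_exp)
  have "(cc - p) * ((A - p) * pairing (right_exp pi) (left_exp c) u p) = A * cc * pairing (right_cell pi) (left_cell c) u p"
    using pairing_right_exp_first[OF d(2)] pairing_left_exp_second[OF d(1)] by (simp add: mult_ac)
  then show ?thesis using nonzero by (simp add: divide_simps mult_ac)
qed

lemma pairing_left_right:
  "pairing (left_exp pi) (right_exp c) u p = p\<^sup>2 * pairing (left_cell pi) (right_cell c) u p / ((B - p) * (dd - p))"
proof -
  have d: "decay pi (left_cell pi)" "decay c (right_exp c)"
    using c by (auto intro: decay_left_cell decay_right_exp)
  have "(dd - p) * ((B - p) * pairing (left_exp pi) (right_exp c) u p) = p\<^sup>2 * pairing (left_cell pi) (right_cell c) u p"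
    using pairing_left_exp_first[OF d(2)] pairing_right_exp_second[OF d(1)] by (simp add: mult_ac power2_eq_square)
  then show ?thesis using nonzero by (simp add: divide_simps mult_ac)
qed

text \<open>The nine products, ordered as in the theorem. When the first factor is the rest and the second one an exponential,
the only denominator is \<open>cc - p\<close> or \<open>dd - p\<close>; the numerator is then multiplied by \<open>A - p\<close> or \<open>B - p\<close>, so that the
term joins those with two denominators.\<close>

lemma pairing_sech:
  assumes \<phi>: "cos \<phi> \<noteq> 0" and \<psi>: "cos \<psi> \<noteq> 0"
  shows "pairing (sech pi \<phi>) (sech c \<psi>) u p =
      (4 * cis \<phi> * cis \<psi> * p) / ((\<i> * u + bb) * (cc - p))
    + (- (4 * cis \<phi> * cis \<psi> * p)) / ((B - p) * (\<i> * u + bb))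
    + (4 * cis (- \<phi>) * cis \<psi> * A * cc * pairing (right_cell pi) (left_cell c) u p
        + 2 * cis \<psi> * cc * (A - p) * pairing (sech_rest pi \<phi>) (left_cell c) u p) / ((A - p) * (cc - p))
    + (- (4 * cis (- \<phi>) * cis (- \<psi>) * p)) / ((A - p) * (\<i> * u - bb))
    + (4 * cis (- \<phi>) * cis (- \<psi>) * p) / ((\<i> * u - bb) * (dd - p))
    + (4 * cis \<phi> * cis (- \<psi>) * p\<^sup>2 * pairing (left_cell pi) (right_cell c) u p
        - 2 * cis (- \<psi>) * p * (B - p) * pairing (sech_rest pi \<phi>) (right_cell c) u p) / ((B - p) * (dd - p))
    + (2 * cis (- \<phi>) * A * pairing (right_cell pi) (sech_rest c \<psi>) u p) / (A - p)
    + (- (2 * cis \<phi> * p * pairing (left_cell pi) (sech_rest c \<psi>) u p)) / (B - p)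
    + pairing (sech_rest pi \<phi>) (sech_rest c \<psi>) u p"
    (is "_ = ?T1 + ?T2 + (?a3 + ?b3) / ?n3 + ?T4 + ?T5 + (?a6 - ?b6) / ?n6 + ?T7 + ?T8 + ?T9")
proof -
  let ?R = "right_exp pi" and ?L = "left_exp pi" and ?S = "sech_rest pi \<phi>"
  let ?R' = "right_exp c" and ?L' = "left_exp c" and ?S' = "sech_rest c \<psi>"
  have d: "decay pi ?R" "decay pi ?L" "decay pi ?S"
    using decay_mono[OF decay_sech_rest[OF \<phi>, of pi]] by (auto intro: decay_right_exp decay_left_exp)
  have d': "decay c ?R'" "decay c ?L'" "decay c ?S'"
    using decay_mono[OF decay_sech_rest[OF \<psi> c], of c] c by (auto intro: decay_right_exp decay_left_exp)
  have dls: "decay pi (\<lambda>x. 2 * cis \<phi> * ?L x + 1 * ?S x)" "decay c (\<lambda>x. 2 * cis \<psi> * ?L' x + 1 * ?S' x)"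
    by (intro decay_add decay_cmult d d')+
  have ds: "decay c (sech c \<psi>)"
    unfolding sech_eq by (intro decay_add decay_cmult d')
  have left: "pairing (sech pi \<phi>) \<beta> u p = 2 * cis (- \<phi>) * pairing ?R \<beta> u p + 2 * cis \<phi> * pairing ?L \<beta> u p + pairing ?S \<beta> u p"
    if "decay c \<beta>" for \<beta>
    unfolding sech_eq[of pi] pairing_linear_first[OF d(1) dls(1) that p lt1 lt2] pairing_linear_first[OF d(2,3) that p lt1 lt2]
    by simp
  have right: "pairing \<alpha> (sech c \<psi>) u p = 2 * cis (- \<psi>) * pairing \<alpha> ?R' u p + 2 * cis \<psi> * pairing \<alpha> ?L' u p + pairing \<alpha> ?S' u p"
    if "decay pi \<alpha>" for \<alpha>
    unfolding sech_eq[of c] pairing_linear_second[OF that d'(1) dls(2) p lt1 lt2] pairing_linear_second[OF that d'(2,3) p lt1 lt2]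
    by simp
  have RS: "pairing ?R ?S' u p = A * pairing (right_cell pi) ?S' u p / (A - p)"
    using pairing_right_exp_first[OF d'(3)] nonzero by (simp add: field_simps)
  have LS: "pairing ?L ?S' u p = - p * pairing (left_cell pi) ?S' u p / (B - p)"
    using pairing_left_exp_first[OF d'(3)] nonzero by (simp add: divide_simps mult_ac)
  have SR: "pairing ?S ?R' u p = - p * pairing ?S (right_cell c) u p / (dd - p)"
    using pairing_right_exp_second[OF d(3)] nonzero by (simp add: divide_simps mult_ac)
  have SL: "pairing ?S ?L' u p = cc * pairing ?S (left_cell c) u p / (cc - p)"
    using pairing_left_exp_second[OF d(3)] nonzero by (simp add: divide_simps mult_ac)
  have 3: "(?a3 + ?b3) / ?n3 = 4 * cis (- \<phi>) * cis \<psi> * pairing ?R ?L' u p + 2 * cis \<psi> * pairing ?S ?L' u p"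
    unfolding pairing_right_left SL using nonzero by (simp add: add_divide_distrib mult.assoc)
  have 6: "(?a6 - ?b6) / ?n6 = 4 * cis \<phi> * cis (- \<psi>) * pairing ?L ?R' u p + 2 * cis (- \<psi>) * pairing ?S ?R' u p"
    unfolding pairing_left_right SR using nonzero by (simp add: diff_divide_distrib mult.assoc)
  have 7: "?T7 = 2 * cis (- \<phi>) * pairing ?R ?S' u p" and 8: "?T8 = 2 * cis \<phi> * pairing ?L ?S' u p"
    unfolding RS LS by simp_all
  have 12: "?T1 + ?T2 = 4 * cis \<phi> * cis \<psi> * pairing ?L ?L' u p"
    unfolding pairing_left_left by (simp add: algebra_simps)
  have 45: "?T4 + ?T5 = 4 * cis (- \<phi>) * cis (- \<psi>) * pairing ?R ?R' u p"
    unfolding pairing_right_right by (simp add: algebra_simps)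
  have "pairing (sech pi \<phi>) (sech c \<psi>) u p = 4 * cis \<phi> * cis \<psi> * pairing ?L ?L' u p
     + (4 * cis (- \<phi>) * cis \<psi> * pairing ?R ?L' u p + 2 * cis \<psi> * pairing ?S ?L' u p)
     + 4 * cis (- \<phi>) * cis (- \<psi>) * pairing ?R ?R' u p
     + (4 * cis \<phi> * cis (- \<psi>) * pairing ?L ?R' u p + 2 * cis (- \<psi>) * pairing ?S ?R' u p)
     + 2 * cis (- \<phi>) * pairing ?R ?S' u p + 2 * cis \<phi> * pairing ?L ?S' u p + ?T9"
    unfolding left[OF ds] right[OF d(1)] right[OF d(2)] right[OF d(3)]
    by (simp only: distrib_left distrib_right ac_simps) (simp add: algebra_simps)
  then show ?thesis unfolding 12[symmetric] 45[symmetric] 3[symmetric] 6[symmetric] 7[symmetric] 8[symmetric]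
    by (simp only: add.assoc)
qed

end

text \<open>The part of the sum of residues that converges beyond the boundary: the leading exponentials are removed
from the coefficients \<open>sech (\<pi> j / 2 + i \<theta>)\<close>.\<close>

definition residue_rest :: "real \<Rightarrow> complex \<Rightarrow> complex \<Rightarrow> complex" where
  "residue_rest \<theta> u p = (\<Sum>\<^sub>\<infinity>j::int. p powi j * exp (\<i> * u * of_real (of_int j / 2)) * sech_rest pi \<theta> (of_int j / 2))"

lemma residue_rest_bound:
  assumes \<theta>: "cos \<theta> \<noteq> 0"
  obtains C where "0 \<le> C" "\<And>u p j. p \<noteq> 0 \<Longrightarrow> \<bar>Im u - ln ((cmod p)\<^sup>2)\<bar> < pi + 1 \<Longrightarrow>
    cmod (p powi j * exp (\<i> * u * of_real (of_int j / 2)) * sech_rest pi \<theta> (of_int j / 2)) \<le> C * exp (- (1 / 2 * \<bar>real_of_int j\<bar>))"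
proof -
  obtain C where C: "0 \<le> C" "\<forall>x. cmod (sech_rest pi \<theta> x) \<le> C * exp (- (3 * pi * \<bar>x\<bar>))"
    using decay_bound[OF decay_sech_rest[OF \<theta> pi_gt_zero]] by blast
  have "cmod (p powi j * exp (\<i> * u * of_real (of_int j / 2)) * sech_rest pi \<theta> (of_int j / 2)) \<le> C * exp (- (1 / 2 * \<bar>real_of_int j\<bar>))"
    if p: "p \<noteq> 0" and lt: "\<bar>Im u - ln ((cmod p)\<^sup>2)\<bar> < pi + 1" for u p j
  proof -
    let ?y = "real_of_int j / 2" and ?P = "ln ((cmod p)\<^sup>2)"
    have "(?P - Im u) * ?y \<le> (pi + 1) * \<bar>?y\<bar>"
      using abs_ge_self[of "(?P - Im u) * ?y"] mult_right_mono[OF less_imp_le[OF lt], of "\<bar>?y\<bar>"]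
      by (simp add: abs_mult abs_minus_commute)
    moreover have "2 * \<bar>?y\<bar> \<le> pi * \<bar>?y\<bar>" using pi_gt3 by (intro mult_right_mono) auto
    ultimately have e: "?P * ?y - Im u * ?y + - (3 * pi * \<bar>?y\<bar>) \<le> - (1 / 2 * \<bar>real_of_int j\<bar>)"
      by (simp add: algebra_simps)
    have "cmod (p powi j * exp (\<i> * u * of_real ?y) * sech_rest pi \<theta> ?y)
       \<le> exp (?P * ?y - Im u * ?y) * (C * exp (- (3 * pi * \<bar>?y\<bar>)))"
      unfolding norm_mult[of _ "sech_rest pi \<theta> ?y"] norm_power_int_exp[OF p]
      by (intro mult_left_mono C(2)[rule_format]) simp
    also have "\<dots> = C * exp (?P * ?y - Im u * ?y + - (3 * pi * \<bar>?y\<bar>))"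
      unfolding exp_add by simp
    also have "\<dots> \<le> C * exp (- (1 / 2 * \<bar>real_of_int j\<bar>))"
      using C(1) e by (intro mult_left_mono) auto
    finally show ?thesis .
  qed
  then show ?thesis using C(1) that by metis
qed

lemma bholo_residue_rest:
  assumes \<theta>: "cos \<theta> \<noteq> 0"
  shows "bholo c (residue_rest \<theta>)"
proof -
  obtain C where C: "0 \<le> C" "\<And>u p j. p \<noteq> 0 \<Longrightarrow> \<bar>Im u - ln ((cmod p)\<^sup>2)\<bar> < pi + 1 \<Longrightarrow>
    cmod (p powi j * exp (\<i> * u * of_real (of_int j / 2)) * sech_rest pi \<theta> (of_int j / 2)) \<le> C * exp (- (1 / 2 * \<bar>real_of_int j\<bar>))"
    by (rule residue_rest_bound[OF \<theta>]) metis
  show ?thesis unfolding residue_rest_def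
  proof (rule bholo_infsum[where g = "\<lambda>j. C * exp (- (1 / 2 * \<bar>real_of_int j\<bar>))"])
    show "(\<lambda>j. C * exp (- (1 / 2 * \<bar>real_of_int j\<bar>))) summable_on UNIV"
      by (intro summable_on_cmult_right summable_exp_abs_int) auto
    fix j u p assume "(u, p) \<in> strip c"
    then have p: "p \<noteq> 0" and lt: "\<bar>Im u - ln ((cmod p)\<^sup>2)\<bar> < pi + 1" by (auto simp: strip_def)
    show "cmod (p powi j * exp (\<i> * u * of_real (of_int j / 2)) * sech_rest pi \<theta> (of_int j / 2)) \<le> C * exp (- (1 / 2 * \<bar>real_of_int j\<bar>))"
      by (rule C(2)[OF p lt])
    show "(\<lambda>s. p powi j * exp (\<i> * s * of_real (of_int j / 2)) * sech_rest pi \<theta> (of_int j / 2)) field_differentiable at u"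
      unfolding field_differentiable_def by (rule exI) (rule derivative_eq_intros refl | simp)+
    show "(\<lambda>s. s powi j * exp (\<i> * u * of_real (of_int j / 2)) * sech_rest pi \<theta> (of_int j / 2)) field_differentiable at p"
      using p unfolding field_differentiable_def by (intro exI) (rule derivative_eq_intros refl | simp)+
  qed
qed

lemma has_sum_geometric_int:
  fixes x :: complex
  assumes x: "cmod x < 1" and inj: "inj h" and out: "\<And>j. j \<notin> range h \<Longrightarrow> f j = 0"
    and f: "\<And>n::nat. f (h n) = x ^ (n + k)"
  shows "(f has_sum x ^ k / (1 - x)) (UNIV :: int set)"
proof -
  have "(\<lambda>n. x ^ k * x ^ n) sums (x ^ k * (1 / (1 - x)))"
    using x by (intro sums_mult geometric_sums)
  moreover have "summable (\<lambda>n. norm (x ^ k * x ^ n))"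
    using x by (simp add: norm_mult norm_power summable_mult summable_geometric)
  ultimately have "((\<lambda>n. x ^ k * x ^ n) has_sum (x ^ k * (1 / (1 - x)))) UNIV"
    by (intro norm_summable_imp_has_sum)
  moreover have "f \<circ> h = (\<lambda>n. x ^ k * x ^ n)"
    by (simp add: fun_eq_iff f power_add mult.commute)
  ultimately have "((f \<circ> h) has_sum x ^ k / (1 - x)) UNIV" by simp
  then have "(f has_sum x ^ k / (1 - x)) (range h)"
    using has_sum_reindex[OF inj, of f "x ^ k / (1 - x)"] by blast
  moreover have "(f has_sum x ^ k / (1 - x)) (range h) \<longleftrightarrow> (f has_sum x ^ k / (1 - x)) UNIV"
    by (rule has_sum_cong_neutral) (use out in auto)
  ultimately show ?thesis by blast
qed

context inner_point
begin

text \<open>The right exponential contributes the powers \<open>(p / A)\<^sup>j\<close> for \<open>j > 0\<close>, the left one \<open>(B / p)\<^sup>n\<close> for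
\<open>n = -j \<ge> 0\<close>. The convention at \<open>j = 0\<close> is the one of \<open>left_exp\<close>.\<close>

lemma residue_sum:
  assumes \<theta>: "cos \<theta> \<noteq> 0"
  shows "((\<lambda>j::int. p powi j * exp (\<i> * u * of_real (of_int j / 2)) * sech pi \<theta> (of_int j / 2)) has_sum
     (2 * cis (- \<theta>) * p / (A - p) + - (2 * cis \<theta> * p) / (B - p) + residue_rest \<theta> u p)) UNIV"
proof -
  define t where "t j = p powi j * exp (\<i> * u * of_real (of_int j / 2))" for j :: int
  define q where "q = p * exp (\<i> * u / 2)"
  have q: "q \<noteq> 0" using p by (simp add: q_def)
  have tq: "t j = q powi j" for j
    by (simp add: t_def q_def power_int_mult_distrib exp_power_int algebra_simps)
  have xA: "p / A = q * of_real (exp (- (pi / 2)))"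
    using exp_half_pi(1) nonzero(5) by (simp add: q_def field_simps)
  have xB: "B / p = inverse q * of_real (exp (- (pi / 2)))"
    unfolding exp_half_pi(2) q_def using p by (simp add: field_simps)
  have r: "((\<lambda>j. t j * right_exp pi (of_int j / 2)) has_sum ((p / A) ^ 1 / (1 - p / A))) UNIV"
  proof (rule has_sum_geometric_int[where h = "\<lambda>n. int n + 1"])
    show "cmod (p / A) < 1" using cmod_less(1) nonzero by (simp add: norm_divide)
    show "inj (\<lambda>n. int n + 1)" by (simp add: inj_def)
    show "t j * right_exp pi (of_int j / 2) = 0" if "j \<notin> range (\<lambda>n. int n + 1)" for j
    proof -
      have "\<not> 0 < j"
      proof
        assume "0 < j"
        then have "j = int (nat (j - 1)) + 1" by simp
        with that show False by blast
      qed
      then show ?thesis by (simp add: right_exp_def)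
    qed
    fix n
    have "t (int n + 1) = q ^ (n + 1)"
      unfolding tq using power_int_of_nat[of q "n + 1"] by (simp add: add.commute)
    moreover have "right_exp pi (of_int (int n + 1) / 2) = of_real (exp (- (pi / 2))) ^ (n + 1)"
    proof -
      have "exp (- (pi * (of_int (int n + 1) / 2))) = exp (- (pi / 2)) ^ (n + 1)"
        unfolding exp_of_nat_mult[symmetric] by (rule arg_cong[where f = exp]) (simp add: field_simps)
      then show ?thesis by (simp add: right_exp_def)
    qed
    ultimately show "t (int n + 1) * right_exp pi (of_int (int n + 1) / 2) = (p / A) ^ (n + 1)"
      unfolding xA power_mult_distrib by simp
  qed
  have l: "((\<lambda>j. t j * left_exp pi (of_int j / 2)) has_sum ((B / p) ^ 0 / (1 - B / p))) UNIV"
  proof (rule has_sum_geometric_int[where h = "\<lambda>n. - int n"])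
    show "cmod (B / p) < 1" using cmod_less(2) p by (simp add: norm_divide)
    show "inj (\<lambda>n. - int n)" by (simp add: inj_def)
    show "t j * left_exp pi (of_int j / 2) = 0" if "j \<notin> range (\<lambda>n. - int n)" for j
    proof -
      have "\<not> j \<le> 0"
      proof
        assume "j \<le> 0"
        then have "j = - int (nat (- j))" by simp
        with that show False by blast
      qed
      then show ?thesis by (simp add: left_exp_def)
    qed
    fix n
    have "t (- int n) = inverse q ^ n"
      unfolding tq by (simp add: power_int_minus power_inverse)
    moreover have "left_exp pi (of_int (- int n) / 2) = of_real (exp (- (pi / 2))) ^ n"
      by (simp add: left_exp_def exp_of_nat_mult[symmetric] algebra_simps flip: of_real_power)
    ultimately show "t (- int n) * left_exp pi (of_int (- int n) / 2) = (B / p) ^ (n + 0)"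
      unfolding xB power_mult_distrib by simp
  qed
  obtain C where C: "0 \<le> C" "\<And>u p j. p \<noteq> 0 \<Longrightarrow> \<bar>Im u - ln ((cmod p)\<^sup>2)\<bar> < pi + 1 \<Longrightarrow>
    cmod (p powi j * exp (\<i> * u * of_real (of_int j / 2)) * sech_rest pi \<theta> (of_int j / 2)) \<le> C * exp (- (1 / 2 * \<bar>real_of_int j\<bar>))"
    by (rule residue_rest_bound[OF \<theta>]) metis
  have "(\<lambda>j. C * exp (- (1 / 2 * \<bar>real_of_int j\<bar>))) summable_on UNIV"
    by (intro summable_on_cmult_right summable_exp_abs_int) auto
  then have "(\<lambda>j. norm (t j * sech_rest pi \<theta> (of_int j / 2))) summable_on UNIV"
    unfolding t_def by (rule summable_on_comparison_test) (use C(2)[OF p] lt1 in auto)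
  then have s: "((\<lambda>j. t j * sech_rest pi \<theta> (of_int j / 2)) has_sum residue_rest \<theta> u p) UNIV"
    unfolding residue_rest_def t_def[symmetric] by (rule has_sum_infsum[OF abs_summable_summable])
  have sum: "((\<lambda>j. 2 * cis (- \<theta>) * (t j * right_exp pi (of_int j / 2)) + 2 * cis \<theta> * (t j * left_exp pi (of_int j / 2))
      + t j * sech_rest pi \<theta> (of_int j / 2)) has_sum
     (2 * cis (- \<theta>) * ((p / A) ^ 1 / (1 - p / A)) + 2 * cis \<theta> * ((B / p) ^ 0 / (1 - B / p)) + residue_rest \<theta> u p)) UNIV"
    by (intro has_sum_add has_sum_cmult_right r l s)
  have eq: "2 * cis (- \<theta>) * (t j * right_exp pi (of_int j / 2)) + 2 * cis \<theta> * (t j * left_exp pi (of_int j / 2))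
      + t j * sech_rest pi \<theta> (of_int j / 2) = t j * sech pi \<theta> (of_int j / 2)" for j
    by (simp add: sech_rest_def algebra_simps)
  have eqA: "2 * cis (- \<theta>) * ((p / A) ^ 1 / (1 - p / A)) = 2 * cis (- \<theta>) * p / (A - p)"
    using nonzero by (simp add: field_simps)
  have eqB: "2 * cis \<theta> * ((B / p) ^ 0 / (1 - B / p)) = - (2 * cis \<theta> * p) / (B - p)"
    using nonzero p by (simp add: divide_simps) (simp add: algebra_simps)
  show ?thesis using sum unfolding eq eqA eqB unfolding t_def .
qed

end

section \<open>Shifting a line integral across a simple pole\<close>

lemma contour_integral_linepath_same_Im:
  assumes "a < b"
  shows "contour_integral (linepath (Complex a s) (Complex b s)) f = integral {a..b} (\<lambda>x. f (Complex x s))"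
proof -
  have lp: "linepath (Complex a s) (Complex b s) x = linepath (of_real a) (of_real b) x + \<i> * of_real s" for x
    by (simp add: linepath_def complex_eq_iff algebra_simps)
  have diff: "Complex b s - Complex a s = of_real b - of_real a"
    by (simp add: complex_eq_iff)
  have "contour_integral (linepath (Complex a s) (Complex b s)) f
      = contour_integral (linepath (of_real a) (of_real b)) (\<lambda>z. f (z + \<i> * of_real s))"
    by (simp add: contour_integral_integral lp diff)
  also have "\<dots> = integral {a..b} (\<lambda>x. f (of_real x + \<i> * of_real s))"
    using contour_integral_linepath_Reals_eq[of "of_real a" "of_real b" "\<lambda>z. f (z + \<i> * of_real s)"] assms
    by simp
  finally show ?thesis by (simp add: Complex_eq)
qed

lemma contour_integral_tendsto_line:
  fixes f :: "complex \<Rightarrow> complex"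
  assumes f: "integrable lborel (\<lambda>x. f (Complex x s))"
  shows "(\<lambda>n. contour_integral (linepath (Complex (- real n) s) (Complex (real n) s)) f)
     \<longlonglongrightarrow> (\<integral>x. f (Complex x s) \<partial>lborel)"
proof -
  have "(\<lambda>n. \<integral>x. indicator {- real n..real n} x *\<^sub>R f (Complex x s) \<partial>lborel) \<longlonglongrightarrow> (\<integral>x. f (Complex x s) \<partial>lborel)"
  proof (rule integral_dominated_convergence)
    show "integrable lborel (\<lambda>x. norm (f (Complex x s)))" using f by (rule integrable_norm)
    show "(\<lambda>x. f (Complex x s)) \<in> borel_measurable lborel" using f by (rule borel_measurable_integrable)
    then show "(\<lambda>x. indicator {- real n..real n} x *\<^sub>R f (Complex x s)) \<in> borel_measurable lborel" for n
      by measurable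
    show "AE x in lborel. (\<lambda>n. indicator {- real n..real n} x *\<^sub>R f (Complex x s)) \<longlonglongrightarrow> f (Complex x s)"
    proof (rule AE_I2)
      fix x :: real
      obtain N :: nat where N: "\<bar>x\<bar> \<le> real N" using real_arch_simple by blast
      have "\<forall>\<^sub>F n in sequentially. indicator {- real n..real n} x *\<^sub>R f (Complex x s) = f (Complex x s)"
        using eventually_ge_at_top[of N]
      proof eventually_elim
        case (elim n)
        then have "x \<in> {- real n..real n}" using N by (auto simp: abs_le_iff intro: order_trans)
        then show ?case by simp
      qed
      then show "(\<lambda>n. indicator {- real n..real n} x *\<^sub>R f (Complex x s)) \<longlonglongrightarrow> f (Complex x s)"
        by (rule tendsto_eventually)
    qed
    show "AE x in lborel. norm (indicator {- real n..real n} x *\<^sub>R f (Complex x s)) \<le> norm (f (Complex x s))" for n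
      by (rule AE_I2) (simp add: indicator_def)
  qed
  moreover have "\<forall>\<^sub>F n in sequentially. (\<integral>x. indicator {- real n..real n} x *\<^sub>R f (Complex x s) \<partial>lborel)
     = contour_integral (linepath (Complex (- real n) s) (Complex (real n) s)) f"
    using eventually_gt_at_top[of 0]
  proof eventually_elim
    case (elim n)
    have "set_integrable lborel {- real n..real n} (\<lambda>x. f (Complex x s))"
      unfolding set_integrable_def using integrable_mult_indicator[OF _ f, of "{- real n..real n}"] by simp
    then show ?case
      using contour_integral_linepath_same_Im[of "- real n" "real n" s f] elim
        set_borel_integral_eq_integral(2)[of "{- real n..real n}" "\<lambda>x. f (Complex x s)"]
      by (simp add: set_lebesgue_integral_def)
  qed
  ultimately show ?thesis by (rule Lim_transform_eventually)
qed

text \<open>The residue theorem on the rectangle with vertices \<open>\<plusminus>n\<close> and \<open>\<plusminus>n + ih\<close>. The bound \<open>B\<close> makes the vertical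
sides disappear in the limit.\<close>

lemma line_integral_shift_across_pole:
  assumes S: "open S" "connected S" and sub: "\<And>z. 0 \<le> Im z \<Longrightarrow> Im z \<le> h \<Longrightarrow> z \<in> S"
    and hol: "f holomorphic_on S - {z0}" and z0: "0 < Im z0" "Im z0 < h"
    and int: "integrable lborel (\<lambda>x. f (Complex x 0))" "integrable lborel (\<lambda>x. f (Complex x h))"
    and B: "B \<longlonglongrightarrow> 0"
    and side: "\<forall>\<^sub>F n in sequentially. \<forall>s\<in>{0..h}. cmod (f (Complex (real n) s)) \<le> B n \<and> cmod (f (Complex (- real n) s)) \<le> B n"
  shows "(\<integral>x. f (Complex x 0) \<partial>lborel) - (\<integral>x. f (Complex x h) \<partial>lborel) = 2 * pi * \<i> * residue f z0"
proof -
  define I where "I s n = contour_integral (linepath (Complex (- real n) s) (Complex (real n) s)) f" for s n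
  define R where "R n = contour_integral (linepath (Complex (real n) 0) (Complex (real n) h)) f" for n
  define L where "L n = contour_integral (linepath (Complex (- real n) h) (Complex (- real n) 0)) f" for n
  have h: "0 < h" using z0 by simp
  obtain N :: nat where N: "\<bar>Re z0\<bar> < real N" using reals_Archimedean2 by blast
  have cont: "continuous_on (closed_segment a b) f"
    if "closed_segment a b \<subseteq> {z. 0 \<le> Im z \<and> Im z \<le> h}" "z0 \<notin> closed_segment a b" for a b
    using holomorphic_on_imp_continuous_on[OF hol] that sub by (auto intro: continuous_on_subset)
  have conv: "convex {z. 0 \<le> Im z \<and> Im z \<le> h}"
    using convex_halfspace_Im_ge[of 0] convex_halfspace_Im_le[of h] convex_Int by (simp add: Collect_conj_eq)
  have seg: "closed_segment a b \<subseteq> {z. 0 \<le> Im z \<and> Im z \<le> h}"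
    if "0 \<le> Im a" "Im a \<le> h" "0 \<le> Im b" "Im b \<le> h" for a b
    using that by (intro closed_segment_subset conv) auto
  have same_Im: "Im z = Im a" if "z \<in> closed_segment a b" "Im a = Im b" for z a b
    using that closed_segment_same_Im by auto
  have same_Re: "Re z = Re a" if "z \<in> closed_segment a b" "Re a = Re b" for z a b
    using that closed_segment_same_Re by auto
  have main: "\<forall>\<^sub>F n in sequentially. I 0 n + R n - I h n + L n = 2 * pi * \<i> * residue f z0 \<and>
      cmod (R n) \<le> B n * h \<and> cmod (L n) \<le> B n * h"
    using eventually_ge_at_top[of N] eventually_gt_at_top[of 0] side
  proof eventually_elim
    case (elim n)
    let ?a1 = "Complex (- real n) 0" and ?a2 = "Complex (real n) 0"
    let ?a3 = "Complex (real n) h" and ?a4 = "Complex (- real n) h"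
    have Nn: "\<bar>Re z0\<bar> < real n" using N elim(1) by linarith
    have notin: "z0 \<notin> closed_segment ?a1 ?a2" "z0 \<notin> closed_segment ?a2 ?a3"
      "z0 \<notin> closed_segment ?a3 ?a4" "z0 \<notin> closed_segment ?a4 ?a1"
      using same_Im[of z0 ?a1 ?a2] same_Re[of z0 ?a2 ?a3] same_Im[of z0 ?a3 ?a4] same_Re[of z0 ?a4 ?a1]
        z0 Nn by auto
    have segs: "closed_segment ?a1 ?a2 \<subseteq> {z. 0 \<le> Im z \<and> Im z \<le> h}" "closed_segment ?a2 ?a3 \<subseteq> {z. 0 \<le> Im z \<and> Im z \<le> h}"
      "closed_segment ?a3 ?a4 \<subseteq> {z. 0 \<le> Im z \<and> Im z \<le> h}" "closed_segment ?a4 ?a1 \<subseteq> {z. 0 \<le> Im z \<and> Im z \<le> h}"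
      by (rule seg; use h in simp)+
    have ci: "f contour_integrable_on linepath ?a1 ?a2" "f contour_integrable_on linepath ?a2 ?a3"
      "f contour_integrable_on linepath ?a3 ?a4" "f contour_integrable_on linepath ?a4 ?a1"
      by (intro contour_integrable_continuous_linepath cont segs notin)+
    have rp: "rectpath ?a1 ?a3 = linepath ?a1 ?a2 +++ linepath ?a2 ?a3 +++ linepath ?a3 ?a4 +++ linepath ?a4 ?a1"
      by (simp add: rectpath_def Let_def)
    have "contour_integral (rectpath ?a1 ?a3) f = 2 * pi * \<i> * (\<Sum>q\<in>{z0}. winding_number (rectpath ?a1 ?a3) q * residue f q)"
    proof (rule Residue_theorem[OF S _ hol])
      have "path_image (rectpath ?a1 ?a3) = closed_segment ?a1 ?a2 \<union> closed_segment ?a2 ?a3 \<union> closed_segment ?a3 ?a4 \<union> closed_segment ?a4 ?a1"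
        unfolding rp by (auto simp: path_image_join)
      then show "path_image (rectpath ?a1 ?a3) \<subseteq> S - {z0}"
        using segs notin sub by blast
      show "\<forall>z. z \<notin> S \<longrightarrow> winding_number (rectpath ?a1 ?a3) z = 0"
      proof (intro allI impI winding_number_rectpath_outside)
        fix z assume "z \<notin> S"
        then show "z \<notin> cbox ?a1 ?a3" using sub by (auto simp: in_cbox_complex_iff)
      qed (use h in auto)
    qed auto
    also have "\<dots> = 2 * pi * \<i> * residue f z0"
      using winding_number_rectpath[of z0 ?a1 ?a3] z0 Nn by (simp add: in_box_complex_iff abs_less_iff)
    also have "contour_integral (rectpath ?a1 ?a3) f
        = contour_integral (linepath ?a1 ?a2) f + contour_integral (linepath ?a2 ?a3) f
          + contour_integral (linepath ?a3 ?a4) f + contour_integral (linepath ?a4 ?a1) f"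
      unfolding rp using ci by simp
    also have "contour_integral (linepath ?a3 ?a4) f = - I h n"
      unfolding I_def by (rule contour_integral_reverse_linepath) (intro cont segs notin)
    finally have "I 0 n + R n - I h n + L n = 2 * pi * \<i> * residue f z0"
      by (simp add: I_def R_def L_def)
    moreover have B0: "0 \<le> B n" using elim(3) h order_trans[OF norm_ge_zero] by (metis atLeastAtMost_iff less_imp_le order_refl)
    have bound: "cmod (f z) \<le> B n" if "z \<in> {z. 0 \<le> Im z \<and> Im z \<le> h}" "Re z = real n \<or> Re z = - real n" for z
      using that elim(3) complex.collapse[of z] by (metis (no_types, lifting) atLeastAtMost_iff mem_Collect_eq)
    have "cmod (R n) \<le> B n * cmod (?a3 - ?a2)"
      unfolding R_def using segs(2) same_Re[of _ ?a2 ?a3] by (intro contour_integral_bound_linepath ci B0 bound) auto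
    moreover have "cmod (L n) \<le> B n * cmod (?a1 - ?a4)"
      unfolding L_def using segs(4) same_Re[of _ ?a4 ?a1] by (intro contour_integral_bound_linepath ci B0 bound) auto
    moreover have "cmod (?a3 - ?a2) = h" "cmod (?a1 - ?a4) = h"
      using h by (simp_all add: cmod_def)
    ultimately show ?case by simp
  qed
  have Bh: "(\<lambda>n. B n * h) \<longlonglongrightarrow> 0" using tendsto_mult[OF B tendsto_const[of h]] by simp
  have "R \<longlonglongrightarrow> 0"
    by (rule Lim_null_comparison[OF _ Bh]) (use main in \<open>auto elim: eventually_mono\<close>)
  moreover have "L \<longlonglongrightarrow> 0"
    by (rule Lim_null_comparison[OF _ Bh]) (use main in \<open>auto elim: eventually_mono\<close>)
  moreover have "I 0 \<longlonglongrightarrow> (\<integral>x. f (Complex x 0) \<partial>lborel)" "I h \<longlonglongrightarrow> (\<integral>x. f (Complex x h) \<partial>lborel)"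
    unfolding I_def by (intro contour_integral_tendsto_line int)+
  ultimately have "(\<lambda>n. I 0 n + R n - I h n + L n) \<longlonglongrightarrow>
     (\<integral>x. f (Complex x 0) \<partial>lborel) + 0 - (\<integral>x. f (Complex x h) \<partial>lborel) + 0"
    by (intro tendsto_intros)
  moreover have "(\<lambda>n. I 0 n + R n - I h n + L n) \<longlonglongrightarrow> 2 * pi * \<i> * residue f z0"
    by (rule tendsto_eventually) (use main in \<open>auto elim: eventually_mono\<close>)
  ultimately show ?thesis using LIMSEQ_unique by fastforce
qed

section \<open>Shifting the line of integration in the kernel\<close>

lemma decay_sech:
  assumes "cos \<phi> \<noteq> 0" "0 < \<mu>"
  shows "decay \<mu> (sech \<mu> \<phi>)"
  unfolding sech_eq using assms decay_mono[OF decay_sech_rest[OF assms], of \<mu>]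
  by (intro decay_add decay_cmult decay_right_exp decay_left_exp) auto

lemma sech_minus: "sech \<mu> \<phi> (- x) = sech \<mu> (- \<phi>) x"
proof -
  have "cosh (Complex (\<mu> * (- x)) \<phi>) = cosh (- Complex (\<mu> * x) (- \<phi>))" by (rule arg_cong[where f = cosh]) (simp add: complex_eq_iff)
  then show ?thesis by (simp add: sech_def)
qed

lemma sech_zero: "sech \<mu> 0 x = of_real (inverse (cosh (\<mu> * x)))"
  by (simp add: sech_def cosh_Complex complex_eq_iff)

text \<open>For the factor \<open>cosh (c (\<xi> - y))\<close> the cosine in \<open>norm_cosh_ge\<close> vanishes somewhere on the vertical sides of the
rectangle. Far from the origin this bound is used instead.\<close>

lemma norm_cosh_ge_sinh: "\<bar>sinh a\<bar> \<le> cmod (cosh (Complex a b))"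
proof -
  have "(sinh a)\<^sup>2 = (sinh a)\<^sup>2 * ((cos b)\<^sup>2 + (sin b)\<^sup>2)" by simp
  also have "\<dots> \<le> (cosh a * cos b)\<^sup>2 + (sinh a * sin b)\<^sup>2"
    unfolding power_mult_distrib distrib_left using sinh_square_eq[of a]
    by (intro add_mono mult_right_mono) auto
  finally show ?thesis unfolding cosh_Complex cmod_def by (intro real_le_rsqrt) simp
qed

lemma exp_le_sinh:
  assumes "1 \<le> \<bar>a :: real\<bar>"
  shows "exp \<bar>a\<bar> / 4 \<le> \<bar>sinh a\<bar>"
proof -
  have "2 * exp (- \<bar>a\<bar>) \<le> exp \<bar>a\<bar>"
  proof -
    have "1 + \<bar>a\<bar> \<le> exp \<bar>a\<bar>" by (rule exp_ge_add_one_self)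
    then have "2 \<le> exp \<bar>a\<bar>" using assms by linarith
    moreover have "exp (- \<bar>a\<bar>) \<le> 1" by simp
    ultimately show ?thesis by linarith
  qed
  then have "exp \<bar>a\<bar> / 4 \<le> sinh \<bar>a\<bar>" by (simp add: sinh_def)
  then show ?thesis by (cases "0 \<le> a") (simp_all add: abs_if)
qed

text \<open>The integral over the line \<open>Im \<xi> = \<sigma> h\<close>, without the factor \<open>e\<^bsup>-\<sigma> u h\<^esup>\<close>; here \<open>y\<close> stands for \<open>j / 2\<close>.
For \<open>h = 0\<close> it is the integral in the Szego kernel.\<close>

definition line_integral :: "real \<Rightarrow> real \<Rightarrow> real \<Rightarrow> real \<Rightarrow> complex \<Rightarrow> complex" where
  "line_integral c h y \<sigma> u = (\<integral>x. exp (\<i> * u * of_real x) * sech pi (\<sigma> * pi * h) x * sech c (\<sigma> * c * h) (x - y) \<partial>lborel)"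

lemma cosh_Complex_eq_0:
  assumes "cosh (Complex a b) = 0"
  shows "a = 0 \<and> cos b = 0"
proof -
  have "cos b = 0" "\<bar>sinh a\<bar> \<le> 0"
    using assms norm_cosh_ge_exp[of b a] norm_cosh_ge_sinh[of a b] by (auto simp: mult_le_0_iff)
  then show ?thesis by simp
qed

context inner_point
begin

lemma abs_Im_u: "\<bar>Im u\<bar> < pi + c"
  using lt1 lt2 by linarith

lemma integrable_line:
  assumes "cos \<phi> \<noteq> 0" "cos \<psi> \<noteq> 0"
  shows "integrable lborel (\<lambda>x. exp (\<i> * u * of_real x) * sech pi \<phi> x * sech c \<psi> (x - of_int j / 2))"
proof -
  have "integrable lborel (\<lambda>x. inverse (p powi j) * pairing_integrand (sech pi \<phi>) (sech c \<psi>) j u p x)"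
    by (intro integrable_mult_right pairing_integrable[OF decay_sech decay_sech p lt1 lt2] assms c pi_gt_zero)
  moreover have "inverse (p powi j) * (p powi j * z) = z" for z using p by simp
  ultimately show ?thesis unfolding pairing_integrand_def by simp
qed

text \<open>The bounds on \<open>h\<close> say that between the two lines \<open>cosh (\<pi> \<xi>)\<close> has no zero and \<open>cosh (c (\<xi> - y))\<close> has
exactly one, \<open>y + i \<pi> / (2c)\<close>, where its derivative is \<open>ic\<close>.\<close>

lemma line_integral_shift:
  assumes h: "pi / (2 * c) < h" "h < 1 / 2" "h < 3 * pi / (2 * c)" and y: "y = of_int j / 2"
  shows "line_integral c 0 y 1 u = 2 * pi / c * exp (\<i> * u * of_real y) * exp (- (u * of_real (pi / (2 * c)))) * sech pi (pi * pi / (2 * c)) y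
       + exp (- (u * of_real h)) * line_integral c h y 1 u"
proof -
  define F :: "complex \<Rightarrow> complex" where "F z = exp (\<i> * u * z) / cosh (of_real pi * z)" for z
  define g :: "complex \<Rightarrow> complex" where "g z = cosh (of_real c * (z - of_real y))" for z
  define z0 where "z0 = Complex y (pi / (2 * c))"
  \<comment> \<open>The integrand is meromorphic on an open strip \<open>S\<close> that is slightly larger than the closed strip between the lines.\<close>
  define H where "H = min (1 / 2) (3 * pi / (2 * c))"
  define S where "S = {z. - (pi / (2 * c)) < Im z} \<inter> {z. Im z < H}"
  have pc: "0 < pi / (2 * c)" "pi / (2 * c) < 1 / 2"
  proof -
    show "0 < pi / (2 * c)" using c by simp
    show "pi / (2 * c) < 1 / 2" using h(1,2) by (rule less_trans)
  qed
  have h0: "0 < h" "h < H" "H \<le> 1 / 2" "H \<le> 3 * pi / (2 * c)" using h pc by (auto simp: H_def)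
  have Sopen: "open S" and Sconv: "convex S"
    unfolding S_def by (auto intro!: open_Int open_halfspace_Im_gt open_halfspace_Im_lt convex_Int convex_halfspace_Im_gt convex_halfspace_Im_lt)
  have eqF: "of_real pi * Complex x s = Complex (pi * x) (pi * s)"
    and eqg: "of_real c * (Complex x s - of_real y) = Complex (c * (x - y)) (c * s)" for x s
    by (simp_all add: complex_eq_iff)
  have cosF: "cos (pi * s) > 0" if "- (pi / (2 * c)) < s" "s < H" for s
  proof (rule cos_gt_zero_pi)
    have "-1/2 < s" "s < 1/2" using that pc h0 by linarith+
    then show "- (pi / 2) < pi * s" "pi * s < pi / 2"
      using mult_strict_left_mono[of "-1/2" s pi] mult_strict_left_mono[of s "1/2" pi] by auto
  qed
  have F0: "cosh (of_real pi * z) \<noteq> 0" if "z \<in> S" for z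
    using that cosF[of "Im z"] cosh_Complex_eq_0[of "pi * Re z" "pi * Im z"] eqF[of "Re z" "Im z"]
    by (auto simp: S_def)
  have g0: "z = z0" if "z \<in> S" "g z = 0" for z
  proof -
    have "c * (Re z - y) = 0" "cos (c * Im z) = 0"
      using that(2) cosh_Complex_eq_0[of "c * (Re z - y)" "c * Im z"] eqg[of "Re z" "Im z"] by (auto simp: g_def)
    then obtain k :: int where k: "odd k" "c * Im z = of_int k * (pi / 2)" and re: "Re z = y"
      using c by (auto simp: cos_zero_iff_int)
    have "- (pi / (2 * c)) * c < Im z * c" "Im z * c < 3 * pi / (2 * c) * c"
      using that(1) c h0(4) unfolding S_def by (intro mult_strict_right_mono; simp)+
    then have "- (pi / 2) < of_int k * (pi / 2)" "of_int k * (pi / 2) < 3 * (pi / 2)"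
      using c unfolding k(2)[symmetric] by (simp_all add: mult.commute)
    then have "(-1) * (pi / 2) < of_int k * (pi / 2)" "of_int k * (pi / 2) < 3 * (pi / 2)" by auto
    then have "- 1 < real_of_int k" "real_of_int k < 3"
      unfolding mult_less_cancel_right_disj by (auto simp: not_less)
    then have "k = 1" using k(1) by (cases "k = 0 \<or> k = 2") auto
    then show ?thesis using k(2) re c by (auto simp: z0_def complex_eq_iff field_simps)
  qed
  have z0S: "z0 \<in> S" using pc h h0 by (auto simp: S_def z0_def)
  have gz0: "g z0 = 0"
    using c unfolding g_def z0_def eqg by (simp add: cosh_Complex complex_eq_iff)
  have dg: "(g has_field_derivative (c * \<i>)) (at z0)"
  proof -
    have "(g has_field_derivative (sinh (of_real c * (z0 - of_real y)) * of_real c)) (at z0)"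
      unfolding g_def by (auto intro!: derivative_eq_intros)
    moreover have "of_real c * (z0 - of_real y) = \<i> * of_real (pi / 2)"
      unfolding z0_def eqg using c by (simp add: complex_eq_iff)
    moreover have "sinh (\<i> * of_real (pi / 2)) = \<i>"
      by (simp add: sinh_def exp_eq_polar complex_eq_iff scaleR_conv_of_real)
    ultimately show ?thesis by (simp add: mult.commute)
  qed
  have hol_cosh: "(\<lambda>z. cosh (f z)) holomorphic_on S" if "f holomorphic_on S" for f :: "complex \<Rightarrow> complex"
    unfolding cosh_field_def using that by (intro holomorphic_intros) auto
  have holF: "F holomorphic_on S" unfolding F_def using F0 by (intro holomorphic_intros hol_cosh) auto
  have holg: "g holomorphic_on S" unfolding g_def by (intro holomorphic_intros hol_cosh)
  have holf: "(\<lambda>z. F z / g z) holomorphic_on S - {z0}"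
    by (intro holomorphic_on_divide holomorphic_on_subset[OF holF] holomorphic_on_subset[OF holg]) (use g0 in auto)
  have val: "F (Complex x s) / g (Complex x s) = exp (- (u * of_real s)) * (exp (\<i> * u * of_real x) * sech pi (pi * s) x * sech c (c * s) (x - y))" for x s
  proof -
    have "exp (\<i> * u * Complex x s) = exp (- (u * of_real s)) * exp (\<i> * u * of_real x)"
      unfolding exp_add[symmetric] by (rule arg_cong[where f = exp]) (simp add: Complex_eq algebra_simps)
    then show ?thesis unfolding F_def g_def eqF eqg sech_def by (simp add: divide_inverse)
  qed
  have res: "residue (\<lambda>z. F z / g z) z0 = F z0 / (c * \<i>)"
    by (rule residue_simple_pole_deriv[OF holF holg Sopen convex_connected[OF Sconv] z0S dg _ gz0])
       (use F0[OF z0S] c in \<open>auto simp: F_def\<close>)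
  have coscne: "cos (c * h) \<noteq> 0"
  proof
    assume "cos (c * h) = 0"
    then have "g (Complex y h) = 0" unfolding g_def eqg by (simp add: cosh_Complex complex_eq_iff)
    moreover have "Complex y h \<in> S" using h0 pc by (auto simp: S_def)
    ultimately show False using g0 h by (fastforce simp: z0_def)
  qed
  have coshne: "cos (pi * h) > 0" using cosF[of h] h0 pc by auto
  define K where "K = exp (\<bar>Re u\<bar> * h) * (2 / cos (pi * h)) * (4 * exp (c * \<bar>y\<bar>))"
  define B where "B n = K * exp (- ((pi + c - \<bar>Im u\<bar>) * real n))" for n
  have "(\<integral>x. F (Complex x 0) / g (Complex x 0) \<partial>lborel) - (\<integral>x. F (Complex x h) / g (Complex x h) \<partial>lborel)
     = 2 * pi * \<i> * residue (\<lambda>z. F z / g z) z0"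
  proof (rule line_integral_shift_across_pole[OF Sopen convex_connected[OF Sconv] _ holf])
    show "z \<in> S" if "0 \<le> Im z" "Im z \<le> h" for z using that pc h0 by (auto simp: S_def)
    show "0 < Im z0" "Im z0 < h" using pc h by (auto simp: z0_def)
    show "integrable lborel (\<lambda>x. F (Complex x 0) / g (Complex x 0))"
      unfolding val y by (intro integrable_mult_right integrable_line) auto
    show "integrable lborel (\<lambda>x. F (Complex x h) / g (Complex x h))"
      unfolding val y using coshne coscne by (intro integrable_mult_right integrable_line) auto
    have "0 < pi + c - \<bar>Im u\<bar>" using abs_Im_u by linarith
    then have "(\<lambda>n. exp (- ((pi + c - \<bar>Im u\<bar>) * real n))) \<longlonglongrightarrow> 0" by real_asymp
    from tendsto_mult[OF tendsto_const[of K] this] show "B \<longlonglongrightarrow> 0" unfolding B_def by simp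
    \<comment> \<open>From \<open>N\<close> on, \<open>c (n - \<bar>y\<bar>) \<ge> 1\<close>, as \<open>exp_le_sinh\<close> requires.\<close>
    obtain N :: nat where N: "\<bar>y\<bar> + 1 / c < real N" using reals_Archimedean2 by blast
    have bd: "cmod (F (Complex x s) / g (Complex x s)) \<le> B n"
      if x: "\<bar>x\<bar> = real n" and n: "N \<le> n" and s: "0 \<le> s" "s \<le> h" for x s n
    proof -
      have 1: "cmod (exp (- (u * of_real s)) * exp (\<i> * u * of_real x)) \<le> exp (\<bar>Re u\<bar> * h) * exp (\<bar>Im u\<bar> * real n)"
      proof -
        have "- (Re u * s) \<le> \<bar>Re u\<bar> * h"
          using mult_mono[of "\<bar>Re u\<bar>" "\<bar>Re u\<bar>" s h] s abs_ge_minus_self[of "Re u * s"] by (simp add: abs_mult)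
        moreover have "- (Im u * x) \<le> \<bar>Im u\<bar> * real n"
          using abs_ge_minus_self[of "Im u * x"] x by (simp add: abs_mult)
        ultimately show ?thesis unfolding norm_mult norm_exp_eq_Re by (intro mult_mono) auto
      qed
      have "cos (pi * h) \<le> cos (pi * s)"
      proof -
        have "pi * h \<le> pi" using h by (simp add: mult_le_cancel_left1)
        then show ?thesis using s by (intro cos_monotone_0_pi_le) auto
      qed
      then have cs: "cos (pi * h) \<le> \<bar>cos (pi * s)\<bar>" "cos (pi * s) \<noteq> 0" using coshne by auto
      have "cmod (sech pi (pi * s) x) \<le> 2 / \<bar>cos (pi * s)\<bar> * exp (- \<bar>pi * x\<bar>)"
        by (rule norm_sech_le(1)[OF cs(2)])
      also have "\<dots> \<le> 2 / cos (pi * h) * exp (- (pi * real n))"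
        using cs coshne x by (intro mult_mono divide_left_mono) (auto simp: abs_mult)
      finally have 2: "cmod (sech pi (pi * s) x) \<le> 2 / cos (pi * h) * exp (- (pi * real n))" .
      have "real n - \<bar>y\<bar> \<le> \<bar>x - y\<bar>" using x by linarith
      then have a: "c * (real n - \<bar>y\<bar>) \<le> \<bar>c * (x - y)\<bar>" using c by (simp add: abs_mult)
      have "1 / c < real n - \<bar>y\<bar>" using N n by linarith
      then have "1 < c * (real n - \<bar>y\<bar>)" using c by (simp add: field_simps)
      then have "exp \<bar>c * (x - y)\<bar> / 4 \<le> \<bar>sinh (c * (x - y))\<bar>" using a by (intro exp_le_sinh) linarith
      moreover have "exp (c * (real n - \<bar>y\<bar>)) / 4 \<le> exp \<bar>c * (x - y)\<bar> / 4" using a by simp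
      ultimately have "exp (c * (real n - \<bar>y\<bar>)) / 4 \<le> cmod (cosh (Complex (c * (x - y)) (c * s)))"
        using norm_cosh_ge_sinh[of "c * (x - y)" "c * s"] by linarith
      then have "cmod (sech c (c * s) (x - y)) \<le> inverse (exp (c * (real n - \<bar>y\<bar>)) / 4)"
        unfolding sech_def norm_inverse by (rule le_imp_inverse_le) simp
      also have "\<dots> = 4 * exp (c * \<bar>y\<bar>) * exp (- (c * real n))"
        by (simp add: right_diff_distrib exp_diff exp_minus field_simps)
      finally have 3: "cmod (sech c (c * s) (x - y)) \<le> 4 * exp (c * \<bar>y\<bar>) * exp (- (c * real n))" .
      have "cmod (F (Complex x s) / g (Complex x s))
        = cmod (exp (- (u * of_real s)) * exp (\<i> * u * of_real x)) * cmod (sech pi (pi * s) x) * cmod (sech c (c * s) (x - y))"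
        unfolding val by (simp add: norm_mult)
      also have "\<dots> \<le> (exp (\<bar>Re u\<bar> * h) * exp (\<bar>Im u\<bar> * real n)) * (2 / cos (pi * h) * exp (- (pi * real n)))
          * (4 * exp (c * \<bar>y\<bar>) * exp (- (c * real n)))"
        using 1 2 3 coshne by (intro mult_mono) auto
      also have "\<dots> = K * (exp (\<bar>Im u\<bar> * real n) * exp (- (pi * real n)) * exp (- (c * real n)))"
        unfolding K_def by (simp only: mult_ac)
      also have "exp (\<bar>Im u\<bar> * real n) * exp (- (pi * real n)) * exp (- (c * real n)) = exp (- ((pi + c - \<bar>Im u\<bar>) * real n))"
        unfolding exp_add[symmetric] by (simp add: algebra_simps)
      finally show ?thesis unfolding B_def .
    qed
    show "\<forall>\<^sub>F n in sequentially. \<forall>s\<in>{0..h}. cmod (F (Complex (real n) s) / g (Complex (real n) s)) \<le> B n \<and>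
       cmod (F (Complex (- real n) s) / g (Complex (- real n) s)) \<le> B n"
      using eventually_ge_at_top[of N] by eventually_elim (auto intro!: bd)
  qed
  moreover have "(\<integral>x. F (Complex x s) / g (Complex x s) \<partial>lborel) = exp (- (u * of_real s)) * line_integral c s y 1 u" for s
    unfolding val line_integral_def mult_1_left by (rule integral_mult_right_zero)
  ultimately have "exp (- (u * of_real 0)) * line_integral c 0 y 1 u - exp (- (u * of_real h)) * line_integral c h y 1 u
      = 2 * pi * \<i> * (F z0 / (c * \<i>))"
    unfolding res by (simp only:)
  then have shift: "line_integral c 0 y 1 u = 2 * pi * \<i> * (F z0 / (c * \<i>)) + exp (- (u * of_real h)) * line_integral c h y 1 u"
    by (simp only: of_real_0 mult_zero_right minus_zero exp_zero mult_1_left diff_eq_eq)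
  have eq1: "2 * pi * \<i> * (F z0 / (c * \<i>)) = 2 * pi / c * F z0" using c by simp
  have eq2: "F z0 = exp (\<i> * u * of_real y) * exp (- (u * of_real (pi / (2 * c)))) * sech pi (pi * pi / (2 * c)) y"
  proof -
    have "\<i> * u * z0 = \<i> * u * of_real y + - (u * of_real (pi / (2 * c)))"
      unfolding z0_def Complex_eq by (simp only: distrib_left mult.assoc) (simp add: mult_ac)
    then have "exp (\<i> * u * z0) = exp (\<i> * u * of_real y) * exp (- (u * of_real (pi / (2 * c))))"
      by (simp only: exp_add)
    moreover have "F z0 = exp (\<i> * u * z0) * sech pi (pi * pi / (2 * c)) y"
      unfolding F_def sech_def unfolding z0_def eqF by (simp only: divide_inverse mult.assoc)
    ultimately show ?thesis by (simp only:)
  qed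
  show ?thesis using shift unfolding eq1 unfolding eq2 by (simp only: mult.assoc)
qed

lemma inner_point_reflect: "inner_point c (- u) (inverse p)"
proof
  have "ln ((cmod (inverse p))\<^sup>2) = - ln ((cmod p)\<^sup>2)"
    using p by (simp add: norm_inverse power_inverse ln_inverse)
  then show "\<bar>Im (- u) - ln ((cmod (inverse p))\<^sup>2)\<bar> < pi" "\<bar>ln ((cmod (inverse p))\<^sup>2)\<bar> < c"
    using lt1 lt2 by auto
qed (use c p in auto)

text \<open>The substitution \<open>\<xi> \<mapsto> -\<xi>\<close> turns the downward shift for \<open>(u, p)\<close> into the upward shift for \<open>(-u, 1 / p)\<close>,
with \<open>j\<close> replaced by \<open>-j\<close>.\<close>

lemma line_integral_reflect: "line_integral c h (- y) 1 (- u) = line_integral c h y (- 1) u"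
proof -
  have "line_integral c h (- y) 1 (- u)
    = (\<integral>x. exp (\<i> * - u * of_real (0 + (-1) * x)) * sech pi (pi * h) (0 + (-1) * x) * sech c (c * h) (0 + (-1) * x - - y) \<partial>lborel)"
    unfolding line_integral_def by (subst lborel_integral_real_affine[where c = "-1" and t = 0]) auto
  also have "\<dots> = line_integral c h y (- 1) u"
    unfolding line_integral_def
  proof (rule arg_cong[where f = "integral\<^sup>L lborel"], rule ext)
    fix x :: real
    have "0 + (-1) * x - - y = - (x - y)" "0 + (-1) * x = - x" by auto
    then show "exp (\<i> * - u * of_real (0 + (-1) * x)) * sech pi (pi * h) (0 + (-1) * x) * sech c (c * h) (0 + (-1) * x - - y)
      = exp (\<i> * u * of_real x) * sech pi (- 1 * pi * h) x * sech c (- 1 * c * h) (x - y)"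
      by (simp only: sech_minus) simp
  qed
  finally show ?thesis .
qed

lemma line_integral_shift_signed:
  assumes h: "pi / (2 * c) < h" "h < 1 / 2" "h < 3 * pi / (2 * c)" and \<sigma>: "\<sigma> \<in> {1, - 1}"
  shows "line_integral c 0 (of_int j / 2) \<sigma> u = 2 * pi / c * exp (\<i> * u * of_real (of_int j / 2))
         * exp (- of_real \<sigma> * (u * of_real (pi / (2 * c)))) * sech pi (\<sigma> * (pi * pi / (2 * c))) (of_int j / 2)
       + exp (- of_real \<sigma> * (u * of_real h)) * line_integral c h (of_int j / 2) \<sigma> u"
proof (cases "\<sigma> = 1")
  case True
  then show ?thesis using line_integral_shift[OF h refl, of j] by simp
next
  case False
  then have s: "\<sigma> = - 1" using \<sigma> by simp
  have "line_integral c 0 (of_int (- j) / 2) 1 (- u) = 2 * pi / c * exp (\<i> * (- u) * of_real (of_int (- j) / 2))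
     * exp (- ((- u) * of_real (pi / (2 * c)))) * sech pi (pi * pi / (2 * c)) (of_int (- j) / 2)
       + exp (- ((- u) * of_real h)) * line_integral c h (of_int (- j) / 2) 1 (- u)"
    by (rule inner_point.line_integral_shift[OF inner_point_reflect h refl])
  moreover have "of_int (- j) / 2 = - (of_int j / 2 :: real)" by simp
  ultimately show ?thesis unfolding s by (simp add: line_integral_reflect sech_minus)
qed

end

section \<open>Assembling the decomposition\<close>

definition series_term :: "real \<Rightarrow> int \<Rightarrow> complex \<Rightarrow> complex \<Rightarrow> complex" where
  "series_term c j u p = p powi j / (8 * of_real pi) * line_integral c 0 (of_int j / 2) 1 u"

lemma szego_term_eq:
  "szego_term \<beta> j w z = series_term (2 * \<beta> - pi) j (fst w - cnj (fst z)) (snd w * cnj (snd z))"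
proof -
  define u where "u = fst w - cnj (fst z)"
  have e: "exp (\<i> * u * of_real x) / of_real (cosh (pi * x) * cosh ((2 * \<beta> - pi) * (x - of_int j / 2)))
    = exp (\<i> * u * of_real x) * sech pi (1 * pi * 0) x * sech (2 * \<beta> - pi) (1 * (2 * \<beta> - pi) * 0) (x - of_int j / 2)" for x
    unfolding mult_zero_right sech_zero
    by (simp only: divide_inverse of_real_mult of_real_inverse inverse_mult_distrib mult.assoc)
  have p: "snd w powi j * cnj (snd z) powi j = (snd w * cnj (snd z)) powi j"
    by (rule power_int_mult_distrib[symmetric])
  show ?thesis
    unfolding szego_term_def series_term_def line_integral_def u_def[symmetric] e p by (rule refl)
qed

lemma worm_inner_point:
  assumes "w \<in> worm \<beta>" "z \<in> worm \<beta>"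
  shows "inner_point (2 * \<beta> - pi) (fst w - cnj (fst z)) (snd w * cnj (snd z))"
proof -
  have w: "snd w \<noteq> 0" "\<bar>Im (fst w) - ln ((cmod (snd w))\<^sup>2)\<bar> < pi / 2" "\<bar>ln ((cmod (snd w))\<^sup>2)\<bar> < \<beta> - pi / 2"
    and z: "snd z \<noteq> 0" "\<bar>Im (fst z) - ln ((cmod (snd z))\<^sup>2)\<bar> < pi / 2" "\<bar>ln ((cmod (snd z))\<^sup>2)\<bar> < \<beta> - pi / 2"
    using assms by (auto simp: worm_def case_prod_unfold)
  have ln: "ln ((cmod (snd w * cnj (snd z)))\<^sup>2) = ln ((cmod (snd w))\<^sup>2) + ln ((cmod (snd z))\<^sup>2)"
    using w(1) z(1) by (simp add: norm_mult power_mult_distrib ln_mult)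
  show ?thesis
  proof
    show "0 < 2 * \<beta> - pi" using w(3) by linarith
    show "snd w * cnj (snd z) \<noteq> 0" using w(1) z(1) by simp
    show "\<bar>Im (fst w - cnj (fst z)) - ln ((cmod (snd w * cnj (snd z)))\<^sup>2)\<bar> < pi"
    proof -
      have "Im (fst w - cnj (fst z)) = Im (fst w) + Im (fst z)" by simp
      then show ?thesis unfolding ln using w(2) z(2) by linarith
    qed
    show "\<bar>ln ((cmod (snd w * cnj (snd z)))\<^sup>2)\<bar> < 2 * \<beta> - pi"
      unfolding ln using w(3) z(3) by linarith
  qed
qed

lemma (in inner_point) series_term_split:
  assumes h: "pi / (2 * c) < h" "h < 1 / 2" "h < 3 * pi / (2 * c)" and \<sigma>: "\<sigma> \<in> {1, - 1}"
  shows "series_term c j u p =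
     exp (- of_real \<sigma> * (u * of_real (pi / (2 * c)))) * (of_real (1 / (4 * c)) *
       (p powi j * exp (\<i> * u * of_real (of_int j / 2)) * sech pi (\<sigma> * (pi * pi / (2 * c))) (of_int j / 2)))
   + exp (- of_real \<sigma> * (u * of_real h)) * (of_real (1 / (8 * pi)) *
       pairing_term (sech pi (\<sigma> * pi * h)) (sech c (\<sigma> * c * h)) j u p)"
proof -
  have 1: "line_integral c 0 (of_int j / 2) 1 u = line_integral c 0 (of_int j / 2) \<sigma> u"
    by (simp add: line_integral_def)
  have 2: "pairing_term (sech pi (\<sigma> * pi * h)) (sech c (\<sigma> * c * h)) j u p = p powi j * line_integral c h (of_int j / 2) \<sigma> u"
    unfolding pairing_term_def pairing_integrand_def line_integral_def by (rule integral_mult_right_zero)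
  have "P / (8 * of_real pi) * (of_real (2 * pi / c) * E * X * S + Y * L)
     = X * (of_real (1 / (4 * c)) * (P * E * S)) + Y * (of_real (1 / (8 * pi)) * (P * L))" for P E X S Y L :: complex
    using c by (simp add: field_simps)
  then show ?thesis
    unfolding series_term_def 1 2 line_integral_shift_signed[OF h \<sigma>] .
qed

lemma bholo_A: "bholo c (\<lambda>u p. exp ((of_real pi - \<i> * u) / 2))"
  and bholo_B: "bholo c (\<lambda>u p. exp (- ((\<i> * u + of_real pi) / 2)))"
proof -
  have "(of_real pi - \<i> * u) / 2 = of_real (pi / 2) + of_real (- 1 / 2) * \<i> * u"
    "- ((\<i> * u + of_real pi) / 2) = - of_real (pi / 2) + of_real (- 1 / 2) * \<i> * u" for u
    by (simp_all add: field_simps)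
  then show "bholo c (\<lambda>u p. exp ((of_real pi - \<i> * u) / 2))" "bholo c (\<lambda>u p. exp (- ((\<i> * u + of_real pi) / 2)))"
    using bholo_exp[of c "of_real (pi / 2)" "- 1 / 2"] bholo_exp[of c "- of_real (pi / 2)" "- 1 / 2"]
    by (simp_all only:)
qed

text \<open>The decomposition for functions of \<open>u\<close> and \<open>p\<close>, with \<open>c\<close> in place of \<open>2 \<beta> - \<pi>\<close>. The angles are \<open>\<theta> = \<sigma> \<pi>\<^sup>2 / (2c)\<close> for
the residues and \<open>\<phi> = \<sigma> \<pi> h\<close>, \<open>\<psi> = \<sigma> c h\<close> for the shifted secants; the bounds on \<open>h\<close> and \<open>c > \<pi>\<close> keep
their cosines from vanishing. Since also \<open>c > 1\<close> and \<open>\<pi> > 1\<close>, tripled rates exceed the rates \<open>\<pi> + 2\<close> and \<open>c + 2\<close>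
that make pairings bounded on the strip.\<close>

lemma series_decomposition:
  assumes c: "pi < c" and h: "pi / (2 * c) < h" "h < 1 / 2" "h < 3 * pi / (2 * c)" and \<sigma>: "\<sigma> \<in> {1, - 1}"
  shows "\<exists>\<rho>\<^sub>1 \<rho>\<^sub>2 G\<^sub>1 G\<^sub>2 G\<^sub>3 G\<^sub>4 G\<^sub>5 G\<^sub>6 G\<^sub>7 G\<^sub>8 E E'.
    (\<forall>f\<in>{\<rho>\<^sub>1, \<rho>\<^sub>2, G\<^sub>1, G\<^sub>2, G\<^sub>3, G\<^sub>4, G\<^sub>5, G\<^sub>6, G\<^sub>7, G\<^sub>8, E, E'}. bholo c f) \<and>
    (\<forall>u p. inner_point c u p \<longrightarrow>
      (let A = exp ((of_real pi - \<i> * u) / 2);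
           B = exp (- ((\<i> * u + of_real pi) / 2));
           cc = complex_of_real (exp (c / 2));
           d = complex_of_real (exp (- (c / 2)));
           b = complex_of_real (pi + c);
           K = \<rho>\<^sub>1 u p / (A - p) + \<rho>\<^sub>2 u p / (B - p) + E u p;
           K' = G\<^sub>1 u p / ((\<i> * u + b) * (cc - p))
                + G\<^sub>2 u p / ((B - p) * (\<i> * u + b))
                + G\<^sub>3 u p / ((A - p) * (cc - p))
                + G\<^sub>4 u p / ((A - p) * (\<i> * u - b))
                + G\<^sub>5 u p / ((\<i> * u - b) * (d - p))
                + G\<^sub>6 u p / ((B - p) * (d - p))
                + G\<^sub>7 u p / (A - p)
                + G\<^sub>8 u p / (B - p)
                + E' u p
       in ((\<lambda>j. series_term c j u p) has_sum
           (exp (- of_real \<sigma> * (u * of_real (pi / (2 * c)))) * K + exp (- of_real \<sigma> * (u * of_real h)) * K')) UNIV))"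
proof -
  define \<theta> \<phi> \<psi> where "\<theta> = \<sigma> * (pi * pi / (2 * c))" and "\<phi> = \<sigma> * pi * h" and "\<psi> = \<sigma> * c * h"
  have c0: "0 < c" using c pi_gt_zero by linarith
  have cos_\<sigma>: "cos (\<sigma> * x) = cos x" for x using \<sigma> by auto
  have "0 < pi / (2 * c)" using c0 by simp
  then have h0: "0 < h" using h by linarith
  have cos_pi: "cos (pi * x) \<noteq> 0" if "0 < x" "x < 1 / 2" for x
  proof -
    have "pi * x < pi * (1 / 2)" using that by (intro mult_strict_left_mono) auto
    moreover have "0 < pi * x" using that by simp
    ultimately have "0 < cos (pi * x)" by (intro cos_gt_zero) auto
    then show ?thesis by simp
  qed
  have \<theta>: "cos \<theta> \<noteq> 0"
    using cos_pi[of "pi / (2 * c)"] c0 c unfolding \<theta>_def cos_\<sigma> by simp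
  have \<phi>: "cos \<phi> \<noteq> 0"
    using cos_pi[OF h0 h(2)] unfolding \<phi>_def mult.assoc cos_\<sigma> .
  \<comment> \<open>\<open>c h\<close> lies between \<open>\<pi> / 2\<close> and \<open>3 \<pi> / 2\<close>, where the cosine is negative.\<close>
  have "pi / 2 < c * h" "c * h < 3 * pi / 2" using h(1,3) c0 by (simp_all add: field_simps)
  then have "0 < cos (c * h - pi)" by (intro cos_gt_zero_pi) auto
  then have \<psi>: "cos \<psi> \<noteq> 0" unfolding \<psi>_def mult.assoc cos_\<sigma> by simp
  define k1 k2 where "k1 = complex_of_real (1 / (4 * c))" and "k2 = complex_of_real (1 / (8 * pi))"
  define A B where "A = (\<lambda>u. exp ((of_real pi - \<i> * u) / 2))" and "B = (\<lambda>u. exp (- ((\<i> * u + of_real pi) / 2)))"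
  define cc where "cc = complex_of_real (exp (c / 2))"
  define r1 r2 e where "r1 = (\<lambda>(u::complex) p. k1 * (2 * cis (- \<theta>) * p))" and "r2 = (\<lambda>(u::complex) p. k1 * (- (2 * cis \<theta> * p)))"
    and "e = (\<lambda>(u::complex) p. k1 * residue_rest \<theta> u p)"
  define g1 g2 where "g1 = (\<lambda>(u::complex) p. k2 * (4 * cis \<phi> * cis \<psi> * p))" and "g2 = (\<lambda>(u::complex) p. k2 * (- (4 * cis \<phi> * cis \<psi> * p)))"
  define g3 where "g3 = (\<lambda>(u::complex) p. k2 * (4 * cis (- \<phi>) * cis \<psi> * A u * cc * pairing (right_cell pi) (left_cell c) u p
        + 2 * cis \<psi> * cc * (A u - p) * pairing (sech_rest pi \<phi>) (left_cell c) u p))"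
  define g4 g5 where "g4 = (\<lambda>(u::complex) p. k2 * (- (4 * cis (- \<phi>) * cis (- \<psi>) * p)))" and "g5 = (\<lambda>(u::complex) p. k2 * (4 * cis (- \<phi>) * cis (- \<psi>) * p))"
  define g6 where "g6 = (\<lambda>(u::complex) p. k2 * (4 * cis \<phi> * cis (- \<psi>) * (p * p) * pairing (left_cell pi) (right_cell c) u p
        - 2 * cis (- \<psi>) * p * (B u - p) * pairing (sech_rest pi \<phi>) (right_cell c) u p))"
  define g7 g8 e' where "g7 = (\<lambda>(u::complex) p. k2 * (2 * cis (- \<phi>) * A u * pairing (right_cell pi) (sech_rest c \<psi>) u p))"
    and "g8 = (\<lambda>(u::complex) p. k2 * (- (2 * cis \<phi> * p * pairing (left_cell pi) (sech_rest c \<psi>) u p)))"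
    and "e' = (\<lambda>(u::complex) p. k2 * pairing (sech_rest pi \<phi>) (sech_rest c \<psi>) u p)"
  have bA: "bholo c (\<lambda>u p. A u)" and bB: "bholo c (\<lambda>u p. B u)"
    unfolding A_def B_def by (rule bholo_A bholo_B)+
  have dr: "decay (pi + 2) (sech_rest pi \<phi>)" "decay (c + 2) (sech_rest c \<psi>)"
    using decay_mono[OF decay_sech_rest[OF \<phi> pi_gt_zero], of "pi + 2"] decay_mono[OF decay_sech_rest[OF \<psi> c0], of "c + 2"]
      c pi_gt3 by linarith+
  have dc: "decay (pi + 2) (right_cell pi)" "decay (pi + 2) (left_cell pi)" "decay (c + 2) (right_cell c)" "decay (c + 2) (left_cell c)"
    using c0 by (auto intro!: decay_right_cell decay_left_cell)
  note bholo_intros = bholo_mult bholo_add bholo_diff bholo_uminus bholo_const bholo_snd bA bB bholo_pairing bholo_residue_rest[OF \<theta>] dr dc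
  have bholos: "bholo c r1" "bholo c r2" "bholo c g1" "bholo c g2" "bholo c g3" "bholo c g4" "bholo c g5" "bholo c g6"
      "bholo c g7" "bholo c g8" "bholo c e" "bholo c e'"
    unfolding r1_def r2_def g1_def g2_def g3_def g4_def g5_def g6_def g7_def g8_def e_def e'_def
    by (intro bholo_intros)+
  have sum: "((\<lambda>j. series_term c j u p) has_sum
        (exp (- of_real \<sigma> * (u * of_real (pi / (2 * c)))) * (r1 u p / (A u - p) + r2 u p / (B u - p) + e u p)
         + exp (- of_real \<sigma> * (u * of_real h)) *
           (g1 u p / ((\<i> * u + of_real (pi + c)) * (cc - p))
                + g2 u p / ((B u - p) * (\<i> * u + of_real (pi + c)))
                + g3 u p / ((A u - p) * (cc - p))
                + g4 u p / ((A u - p) * (\<i> * u - of_real (pi + c)))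
                + g5 u p / ((\<i> * u - of_real (pi + c)) * (of_real (exp (- (c / 2))) - p))
                + g6 u p / ((B u - p) * (of_real (exp (- (c / 2))) - p))
                + g7 u p / (A u - p)
                + g8 u p / (B u - p)
                + e' u p))) UNIV" (is "(_ has_sum (?x * ?K + ?y * ?K')) _") if ip: "inner_point c u p" for u p
  proof -
    have eqA: "inner_point.A u = A u" and eqB: "inner_point.B u = B u" and eqc: "inner_point.cc c = cc"
      and eqd: "inner_point.dd c = of_real (exp (- (c / 2)))" and eqb: "inner_point.bb c = of_real (pi + c)"
      unfolding inner_point.A_def[OF ip] inner_point.B_def[OF ip] inner_point.cc_def[OF ip] inner_point.dd_def[OF ip]
        inner_point.bb_def[OF ip] A_def B_def cc_def by (rule refl)+
    note ip' = ip[unfolded inner_point_def]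
    have "((\<lambda>j. k1 * (p powi j * exp (\<i> * u * of_real (of_int j / 2)) * sech pi \<theta> (of_int j / 2))) has_sum
        k1 * (2 * cis (- \<theta>) * p / (A u - p) + - (2 * cis \<theta> * p) / (B u - p) + residue_rest \<theta> u p)) UNIV"
      by (rule has_sum_cmult_right[OF inner_point.residue_sum[OF ip \<theta>, unfolded eqA eqB]])
    also have "k1 * (2 * cis (- \<theta>) * p / (A u - p) + - (2 * cis \<theta> * p) / (B u - p) + residue_rest \<theta> u p) = ?K"
      unfolding r1_def r2_def e_def by (simp only: distrib_left times_divide_eq_right)
    finally have 1: "((\<lambda>j. k1 * (p powi j * exp (\<i> * u * of_real (of_int j / 2)) * sech pi \<theta> (of_int j / 2))) has_sum ?K) UNIV" .
    have "((\<lambda>j. pairing_term (sech pi \<phi>) (sech c \<psi>) j u p) has_sum pairing (sech pi \<phi>) (sech c \<psi>) u p) UNIV"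
      using ip' by (intro pairing_has_sum[OF decay_sech[OF \<phi> pi_gt_zero] decay_sech[OF \<psi> c0]]) simp_all
    then have "((\<lambda>j. k2 * pairing_term (sech pi \<phi>) (sech c \<psi>) j u p) has_sum k2 * pairing (sech pi \<phi>) (sech c \<psi>) u p) UNIV"
      by (rule has_sum_cmult_right)
    also have "k2 * pairing (sech pi \<phi>) (sech c \<psi>) u p = ?K'"
      unfolding inner_point.pairing_sech[OF ip \<phi> \<psi>] eqA eqB eqc eqd eqb g1_def g2_def g3_def g4_def g5_def g6_def g7_def g8_def e'_def
      by (simp only: distrib_left times_divide_eq_right power2_eq_square)
    finally have 2: "((\<lambda>j. k2 * pairing_term (sech pi \<phi>) (sech c \<psi>) j u p) has_sum ?K') UNIV" .
    have "series_term c j u p = ?x * (k1 * (p powi j * exp (\<i> * u * of_real (of_int j / 2)) * sech pi \<theta> (of_int j / 2)))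
        + ?y * (k2 * pairing_term (sech pi \<phi>) (sech c \<psi>) j u p)" for j
      unfolding k1_def k2_def \<theta>_def \<phi>_def \<psi>_def by (rule inner_point.series_term_split[OF ip h \<sigma>])
    then show ?thesis
      using has_sum_add[OF has_sum_cmult_right[OF 1, of ?x] has_sum_cmult_right[OF 2, of ?y]] by (simp only:)
  qed
  have all_bholo: "\<forall>f\<in>{r1, r2, g1, g2, g3, g4, g5, g6, g7, g8, e, e'}. bholo c f"
    using bholos by simp
  show ?thesis
    by (rule exI[of _ r1], rule exI[of _ r2], rule exI[of _ g1], rule exI[of _ g2], rule exI[of _ g3], rule exI[of _ g4],
        rule exI[of _ g5], rule exI[of _ g6], rule exI[of _ g7], rule exI[of _ g8], rule exI[of _ e], rule exI[of _ e'],
        rule conjI[OF all_bholo], intro allI impI, unfold Let_def, rule sum[unfolded A_def B_def cc_def])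
qed

theorem theorem1p2:
  fixes \<beta> h :: real and K\<^sub>D :: kernel
  assumes "\<beta> > pi"
    and "nu \<beta> / 2 < h" and "h < min (1 / 2) (3 * nu \<beta> / 2)"
    and szego: "is_szego_kernel \<beta> K\<^sub>D"
    and known_expansion:
      "\<forall>w\<in>worm \<beta>. \<forall>z\<in>worm \<beta>. ((\<lambda>j. szego_term \<beta> j w z) has_sum K\<^sub>D w z) UNIV"
  shows "\<exists>U. open U \<and> closure (worm \<beta>) \<subseteq> U \<and>
    (\<forall>\<sigma>\<in>{1, -1 :: real}. \<exists>\<rho>\<^sub>1 \<rho>\<^sub>2 G\<^sub>1 G\<^sub>2 G\<^sub>3 G\<^sub>4 G\<^sub>5 G\<^sub>6 G\<^sub>7 G\<^sub>8 E E'.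
      (\<forall>f\<in>{\<rho>\<^sub>1, \<rho>\<^sub>2, G\<^sub>1, G\<^sub>2, G\<^sub>3, G\<^sub>4, G\<^sub>5, G\<^sub>6, G\<^sub>7, G\<^sub>8, E, E'}. admissible \<beta> U f) \<and>
      (\<forall>w\<in>worm \<beta>. \<forall>z\<in>worm \<beta>. sgn1 (Re (fst w - cnj (fst z))) = \<sigma> \<longrightarrow>
        (let u = fst w - cnj (fst z);
             p = snd w * cnj (snd z);
             A = exp ((of_real pi - \<i> * u) / 2);
             B = exp (- ((\<i> * u + of_real pi) / 2));
             c = complex_of_real (exp (\<beta> - pi / 2));
             d = complex_of_real (exp (- (\<beta> - pi / 2)));
             b = complex_of_real (2 * \<beta>);
             K = \<rho>\<^sub>1 w z / (A - p) + \<rho>\<^sub>2 w z / (B - p) + E w z;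
             K' = G\<^sub>1 w z / ((\<i> * u + b) * (c - p))
                + G\<^sub>2 w z / ((B - p) * (\<i> * u + b))
                + G\<^sub>3 w z / ((A - p) * (c - p))
                + G\<^sub>4 w z / ((A - p) * (\<i> * u - b))
                + G\<^sub>5 w z / ((\<i> * u - b) * (d - p))
                + G\<^sub>6 w z / ((B - p) * (d - p))
                + G\<^sub>7 w z / (A - p)
                + G\<^sub>8 w z / (B - p)
                + E' w z
         in K\<^sub>D w z = exp (- of_real \<sigma> * (u * of_real (nu \<beta>) / 2)) * K
                     + exp (- of_real \<sigma> * (u * of_real h)) * K')))"
proof -
  define c where "c = 2 * \<beta> - pi"
  define U where "U = nbhd (closure (worm \<beta>)) (worm_radius \<beta> / 2)"
  have c: "pi < c" using assms(1) by (simp add: c_def)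
  then have c0: "0 < c" using pi_gt_zero by linarith
  have nu: "nu \<beta> / 2 = pi / (2 * c)" "3 * nu \<beta> / 2 = 3 * pi / (2 * c)"
    using c0 by (simp_all add: nu_def c_def)
  have h: "pi / (2 * c) < h" "h < 1 / 2" "h < 3 * pi / (2 * c)"
    using assms(2,3) unfolding nu by auto
  have "0 < worm_radius \<beta> / 2" by (simp add: worm_radius_def)
  then have U: "open U" "closure (worm \<beta>) \<subseteq> U"
    unfolding U_def by (simp_all add: open_nbhd subset_nbhd)
  let ?k = "\<lambda>\<Phi> w z. \<Phi> (fst w - cnj (fst z)) (snd w * cnj (snd z)) :: complex"
  have adm: "admissible \<beta> U (?k \<Phi>)" if "bholo c \<Phi>" for \<Phi>
    using that unfolding U_def c_def by (rule admissible_bholo)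
  have const_eqs: "exp (\<beta> - pi / 2) = exp (c / 2)" "exp (- (\<beta> - pi / 2)) = exp (- (c / 2))" "2 * \<beta> = pi + c"
    by (simp_all add: c_def field_simps)
  have half: "u * of_real (nu \<beta>) / 2 = u * of_real (pi / (2 * c))" for u :: complex
    unfolding nu(1)[symmetric] by simp
  show ?thesis
  proof (rule exI[of _ U], rule conjI[OF U(1)], rule conjI[OF U(2)], rule ballI, goal_cases)
    case (1 \<sigma>)
    from series_decomposition[OF c h 1] show ?case
    proof (elim exE conjE, goal_cases)
      case (1 \<rho>\<^sub>1 \<rho>\<^sub>2 G\<^sub>1 G\<^sub>2 G\<^sub>3 G\<^sub>4 G\<^sub>5 G\<^sub>6 G\<^sub>7 G\<^sub>8 E E')
      have all_adm: "\<forall>f\<in>{?k \<rho>\<^sub>1, ?k \<rho>\<^sub>2, ?k G\<^sub>1, ?k G\<^sub>2, ?k G\<^sub>3, ?k G\<^sub>4, ?k G\<^sub>5, ?k G\<^sub>6, ?k G\<^sub>7, ?k G\<^sub>8, ?k E, ?k E'}. admissible \<beta> U f"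
        using 1(1) adm by simp
      note sum = 1(2)
      show ?case
      proof (rule exI[of _ "?k \<rho>\<^sub>1"], rule exI[of _ "?k \<rho>\<^sub>2"], rule exI[of _ "?k G\<^sub>1"], rule exI[of _ "?k G\<^sub>2"],
          rule exI[of _ "?k G\<^sub>3"], rule exI[of _ "?k G\<^sub>4"], rule exI[of _ "?k G\<^sub>5"], rule exI[of _ "?k G\<^sub>6"],
          rule exI[of _ "?k G\<^sub>7"], rule exI[of _ "?k G\<^sub>8"], rule exI[of _ "?k E"], rule exI[of _ "?k E'"],
          rule conjI[OF all_adm], intro ballI impI, goal_cases)
        case (1 w z)
        have K: "((\<lambda>j. series_term c j (fst w - cnj (fst z)) (snd w * cnj (snd z))) has_sum K\<^sub>D w z) UNIV"
          using known_expansion[rule_format, OF 1(1,2)] unfolding szego_term_eq c_def .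
        note S = sum[rule_format, OF worm_inner_point[OF 1(1,2), folded c_def], unfolded Let_def]
        show ?case
          unfolding Let_def half const_eqs by (rule has_sum_unique[OF K S])
      qed
    qed
  qed
qed

end
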